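(* Let $\phi\in\mathcal{B}$ be such that $\phi(\infty)=\infty$ with $\phi^{\mathfrak t}\in\mathcal{B}_{\mathcal J}$ for all $\mathfrak t\in(0,1)$, and let $(\nu_t)_{t\ge0}$ be the corresponding Berg-Urbanik semigroup. For any $t>0$, $\nu_t\in\mathtt{C}_0^\infty(\mathbb{R}_+)$, i.e. $\nu_t(dx)=\nu_t(x)dx$, $x>0$, and the densities $\nu_t(x)$ satisfy $$\nu_t(x^t)\stackrel{\infty}{\sim}\frac{C_\phi^t}{\sqrt{2\pi t}}\sqrt{x^{1-t}\varphi'(x)}\exp\left(-t\int_{\mathsf k}^x\frac{\varphi(r)}{r}dr\right),$$ where $C_\phi>0$ is a constant depending only on $\phi$, and $\varphi:[\mathsf k,\infty)\to[0,\infty)$ is the continuous inverse of $\phi$. Furthermore, for any $n\in\mathbb{N}$ and $t>0$, the successive derivatives of the density satisfy $$\nu_t^{(n)}(x^t)\stackrel{\infty}{\sim}(-1)^nx^{-nt}\varphi^n(x)\,\nu_t(x^t).$$ These can be specified as follows. (1) If $\phi\in\mathcal{B}_d$ then $$\nu_t(x^t)\stackrel{\infty}{\sim}\frac{\tilde C_\phi^t}{\sqrt{2\pi t}}\,x^{\frac{\mathsf d+t(2\mathsf k-\mathsf d)}{2\mathsf d}}\exp\left(-\frac{tx}{\mathsf d}+\frac{t}{\mathsf d}\int_{\mathsf k}^x\frac{E(r)}{r}dr\right),$$ where $\tilde C_\phi>0$ is a constant, and $E(u)\ge0$ satisfies $E(u)\stackrel{\infty}{=}\mathrm{o}(u)$.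 Furthermore, for any $n\in\mathbb{N}$ and $t>0$, $$\nu_t^{(n)}(x^t)\stackrel{\infty}{\sim}(-1)^n\mathsf d^{-n}x^{n(1-t)}\nu_t(x^t).$$ (2) If $\phi(u)\stackrel{\infty}{\sim}C_\alpha u^\alpha$, for a constant $C_\alpha>0$ and $\alpha\in(0,1)$, then $$\nu_t(x^t)\stackrel{\infty}{\sim}\frac{\bar C_\phi^t}{\sqrt{2\pi t}}\,x^{\frac{1-\alpha t}{2\alpha}}\exp\left(-t\alpha C_\alpha^{-\frac1\alpha}x^{\frac1\alpha}+t\int_{\mathsf k}^x\frac{H(r)}{r}dr\right),$$ where $\bar C_\phi>0$ is a constant, and $H(u^\alpha)\stackrel{\infty}{=}\mathrm{o}(u)$. Furthermore, for any $n\in\mathbb{N}$ and $t>0$, $$\nu_t^{(n)}(x^t)\stackrel{\infty}{\sim}(-1)^nC_\alpha^{-\frac n\alpha}x^{\frac n\alpha(1-\alpha t)}\nu_t(x^t).$$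
   Context: Notation: $f(x)\stackrel{\infty}{\sim}g(x)$ means $\lim_{x\to\infty}f(x)/g(x)=1$, and $f(x)\stackrel{\infty}{=}\mathrm{o}(g(x))$ means $\lim_{x\to\infty}f(x)/g(x)=0$. $\nu_t^{(n)}(x^t)$ is the $n$-th derivative of the density $\nu_t$ evaluated at the point $x^t$; $\varphi^n(x)=(\varphi(x))^n$. Bernstein functions: $\mathcal{B}$ is the set of functions $\phi:[0,\infty)\to[0,\infty)$ of the form $\phi(u)=\mathsf{k}+\mathsf{d}u+\int_0^\infty(1-e^{-uy})\mu(dy)$, where $\mathsf{k},\mathsf{d}\ge0$ and $\mu$ is a Radon measure on $(0,\infty)$ with $\int_0^\infty(1\wedge y)\mu(dy)<\infty$; $(\mathsf{k},\mathsf{d},\mu)$ is uniquely determined by $\phi$, and $\mathsf k=\phi(0)$. $\phi(\infty)=\lim_{u\to\infty}\phi(u)$. $\mathcal{B}_d=\{\phi\in\mathcal B:\mathsf d>0\}$; $\mathcal{B}_{\mathcal J}=\{\phi\in\mathcal B:\mu(dy)=v(y)dy\text{ with }v\text{ non-increasing}\}$. $\phi^{\mathfrak t}$ denotes $u\mapsto\phi(u)^{\mathfrak t}$. Berg-Urbanik semigroup: a family $(\nu_t)_{t\ge0}$ of probability measures is a multiplicative convolution semigroup if $\nu_t\diamond\nu_s=\nu_{t+s}$ for all $t,s\ge0$, where $\diamond$ is the product convolution on the multiplicative group $(\mathbb{R}_+,\times)$, $\mathbb{R}_+=(0,\infty)$. The Berg-Urbanik semigroup associated to $\phi\in\mathcal{B}$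 is the unique multiplicative convolution semigroup of probability measures such that $\int_0^\infty x^z\nu_t(dx)=e^{t\Psi(z)}$ for all $t\ge0$ and $\mathrm{Re}(z)>0$, where $$\Psi(z)=z\log\phi(1)+\int_0^\infty\big(e^{-zy}-1-z(e^{-y}-1)\big)\frac{\kappa(dy)}{y(e^y-1)},$$ and $\kappa$ is the measure with $\int_0^\infty e^{-uy}\kappa(dy)=\frac{\phi'(u)}{\phi(u)}$. In particular $\int_0^\infty x^n\nu_t(dx)=\big(\prod_{k=1}^n\phi(k)\big)^t$ for all $n\in\mathbb{N}$. $\mathtt{C}_0^\infty(\mathbb{R}_+)$ is the set of infinitely differentiable functions on $\mathbb{R}_+$ that, together with all their derivatives, are continuous with limit zero at infinity; $\nu_t\in\mathtt{C}_0^\infty(\mathbb{R}_+)$ means that $\nu_t$ has a Lebesgue density in this space.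
   Formalization: In (1) and (2) the constants must depend on t: C̃_φ^t is replaced by c^t d^{-1/2} and C̄_φ^t by c^t (C_α^{-1/α}/α)^{1/2}, with c>0 independent of t and x; with t-free constants the displayed formulas fail, e.g. for φ(u)=d·u, d≠1. *)

theory Defs
  imports "HOL-Probability.Probability" "HOL-Library.Landau_Symbols"
begin

text \<open>
  Measures on the open half-line are Borel measures on \<open>real\<close> that do not charge
  \<open>{..0}\<close>, and functions on \<open>[0,\<infinity>)\<close> or \<open>(0,\<infinity>)\<close> are functions
  \<open>real \<Rightarrow> real\<close> about which nothing is required outside that domain.
\<close>

definition pos_measure :: "real measure \<Rightarrow> bool" where
  "pos_measure M \<longleftrightarrow> sets M = sets borel \<and> emeasure M {..0} = 0"

text \<open>
  \<open>\<phi>\<close> is the Bernstein function with triplet \<open>(k, d, \<mu>)\<close>. The integrability condition makes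
  \<open>\<mu>\<close> finite on compact subsets of \<open>(0,\<infinity>)\<close>, hence Radon there, and makes the
  Bochner integral a genuine one.
\<close>

definition bernstein_triplet ::
  "(real \<Rightarrow> real) \<Rightarrow> real \<Rightarrow> real \<Rightarrow> real measure \<Rightarrow> bool" where
  "bernstein_triplet \<phi> k d \<mu> \<longleftrightarrow>
     0 \<le> k \<and> 0 \<le> d \<and> pos_measure \<mu> \<and>
     (\<integral>\<^sup>+ y. ennreal (min 1 y) \<partial>\<mu>) < \<infinity> \<and>
     (\<forall>u\<ge>0. \<phi> u = k + d * u + (\<integral> y. (1 - exp (- (u * y))) \<partial>\<mu>))"

definition Bernstein_J :: "(real \<Rightarrow> real) set" where
  "Bernstein_J = {\<phi>. \<exists>k d v.
     antimono_on {0<..} v \<and> (\<forall>y>0. 0 \<le> v y) \<and>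
     bernstein_triplet \<phi> k d
       (density lborel (\<lambda>y. ennreal (v y) * indicator {0<..} y))}"

definition bernstein_inv :: "(real \<Rightarrow> real) \<Rightarrow> real \<Rightarrow> real" where
  "bernstein_inv \<phi> = the_inv_into {0..} \<phi>"

definition mult_convolution :: "real measure \<Rightarrow> real measure \<Rightarrow> real measure" where
  "mult_convolution M N = distr (M \<Otimes>\<^sub>M N) borel (\<lambda>(x, y). x * y)"

definition mult_conv_semigroup :: "(real \<Rightarrow> real measure) \<Rightarrow> bool" where
  "mult_conv_semigroup \<nu> \<longleftrightarrow>
     (\<forall>t\<ge>0. prob_space (\<nu> t) \<and> pos_measure (\<nu> t)) \<and>
     (\<forall>t\<ge>0. \<forall>s\<ge>0. mult_convolution (\<nu> t) (\<nu> s) = \<nu> (t + s))"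

text \<open>The measure \<open>\<kappa>\<close> whose Laplace transform is the logarithmic derivative of \<open>\<phi>\<close>.\<close>

definition log_deriv_measure :: "(real \<Rightarrow> real) \<Rightarrow> real measure \<Rightarrow> bool" where
  "log_deriv_measure \<phi> \<kappa> \<longleftrightarrow>
     pos_measure \<kappa> \<and>
     (\<forall>u>0. has_bochner_integral \<kappa> (\<lambda>y. exp (- (u * y))) (deriv \<phi> u / \<phi> u))"

definition berg_urbanik_exponent ::
  "(real \<Rightarrow> real) \<Rightarrow> real measure \<Rightarrow> complex \<Rightarrow> complex" where
  "berg_urbanik_exponent \<phi> \<kappa> z =
     z * of_real (ln (\<phi> 1)) +
     (\<integral> y. (exp (- (z * of_real y)) - 1 - z * of_real (exp (- y) - 1))
             / of_real (y * (exp y - 1)) \<partial>\<kappa>)"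

text \<open>
  The measure \<open>\<kappa>\<close> is unique, by uniqueness of Laplace transforms. Since the exponential
  never vanishes, the Mellin identity forces \<open>x powr z\<close> to be \<open>\<nu> t\<close>-integrable.
\<close>

definition berg_urbanik_semigroup ::
  "(real \<Rightarrow> real) \<Rightarrow> (real \<Rightarrow> real measure) \<Rightarrow> bool" where
  "berg_urbanik_semigroup \<phi> \<nu> \<longleftrightarrow>
     mult_conv_semigroup \<nu> \<and>
     (\<exists>\<kappa>. log_deriv_measure \<phi> \<kappa> \<and>
        (\<forall>t\<ge>0. \<forall>z. Re z > 0 \<longrightarrow>
           (\<integral> x. of_real x powr z \<partial>\<nu> t)
             = exp (of_real t * berg_urbanik_exponent \<phi> \<kappa> z)))"

text \<open>
  Smooth functions on \<open>(0,\<infinity>)\<close> all of whose derivatives vanish at infinity; no condition is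
  imposed at \<open>0\<close>.
\<close>

definition C0_infinity :: "(real \<Rightarrow> real) set" where
  "C0_infinity = {f. \<forall>n.
     (\<forall>x>0. (deriv ^^ n) f differentiable (at x)) \<and>
     ((deriv ^^ n) f \<longlongrightarrow> 0) at_top}"

definition has_pos_density :: "real measure \<Rightarrow> (real \<Rightarrow> real) \<Rightarrow> bool" where
  "has_pos_density M f \<longleftrightarrow>
     (\<forall>x>0. 0 \<le> f x) \<and>
     M = density lborel (\<lambda>x. ennreal (f x) * indicator {0<..} x)"

end

theory Submission
  imports Defs "HOL-Real_Asymp.Real_Asymp"
begin

text \<open>
  Write \<open>g = \<phi>' / \<phi>\<close>, which is the Laplace transform of \<open>\<kappa>\<close>, and \<open>\<Psi>\<close> for the exponent, so that the Mellin
  transform of \<open>\<nu>\<^sub>t\<close> is \<open>exp (t \<Psi>)\<close>. Let \<open>X\<close> have law \<open>\<nu>\<^sub>t\<close>. Tilting the law of \<open>ln X\<close> by \<open>exp (a ln X)\<close> gives a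
  probability measure with characteristic function \<open>b \<mapsto> exp (t (\<Psi>(a + ib) - \<Psi>(a)))\<close>. As \<open>a \<rightarrow> \<infinity>\<close> this law,
  centred at \<open>t ln (\<phi> a)\<close> and divided by \<open>sqrt (t g(a))\<close>, becomes Gaussian, also locally. Fourier inversion of
  the tilted law therefore gives the density of \<open>\<nu>\<^sub>t\<close> at \<open>(\<phi> a) powr t\<close>: every \<open>x = \<phi> a\<close> is treated with
  its own tilting parameter, and this is the saddle point method. Differentiating the inversion formula
  \<open>n\<close> times inserts the factor \<open>(-1)\<^sup>n (z + 1) \<cdots> (z + n)\<close> with \<open>z = a + ib\<close>, which is
  asymptotically \<open>(-1)\<^sup>n a\<^sup>n\<close>. Two facts make this work.
  
  The first is an integrable majorant for the characteristic functions, uniform in \<open>a\<close>. This is what the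
  assumption on the powers \<open>\<phi>\<^sup>\<tau>\<close> is for. If \<open>v\<^sub>\<tau>\<close> is the nonincreasing density of the measure of \<open>\<phi>\<^sup>\<tau>\<close>, then
  \<open>\<tau> \<phi>\<^sup>\<tau> g\<close> is the Laplace transform of \<open>y v\<^sub>\<tau>(y)\<close>; letting \<open>\<tau> \<rightarrow> 0\<close> shows that \<open>\<kappa>\<close> satisfies the
  integral inequalities that hold for \<open>y\<close> times any nonincreasing density (\<open>kappa_positivity\<close>). Two of them are used.
  One says that \<open>a\<^sup>2 g(a)\<close> is nondecreasing (\<open>g_scaled_mono\<close>); the other, integrated in \<open>b\<close>, says that with \<open>A = a + 1\<close>
  the real part of \<open>\<Psi>\<close> drops by at least \<open>A\<^sup>2 g(A) ln (1 + b\<^sup>2/A\<^sup>2) / 2\<close> between \<open>a\<close> and \<open>a + ib\<close>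
  (\<open>decay_lower\<close>). With \<open>b = \<theta> / sqrt (t g(A))\<close> and \<open>m = t A\<^sup>2 g(A)\<close> the normalised characteristic function is thus
  bounded by \<open>(1 + \<theta>\<^sup>2/m) powr (- m/2)\<close>, which decreases in \<open>m\<close>. Since \<open>\<phi>\<close> is unbounded, \<open>m\<close> tends to infinity
  (\<open>g_scaled_at_top\<close>); so there is a majorant that decays like any given power of \<open>\<theta>\<close>. On a fixed
  line the bound holds for all larger \<open>A\<close> as well, which makes the densities smooth.
  
  The second is the value of \<open>\<Psi>\<close> on the real axis up to \<open>o(1)\<close>: by Binet's argument \<open>\<Psi>(a)\<close> is
  \<open>(a + 1/2) ln (\<phi> a)\<close> minus the integral of \<open>u g(u)\<close> from \<open>1\<close> to \<open>a\<close>, plus a constant (\<open>stirling\<close>). The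
  substitution \<open>r = \<phi> u\<close> turns that integral into the integral of \<open>inv\<phi> r / r\<close> in the theorem.
  
  The two special cases only require the asymptotics of the inverse function and of its derivative. With
  positive drift \<open>\<phi>' \<rightarrow> d\<close>; under power growth the derivative is found by the monotone density theorem
  (\<open>dphi_power_ratio\<close>).
\<close>

section \<open>Differentiation under a Lebesgue integral\<close>

lemma has_vector_derivative_iff_quotient:
  fixes f :: "real \<Rightarrow> 'b :: real_normed_vector"
  shows "(f has_vector_derivative D) (at x) \<longleftrightarrow> ((\<lambda>u. (f u - f x) /\<^sub>R (u - x)) \<longlongrightarrow> D) (at x)"
proof -
  have eq: "norm ((f u - f x) /\<^sub>R (u - x) - D) = norm (f u - f x - (u - x) *\<^sub>R D) / norm (u - x)"
    if "u \<noteq> x" for u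
  proof -
    have "(f u - f x) /\<^sub>R (u - x) - D = (f u - f x - (u - x) *\<^sub>R D) /\<^sub>R (u - x)"
      using that by (simp add: scaleR_diff_right)
    then show ?thesis by (simp add: divide_inverse_commute)
  qed
  have "((\<lambda>u. (f u - f x) /\<^sub>R (u - x)) \<longlongrightarrow> D) (at x)
    \<longleftrightarrow> ((\<lambda>u. norm ((f u - f x) /\<^sub>R (u - x) - D)) \<longlongrightarrow> 0) (at x)"
    by (simp add: Lim_null[where l=D] tendsto_norm_zero_iff)
  also have "\<dots> \<longleftrightarrow> ((\<lambda>u. norm (f u - f x - (u - x) *\<^sub>R D) / norm (u - x)) \<longlongrightarrow> 0) (at x)"
    by (rule filterlim_cong) (auto simp: eventually_at_filter eq)
  finally show ?thesis
    unfolding has_vector_derivative_def has_derivative_iff_norm by (simp add: bounded_linear_scaleR_left)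
qed

text \<open>
  By the mean value inequality the difference quotients are dominated by a multiple of \<open>h\<close>, so
  dominated convergence applies. The parameter ranges over an open convex set, so that bounds which
  hold only locally in the parameter suffice.
\<close>

lemma has_vector_derivative_lebesgue_integral:
  fixes f :: "real \<Rightarrow> 'a \<Rightarrow> 'b :: {banach, second_countable_topology}"
  assumes S: "open S" "convex S" and x: "x \<in> S"
    and int: "\<And>u. u \<in> S \<Longrightarrow> integrable M (f u)"
    and meas: "f' x \<in> borel_measurable M"
    and deriv: "AE y in M. \<forall>u\<in>S. ((\<lambda>u. f u y) has_vector_derivative f' u y) (at u) \<and> norm (f' u y) \<le> h y"
    and h: "integrable M h"
  shows "((\<lambda>u. \<integral>y. f u y \<partial>M) has_vector_derivative (\<integral>y. f' x y \<partial>M)) (at x)"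
    and "integrable M (f' x)"
proof -
  show "integrable M (f' x)"
    by (rule Bochner_Integration.integrable_bound[OF h meas]) (use deriv x in \<open>auto elim!: eventually_mono\<close>)
  have "((\<lambda>u. ((\<integral>y. f u y \<partial>M) - (\<integral>y. f x y \<partial>M)) /\<^sub>R (u - x)) \<longlongrightarrow> (\<integral>y. f' x y \<partial>M)) (at x within S)"
    unfolding tendsto_at_iff_sequentially comp_def
  proof (intro allI impI)
    fix X :: "nat \<Rightarrow> real" assume X: "\<forall>i. X i \<in> S - {x}" and lim: "X \<longlonglongrightarrow> x"
    have eq: "((\<integral>y. f (X i) y \<partial>M) - (\<integral>y. f x y \<partial>M)) /\<^sub>R (X i - x) = (\<integral>y. (f (X i) y - f x y) /\<^sub>R (X i - x) \<partial>M)" for i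
      using int[of "X i"] int[OF x] X by (subst Bochner_Integration.integral_diff[symmetric]) auto
    show "(\<lambda>i. ((\<integral>y. f (X i) y \<partial>M) - (\<integral>y. f x y \<partial>M)) /\<^sub>R (X i - x)) \<longlonglongrightarrow> (\<integral>y. f' x y \<partial>M)"
      unfolding eq
    proof (rule integral_dominated_convergence)
      show "f' x \<in> borel_measurable M" by (rule meas)
      show "(\<lambda>y. (f (X i) y - f x y) /\<^sub>R (X i - x)) \<in> borel_measurable M" for i
        using int[of "X i"] int[OF x] X by auto
      show "integrable M (\<lambda>y. 3 * h y)" using h by simp
      show "AE y in M. (\<lambda>i. (f (X i) y - f x y) /\<^sub>R (X i - x)) \<longlonglongrightarrow> f' x y"
        using deriv
      proof eventually_elim
        case (elim y)
        with x have "((\<lambda>u. f u y) has_vector_derivative f' x y) (at x)" by auto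
        then have "((\<lambda>u. (f u y - f x y) /\<^sub>R (u - x)) \<longlongrightarrow> f' x y) (at x)"
          by (simp add: has_vector_derivative_iff_quotient)
        then show ?case
          using X lim unfolding tendsto_at_iff_sequentially comp_def by auto
      qed
      show "AE y in M. norm ((f (X i) y - f x y) /\<^sub>R (X i - x)) \<le> 3 * h y" for i
        using deriv
      proof eventually_elim
        case (elim y)
        have "X i \<in> S" using X by simp
        then have seg: "closed_segment x (X i) \<subseteq> S" using x S(2) by (intro closed_segment_subset)
        have a: "norm (f (X i) y - f x y - (X i - x) *\<^sub>R f' x y) \<le> norm (X i - x) * (2 * h y)"
        proof (rule vector_differentiable_bound_linearization[where S=S and f'="\<lambda>u. f' u y"])
          fix u assume u: "u \<in> S"
          have a: "((\<lambda>u. f u y) has_vector_derivative f' u y) (at u)" "norm (f' u y) \<le> h y"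
            using elim u by blast+
          have b: "norm (f' x y) \<le> h y" using elim x by blast
          show "norm (f' u y - f' x y) \<le> 2 * h y"
            using a(2) b norm_triangle_ineq4[of "f' u y" "f' x y"] by linarith
          show "((\<lambda>u. f u y) has_vector_derivative f' u y) (at u within S)"
            by (rule has_vector_derivative_at_within[OF a(1)])
        qed (rule seg, rule x)
        have b: "norm (f (X i) y - f x y) \<le> norm (f (X i) y - f x y - (X i - x) *\<^sub>R f' x y) + norm ((X i - x) *\<^sub>R f' x y)"
          using norm_triangle_ineq[of "f (X i) y - f x y - (X i - x) *\<^sub>R f' x y" "(X i - x) *\<^sub>R f' x y"]
          by (simp only: diff_add_cancel)
        have c: "norm ((X i - x) *\<^sub>R f' x y) \<le> norm (X i - x) * h y"
          using bspec[OF elim x] unfolding norm_scaleR real_norm_def by (intro mult_left_mono) auto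
        have d: "r * (2 * h y) + r * h y = 3 * h y * r" for r
          by (simp add: algebra_simps)
        have "norm (f (X i) y - f x y) \<le> 3 * h y * norm (X i - x)"
          using order_trans[OF b add_mono[OF a c]] unfolding d .
        then have "norm (f (X i) y - f x y) / norm (X i - x) \<le> 3 * h y"
          using X by (subst pos_divide_le_eq) auto
        then show ?case by (simp only: norm_scaleR abs_inverse real_norm_def divide_inverse mult.commute)
      qed
    qed
  qed
  then have lim: "((\<lambda>u. ((\<integral>y. f u y \<partial>M) - (\<integral>y. f x y \<partial>M)) /\<^sub>R (u - x)) \<longlongrightarrow> (\<integral>y. f' x y \<partial>M)) (at x)"
    using at_within_open[OF x S(1)] by (simp only:)
  show "((\<lambda>u. \<integral>y. f u y \<partial>M) has_vector_derivative (\<integral>y. f' x y \<partial>M)) (at x)"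
    using lim by (subst has_vector_derivative_iff_quotient)
qed

lemma pos_measure_AE:
  assumes "pos_measure M"
  shows "AE y in M. 0 < y"
proof (rule AE_I[of _ _ "{..0}"])
  have "space M = UNIV" using assms sets_eq_imp_space_eq[of M borel] by (simp add: pos_measure_def)
  then show "{y \<in> space M. \<not> 0 < y} \<subseteq> {..0}" by auto
qed (use assms in \<open>simp_all add: pos_measure_def\<close>)

section \<open>Bernstein functions and their inverses\<close>

lemma one_minus_exp_le: "1 - exp (- (u * y)) \<le> (1 + u) * min 1 y" if "0 \<le> u" "0 < y" for u y :: real
proof -
  have "1 - exp (- (u * y)) \<le> u * y" using exp_ge_add_one_self[of "-(u * y)"] by simp
  moreover have "1 - exp (- (u * y)) \<le> 1 + u" using that(1) exp_gt_zero[of "- (u * y)"] by linarith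
  moreover have "0 \<le> u * y" using that by simp
  moreover have "(1 + u) * y = y + u * y" by (simp add: algebra_simps)
  ultimately show ?thesis using that by (cases "y \<le> 1") (simp_all add: min_def)
qed

lemma mult_exp_le: "y * exp (- (u * y)) \<le> 1 / u" if "0 < u" for u y :: real
proof -
  have "u * y \<le> exp (u * y)" using exp_ge_add_one_self[of "u * y"] by linarith
  then have "u * y * exp (- (u * y)) \<le> 1" by (simp add: exp_minus field_simps)
  then show ?thesis using that by (simp add: field_simps)
qed

text \<open>
  Elementary facts on a Bernstein function \<open>\<phi>\<close>, all obtained by integrating the corresponding
  property of \<open>u \<mapsto> 1 - exp (- u y)\<close> against \<open>\<mu>\<close>. The integrand is at most
  \<open>(1 + u) min 1 y\<close>, which is integrable by the definition of a triplet.
\<close>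

locale bernstein =
  fixes \<phi> :: "real \<Rightarrow> real" and k d :: real and \<mu> :: "real measure"
  assumes triplet: "bernstein_triplet \<phi> k d \<mu>"
begin

lemma k_nonneg: "0 \<le> k" and d_nonneg: "0 \<le> d" and pos_mu: "pos_measure \<mu>"
  and phi_eq: "0 \<le> u \<Longrightarrow> \<phi> u = k + d * u + (\<integral> y. (1 - exp (- (u * y))) \<partial>\<mu>)"
  using triplet unfolding bernstein_triplet_def by auto

lemma sets_mu [measurable_cong]: "sets \<mu> = sets borel"
  using pos_mu by (simp add: pos_measure_def)

lemmas AE_mu = pos_measure_AE[OF pos_mu]

lemma integrable_min: "integrable \<mu> (\<lambda>y. min 1 y)"
proof (rule integrableI_nonneg)
  show "AE y in \<mu>. 0 \<le> min 1 y" using AE_mu by eventually_elim auto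
  show "(\<integral>\<^sup>+ y. ennreal (min 1 y) \<partial>\<mu>) < \<infinity>"
    using triplet unfolding bernstein_triplet_def by auto
qed auto

lemma integrable_one_minus_exp: "integrable \<mu> (\<lambda>y. 1 - exp (- (u * y)))" if "0 \<le> u"
proof (rule Bochner_Integration.integrable_bound)
  show "integrable \<mu> (\<lambda>y. (1 + u) * min 1 y)" using integrable_min by simp
  show "AE y in \<mu>. norm (1 - exp (- (u * y))) \<le> norm ((1 + u) * min 1 y)"
    using AE_mu
  proof eventually_elim
    case (elim y)
    then have "0 \<le> 1 - exp (- (u * y))" using that by simp
    then show ?case using one_minus_exp_le[OF that elim] by simp
  qed
qed auto

lemma phi_0: "\<phi> 0 = k"
  by (simp add: phi_eq)

lemma phi_mono: "\<phi> u \<le> \<phi> v" if "0 \<le> u" "u \<le> v"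
proof -
  have "(\<integral> y. (1 - exp (- (u * y))) \<partial>\<mu>) \<le> (\<integral> y. (1 - exp (- (v * y))) \<partial>\<mu>)"
    using AE_mu that
    by (intro integral_mono_AE integrable_one_minus_exp) (auto elim!: eventually_mono intro!: mult_right_mono)
  moreover have "d * u \<le> d * v" using that d_nonneg by (intro mult_left_mono)
  ultimately show ?thesis using that by (simp add: phi_eq)
qed

lemma k_le_phi: "0 \<le> u \<Longrightarrow> k \<le> \<phi> u"
  using phi_mono[of 0 u] by (simp add: phi_0)

text \<open>
  Concavity together with \<open>\<phi> 0 \<ge> 0\<close>. It gives the linear upper bound of \<open>\<phi>\<close> at infinity and the linear
  lower bound near \<open>0\<close>.
\<close>

lemma phi_star: "c * \<phi> u \<le> \<phi> (c * u)" if "0 \<le> u" "0 \<le> c" "c \<le> 1"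
proof -
  have "(\<integral> y. c * (1 - exp (- (u * y))) \<partial>\<mu>) \<le> (\<integral> y. (1 - exp (- (c * u * y))) \<partial>\<mu>)"
  proof (rule integral_mono_AE)
    show "AE y in \<mu>. c * (1 - exp (- (u * y))) \<le> 1 - exp (- (c * u * y))"
    proof (intro always_eventually allI)
      fix y
      have "exp ((1 - c) * 0 + c * (- (u * y))) \<le> (1 - c) * exp 0 + c * exp (- (u * y))"
        using convex_onD[OF exp_convex, of c 0 "- (u * y)"] that by simp
      then show "c * (1 - exp (- (u * y))) \<le> 1 - exp (- (c * u * y))"
        by (simp add: algebra_simps)
    qed
  qed (use that in \<open>auto intro!: integrable_one_minus_exp integrable_mult_right simp del: integrable_mult_right_iff\<close>)
  then have "c * (\<integral> y. 1 - exp (- (u * y)) \<partial>\<mu>) \<le> (\<integral> y. (1 - exp (- (c * u * y))) \<partial>\<mu>)" by simp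
  moreover have "c * k \<le> k" using that k_nonneg by (simp add: mult_left_le_one_le)
  ultimately have "c * k + c * (d * u) + c * (\<integral> y. 1 - exp (- (u * y)) \<partial>\<mu>) \<le> k + d * (c * u) + (\<integral> y. (1 - exp (- (c * u * y))) \<partial>\<mu>)"
    by (simp add: mult.left_commute)
  then show ?thesis using that by (simp add: phi_eq distrib_left)
qed

lemma phi_le_linear: "\<phi> u \<le> u * \<phi> 1" if "1 \<le> u"
  using phi_star[of u "1 / u"] that by (simp add: field_simps)

lemma phi_ge_linear: "u * \<phi> 1 \<le> \<phi> u" if "0 \<le> u" "u \<le> 1"
  using phi_star[of 1 u] that by simp

definition dphi :: "real \<Rightarrow> real" where
  "dphi u = d + (\<integral> y. y * exp (- (u * y)) \<partial>\<mu>)"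

lemma integrable_dphi: "integrable \<mu> (\<lambda>y. y * exp (- (u * y)))"
  and phi_deriv: "(\<phi> has_real_derivative dphi u) (at u)" if "0 < u"
proof -
  have *: "AE y in \<mu>. \<forall>v\<in>{u/2<..}. ((\<lambda>v. 1 - exp (- (v * y))) has_vector_derivative y * exp (- (v * y))) (at v) \<and> norm (y * exp (- (v * y))) \<le> (1 + 2 / u) * min 1 y"
    using AE_mu
  proof eventually_elim
    case (elim y)
    show ?case
    proof (intro ballI conjI)
      fix v assume v: "v \<in> {u/2<..}"
      show "((\<lambda>v. 1 - exp (- (v * y))) has_vector_derivative y * exp (- (v * y))) (at v)"
        unfolding has_real_derivative_iff_has_vector_derivative[symmetric]
        by (auto intro!: derivative_eq_intros)
      have "y * exp (- (v * y)) \<le> 1 / v" using v that by (intro mult_exp_le) auto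
      also have "\<dots> \<le> 2 / u" using v that by (simp add: field_simps)
      finally have 1: "y * exp (- (v * y)) \<le> 2 / u" .
      have 2: "y * exp (- (v * y)) \<le> y" using elim v that by (intro mult_left_le) auto
      have "y * exp (- (v * y)) \<le> (1 + 2 / u) * min 1 y"
      proof (cases "1 \<le> y")
        case True
        then show ?thesis using 1 by simp
      next
        case False
        have "(1 + 2 / u) * y \<ge> 1 * y" using elim that by (intro mult_right_mono) auto
        then show ?thesis using False 2 by simp
      qed
      then show "norm (y * exp (- (v * y))) \<le> (1 + 2 / u) * min 1 y"
        using elim by simp
    qed
  qed
  note L = has_vector_derivative_lebesgue_integral[where S="{u/2<..}" and x=u and M=\<mu>
     and f="\<lambda>u y. 1 - exp (- (u * y))" and f'="\<lambda>u y. y * exp (- (u * y))" and h="\<lambda>y. (1 + 2 / u) * min 1 y"]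
  have 1: "((\<lambda>u. \<integral>y. 1 - exp (- (u * y)) \<partial>\<mu>) has_vector_derivative (\<integral>y. y * exp (- (u * y)) \<partial>\<mu>)) (at u)"
    using that integrable_min by (intro L(1) *) (auto intro!: integrable_one_minus_exp)
  show "integrable \<mu> (\<lambda>y. y * exp (- (u * y)))"
    using that integrable_min by (intro L(2) *) (auto intro!: integrable_one_minus_exp)
  have "((\<lambda>u. k + d * u + (\<integral> y. (1 - exp (- (u * y))) \<partial>\<mu>)) has_real_derivative dphi u) (at u)"
    using 1 unfolding has_real_derivative_iff_has_vector_derivative[symmetric] dphi_def
    by (auto intro!: derivative_eq_intros)
  then show "(\<phi> has_real_derivative dphi u) (at u)"
    by (rule DERIV_cong_ev[THEN iffD1, rotated -1, of _ _ _ u])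
       (use that phi_eq in \<open>auto intro!: eventually_mono[OF eventually_nhds_in_open[of "{0<..}" u]]\<close>)
qed

lemma deriv_phi: "0 < u \<Longrightarrow> deriv \<phi> u = dphi u"
  using DERIV_imp_deriv[OF phi_deriv] .

lemma dphi_nonneg: "0 \<le> dphi u"
  unfolding dphi_def using AE_mu d_nonneg
  by (intro add_nonneg_nonneg integral_nonneg_AE) (auto elim!: eventually_mono)

lemma dphi_antimono: "dphi v \<le> dphi u" if "0 < u" "u \<le> v"
proof -
  have "(\<integral> y. y * exp (- (v * y)) \<partial>\<mu>) \<le> (\<integral> y. y * exp (- (u * y)) \<partial>\<mu>)"
    using AE_mu that
    by (intro integral_mono_AE integrable_dphi) (auto elim!: eventually_mono intro: mult_right_mono)
  then show ?thesis by (simp add: dphi_def)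
qed

lemma phi_continuous: "continuous_on {0..} \<phi>"
  unfolding continuous_on_sequentially comp_def
proof (intro allI ballI impI)
  fix X :: "nat \<Rightarrow> real" and u assume u: "u \<in> {0..}" and X: "(\<forall>n. X n \<in> {0..}) \<and> X \<longlonglongrightarrow> u"
  have X0: "0 \<le> X n" for n using X by auto
  have "convergent X" using X by (auto simp: convergent_def)
  then obtain B where B: "\<And>n. norm (X n) \<le> B" using convergent_imp_Bseq[of X] by (auto simp: Bseq_def)
  have "(\<lambda>n. \<integral> y. (1 - exp (- (X n * y))) \<partial>\<mu>) \<longlonglongrightarrow> (\<integral> y. (1 - exp (- (u * y))) \<partial>\<mu>)"
  proof (rule integral_dominated_convergence)
    show "integrable \<mu> (\<lambda>y. (1 + B) * min 1 y)" using integrable_min by simp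
    show "AE y in \<mu>. (\<lambda>n. 1 - exp (- (X n * y))) \<longlonglongrightarrow> 1 - exp (- (u * y))"
      using X by (auto intro!: tendsto_intros always_eventually)
    show "AE y in \<mu>. norm (1 - exp (- (X n * y))) \<le> (1 + B) * min 1 y" for n
      using AE_mu
    proof eventually_elim
      case (elim y)
      have "1 - exp (- (X n * y)) \<le> (1 + X n) * min 1 y" using elim X0 by (intro one_minus_exp_le)
      also have "\<dots> \<le> (1 + B) * min 1 y" using B[of n] elim by (intro mult_right_mono) auto
      finally moreover have "exp (- (X n * y)) \<le> 1" using elim X0[of n] by simp
      ultimately show ?case by simp
    qed
  qed auto
  then have "(\<lambda>n. k + d * X n + (\<integral> y. (1 - exp (- (X n * y))) \<partial>\<mu>)) \<longlonglongrightarrow> k + d * u + (\<integral> y. (1 - exp (- (u * y))) \<partial>\<mu>)"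
    using X by (intro tendsto_intros) auto
  then show "(\<lambda>n. \<phi> (X n)) \<longlonglongrightarrow> \<phi> u" using u X0 by (simp add: phi_eq)
qed

lemma dphi_tendsto: "(dphi \<longlongrightarrow> d) at_top"
proof -
  have "((\<lambda>u. \<integral> y. y * exp (- (u * y)) \<partial>\<mu>) \<longlongrightarrow> (\<integral> y. 0 \<partial>\<mu>)) at_top"
  proof (rule integral_dominated_convergence_at_top[OF _ _ integrable_dphi[of 1]])
    show "\<forall>\<^sub>F u in at_top. AE y in \<mu>. norm (y * exp (- (u * y))) \<le> y * exp (- (1 * y))"
      using eventually_ge_at_top[of 1]
    proof eventually_elim
      case (elim u)
      show ?case using AE_mu by eventually_elim (use elim in auto)
    qed
    show "AE y in \<mu>. ((\<lambda>u. y * exp (- (u * y))) \<longlongrightarrow> 0) at_top"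
      using AE_mu
    proof eventually_elim
      case (elim y)
      then show ?case by real_asymp
    qed
  qed auto
  then show ?thesis unfolding dphi_def by (auto intro!: tendsto_eq_intros)
qed

text \<open>
  The drift is the only linear part of \<open>\<phi>\<close>: for \<open>u \<ge> 1\<close> the quotients \<open>(1 - exp (- u y)) / u\<close> are
  dominated by \<open>2 min 1 y\<close> and tend to \<open>0\<close>.
\<close>

lemma phi_over_tendsto: "((\<lambda>u. \<phi> u / u) \<longlongrightarrow> d) at_top"
proof -
  have "((\<lambda>u. \<integral> y. (1 - exp (- (u * y))) / u \<partial>\<mu>) \<longlongrightarrow> (\<integral> y. 0 \<partial>\<mu>)) at_top"
  proof (rule integral_dominated_convergence_at_top[where w="\<lambda>y. 2 * min 1 y"])
    show "\<forall>\<^sub>F u in at_top. AE y in \<mu>. norm ((1 - exp (- (u * y))) / u) \<le> 2 * min 1 y"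
      using eventually_ge_at_top[of 1]
    proof eventually_elim
      case (elim u)
      show ?case using AE_mu
      proof eventually_elim
        case (elim y)
        then have "1 - exp (- (u * y)) \<le> (1 + u) * min 1 y" using \<open>1 \<le> u\<close> by (intro one_minus_exp_le) auto
        also have "\<dots> \<le> (2 * u) * min 1 y" using \<open>1 \<le> u\<close> elim by (intro mult_right_mono) auto
        finally have le: "1 - exp (- (u * y)) \<le> 2 * u * min 1 y" .
        have "(1 - exp (- (u * y))) / u \<le> 2 * u * min 1 y / u" using \<open>1 \<le> u\<close> by (intro divide_right_mono le) simp
        also have "\<dots> = 2 * min 1 y" using \<open>1 \<le> u\<close> by simp
        finally have "(1 - exp (- (u * y))) / u \<le> 2 * min 1 y" .
        moreover have "0 \<le> (1 - exp (- (u * y))) / u" using \<open>1 \<le> u\<close> elim by simp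
        ultimately show ?case by simp
      qed
    qed
    show "AE y in \<mu>. ((\<lambda>u. (1 - exp (- (u * y))) / u) \<longlongrightarrow> 0) at_top"
      using AE_mu
    proof eventually_elim
      case (elim y)
      then show ?case by real_asymp
    qed
  qed (use integrable_min in auto)
  moreover have "((\<lambda>u. k / u + d) \<longlongrightarrow> d) at_top" by real_asymp
  ultimately have "((\<lambda>u. k / u + d + (\<integral> y. (1 - exp (- (u * y))) / u \<partial>\<mu>)) \<longlongrightarrow> d + 0) at_top"
    by (intro tendsto_add) auto
  then have "((\<lambda>u. k / u + d + (\<integral> y. (1 - exp (- (u * y))) / u \<partial>\<mu>)) \<longlongrightarrow> d) at_top" by simp
  then show ?thesis
    by (rule Lim_transform_eventually)
       (use eventually_gt_at_top[of 0] in eventually_elim, simp add: phi_eq add_divide_distrib)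
qed

end

text \<open>
  An unbounded Bernstein function is not constant, hence strictly increasing, and it maps
  \<open>[0,\<infinity>)\<close> onto \<open>[k,\<infinity>)\<close>, where its inverse is therefore defined.
\<close>

locale unbounded_bernstein = bernstein +
  assumes phi_at_top: "filterlim \<phi> at_top at_top"
begin

text \<open>
  If the derivative vanished at one point, the drift would be \<open>0\<close> and \<open>\<mu>\<close> would be null, so \<open>\<phi>\<close> would
  be the constant \<open>k\<close>.
\<close>

lemma dphi_pos: "0 < dphi u" if u: "0 < u"
proof (rule ccontr)
  assume "\<not> 0 < dphi u"
  then have z: "dphi u = 0" using dphi_nonneg[of u] by simp
  have int: "0 \<le> (\<integral> y. y * exp (- (u * y)) \<partial>\<mu>)"
    using AE_mu by (intro integral_nonneg_AE) (auto elim!: eventually_mono)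
  then have d: "d = 0" and i: "(\<integral> y. y * exp (- (u * y)) \<partial>\<mu>) = 0"
    using z d_nonneg unfolding dphi_def by auto
  have "AE y in \<mu>. y * exp (- (u * y)) = 0"
    using i AE_mu by (subst integral_nonneg_eq_0_iff_AE[symmetric, OF integrable_dphi[OF u]]) (auto elim!: eventually_mono)
  then have F: "AE y in \<mu>. False" using AE_mu by eventually_elim auto
  have "\<phi> v = k" if "0 \<le> v" for v
  proof -
    have "(\<integral> y. (1 - exp (- (v * y))) \<partial>\<mu>) = (\<integral> y. 0 \<partial>\<mu>)"
    proof (rule integral_cong_AE)
      show "AE y in \<mu>. 1 - exp (- (v * y)) = 0" using F by (rule eventually_mono) simp
    qed auto
    then show ?thesis using d that by (simp add: phi_eq)
  qed
  moreover have "\<forall>\<^sub>F v in at_top. \<phi> v > k \<and> v \<ge> 0"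
    using phi_at_top by (intro eventually_conj eventually_ge_at_top) (auto simp: filterlim_at_top_dense)
  ultimately show False by (auto simp: eventually_at_top_linorder)
qed

lemma phi_strict_mono: "\<phi> u < \<phi> v" if "0 \<le> u" "u < v"
proof (rule DERIV_pos_imp_increasing_open[OF that(2)])
  fix x assume "u < x"
  then have "0 < x" using that by simp
  then show "\<exists>y. (\<phi> has_real_derivative y) (at x) \<and> 0 < y" using phi_deriv dphi_pos by blast
qed (use that in \<open>auto intro: continuous_on_subset[OF phi_continuous]\<close>)

lemma phi_pos: "0 < \<phi> u" if "0 < u"
  using phi_strict_mono[of 0 u] that k_nonneg by (simp add: phi_0)

lemma phi_inj: "inj_on \<phi> {0..}"
  by (rule linorder_inj_onI) (use phi_strict_mono in force)+

abbreviation inv\<phi> :: "real \<Rightarrow> real" where "inv\<phi> \<equiv> bernstein_inv \<phi>"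

lemma inv_phi: "0 \<le> u \<Longrightarrow> inv\<phi> (\<phi> u) = u"
  unfolding bernstein_inv_def using phi_inj by (simp add: the_inv_into_f_f)

lemma phi_surj: "\<exists>u\<ge>0. \<phi> u = x" if "k \<le> x"
proof -
  obtain v where v: "v \<ge> 0" "\<phi> v \<ge> x"
    using eventually_conj[OF eventually_ge_at_top[of 0] filterlim_at_top[THEN iffD1, OF phi_at_top, rule_format, of x]]
    by (auto simp: eventually_at_top_linorder)
  show ?thesis
    using IVT'[of \<phi> 0 x v] v that continuous_on_subset[OF phi_continuous, of "{0..v}"] by (auto simp: phi_0)
qed

lemma phi_inv: "\<phi> (inv\<phi> x) = x" and inv_nonneg: "0 \<le> inv\<phi> x" if "k \<le> x"
  using phi_surj[OF that] inv_phi by auto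

lemma inv_pos: "0 < inv\<phi> x" if "k < x"
  using phi_inv[of x] inv_nonneg[of x] that phi_0 by (cases "inv\<phi> x = 0") auto

lemma inv_strict_mono: "inv\<phi> x < inv\<phi> y" if "k \<le> x" "x < y"
  using phi_inv[of x] phi_inv[of y] phi_mono[of "inv\<phi> y" "inv\<phi> x"] inv_nonneg[of y] that by force

lemma inv_at_top: "filterlim inv\<phi> at_top at_top"
  unfolding filterlim_at_top
proof
  fix Z :: real
  show "\<forall>\<^sub>F x in at_top. Z \<le> inv\<phi> x"
    using eventually_ge_at_top[of "max k (\<phi> (max 0 Z))"]
  proof eventually_elim
    case (elim x)
    then have "inv\<phi> (\<phi> (max 0 Z)) \<le> inv\<phi> x"
      using inv_strict_mono[of "\<phi> (max 0 Z)" x] k_le_phi[of "max 0 Z"] by (cases "\<phi> (max 0 Z) = x") auto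
    then show ?case by (simp add: inv_phi)
  qed
qed

lemma inv_deriv: "(inv\<phi> has_real_derivative inverse (dphi (inv\<phi> x))) (at x)" if "k < x"
proof (rule DERIV_inverse_function[where f=\<phi> and a=k and b="x + 1"])
  show "(\<phi> has_real_derivative dphi (inv\<phi> x)) (at (inv\<phi> x))" by (rule phi_deriv[OF inv_pos[OF that]])
  show "dphi (inv\<phi> x) \<noteq> 0" using dphi_pos[OF inv_pos[OF that]] by simp
  show "\<And>y. k < y \<Longrightarrow> y < x + 1 \<Longrightarrow> \<phi> (inv\<phi> y) = y" using phi_inv by auto
  have c: "continuous_on (\<phi> ` {0..inv\<phi> (x+1)}) inv\<phi>"
    by (rule continuous_on_inv) (auto intro: continuous_on_subset[OF phi_continuous] inv_phi)
  have "{k..x+1} \<subseteq> \<phi> ` {0..inv\<phi> (x+1)}"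
  proof
    fix y assume y: "y \<in> {k..x+1}"
    then have "inv\<phi> y \<le> inv\<phi> (x+1)" using inv_strict_mono[of y "x+1"] by (cases "y = x+1") auto
    then show "y \<in> \<phi> ` {0..inv\<phi> (x+1)}" using y phi_inv[of y] inv_nonneg[of y] by (auto intro!: image_eqI[of _ _ "inv\<phi> y"])
  qed
  then have "continuous_on {k<..<x+1} inv\<phi>" by (intro continuous_on_subset[OF c]) auto
  then show "isCont inv\<phi> x" using that by (simp add: continuous_on_eq_continuous_at)
qed (use that in auto)

lemma deriv_inv: "k < x \<Longrightarrow> deriv inv\<phi> x = inverse (dphi (inv\<phi> x))"
  using DERIV_imp_deriv[OF inv_deriv] .

end

section \<open>Inequalities inherited by the measure of the logarithmic derivative\<close>

lemma antimono_on_indicator_measurable: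
  fixes v :: "real \<Rightarrow> real"
  assumes "antimono_on {0<..} v"
  shows "(\<lambda>y. indicator {0<..} y * v y) \<in> borel_measurable borel"
proof -
  have "mono_on {0<..} (\<lambda>y. - v y)"
    using assms by (auto simp: monotone_on_def)
  then have "(\<lambda>y. - v y) \<in> borel_measurable (restrict_space borel {0<..})"
    by (rule borel_measurable_mono_on_fnc)
  then have "(\<lambda>y. - (- v y)) \<in> borel_measurable (restrict_space borel {0<..})"
    by (rule borel_measurable_uminus)
  then show ?thesis
    by (subst (asm) borel_measurable_restrict_space_iff) auto
qed

text \<open>
  If every integral of \<open>f\<close> over an initial interval \<open>[0,r]\<close> is nonnegative, then so is the integral of
  \<open>f\<close> against any nonincreasing nonnegative weight. For a bounded weight on a bounded interval this
  is the second mean value theorem; the general case follows by truncating the weight at height \<open>n\<close>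
  and the interval at \<open>n\<close>.
\<close>

lemma decreasing_weight_integral_nonneg:
  fixes v f :: "real \<Rightarrow> real"
  assumes anti: "antimono_on {0<..} v" and nonneg: "\<And>y. 0 < y \<Longrightarrow> 0 \<le> v y"
    and cont: "continuous_on {0..} f" and f0: "f 0 = 0"
    and prim: "\<And>r. 0 \<le> r \<Longrightarrow> 0 \<le> integral {0..r} f"
    and int: "integrable lborel (\<lambda>y. indicator {0<..} y * (f y * v y))"
  shows "0 \<le> (\<integral>y. indicator {0<..} y * (f y * v y) \<partial>lborel)"
proof -
  have v_meas: "(\<lambda>y. indicator {0<..} y * v y) \<in> borel_measurable borel"
    by (rule antimono_on_indicator_measurable[OF anti])
  \<comment> \<open>the truncated weight, extended to the left of 0 so that it is nonincreasing on all of [0,n]\<close>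
  define w where "w = (\<lambda>(n::nat) y. if y \<le> 0 then real n else min (real n) (v y))"
  have w_eq: "w n y = (if y \<le> 0 then real n else min (real n) (indicator {0<..} y * v y))" for n y
    by (auto simp: w_def)
  have w_meas [measurable]: "w n \<in> borel_measurable borel" for n
    unfolding w_eq using v_meas by measurable
  have f_meas: "(\<lambda>y. indicator {0..} y *\<^sub>R f y) \<in> borel_measurable borel"
    by (rule borel_measurable_continuous_on_indicator[OF _ cont]) auto
  define s where "s = (\<lambda>n y. indicator {0..real n} y * (w n y * f y))"
  have s_eq: "s n y = indicator {..real n} y * (w n y * (indicator {0..} y *\<^sub>R f y))" for n y
    by (auto simp: s_def indicator_def)
  have s_meas [measurable]: "s n \<in> borel_measurable borel" for n
    unfolding s_eq using f_meas by measurable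
  let ?F = "\<lambda>y. indicator {0<..} y * (f y * v y)"
  have bound: "norm (s n y) \<le> norm (?F y)" for n y
  proof (cases "0 < y")
    case True
    have "0 \<le> w n y" "w n y \<le> v y" using True nonneg[OF True] by (auto simp: w_def)
    then have "\<bar>w n y\<bar> * \<bar>f y\<bar> \<le> \<bar>v y\<bar> * \<bar>f y\<bar>" by (intro mult_right_mono) auto
    then show ?thesis using True by (auto simp: s_def abs_mult indicator_def mult.commute)
  next
    case False
    then show ?thesis using f0 by (cases "y = 0") (auto simp: s_def)
  qed
  have s_int: "integrable lborel (s n)" for n
    by (rule Bochner_Integration.integrable_bound[OF int]) (use bound in auto)
  have lim: "(\<lambda>n. \<integral>y. s n y \<partial>lborel) \<longlonglongrightarrow> (\<integral>y. ?F y \<partial>lborel)"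
  proof (rule integral_dominated_convergence[where w="\<lambda>y. norm (?F y)"])
    show "integrable lborel (\<lambda>y. norm (?F y))" using int by (rule integrable_norm)
    show "?F \<in> borel_measurable lborel" using int by (rule borel_measurable_integrable)
    show "AE y in lborel. (\<lambda>n. s n y) \<longlonglongrightarrow> ?F y"
    proof (rule always_eventually, rule allI, rule tendsto_eventually)
      fix y
      obtain N :: nat where N: "max y (v y) \<le> real N" using real_arch_simple by blast
      show "\<forall>\<^sub>F n in sequentially. s n y = ?F y"
        using eventually_ge_at_top[of N]
      proof eventually_elim
        case (elim n)
        then have "real N \<le> real n" by simp
        then have "y \<le> real n" "v y \<le> real n" using N by auto
        then show ?case using f0 by (cases "y = 0") (auto simp: s_def w_def indicator_def)
      qed
    qed
  qed (use bound in auto)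
  have pos: "0 \<le> (\<integral>y. s n y \<partial>lborel)" for n
  proof -
    have fint: "f integrable_on {0..real n}"
      by (intro integrable_continuous_interval continuous_on_subset[OF cont]) auto
    have wanti: "- w n x \<le> - w n y" if "0 \<le> x" "x \<le> y" for x y
    proof (cases "0 < x")
      case True
      then have "v y \<le> v x" using that anti by (auto simp: monotone_on_def)
      then show ?thesis using True that by (auto simp: w_def)
    next
      case False
      then show ?thesis using that by (auto simp: w_def)
    qed
    obtain c where c: "c \<in> {0..real n}"
      and hi: "((\<lambda>x. - w n x * f x) has_integral (- w n 0 * integral {0..c} f + - w n (real n) * integral {c..real n} f)) {0..real n}"
      using second_mean_value_theorem_full[OF fint, of "\<lambda>x. - w n x"] wanti by auto
    have split: "integral {0..c} f + integral {c..real n} f = integral {0..real n} f"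
      using c Henstock_Kurzweil_Integration.integral_combine[OF _ _ fint, of c] by auto
    have "((\<lambda>x. w n x * f x) has_integral (w n 0 * integral {0..c} f + w n (real n) * integral {c..real n} f)) {0..real n}"
      using has_integral_neg[OF hi] by (simp add: add.commute)
    then have "((\<lambda>x. if x \<in> {0..real n} then w n x * f x else 0) has_integral (w n 0 * integral {0..c} f + w n (real n) * integral {c..real n} f)) UNIV"
      by (simp only: has_integral_restrict_UNIV)
    moreover have "(\<lambda>x. if x \<in> {0..real n} then w n x * f x else 0) = s n"
      by (auto simp: s_def fun_eq_iff)
    ultimately have "(s n has_integral (w n 0 * integral {0..c} f + w n (real n) * integral {c..real n} f)) UNIV"
      by simp
    then have "(\<integral>y. s n y \<partial>lborel) = w n 0 * integral {0..c} f + w n (real n) * integral {c..real n} f"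
      using has_integral_integral_lborel[OF s_int[of n]] has_integral_unique by blast
    also have "\<dots> = (w n 0 - w n (real n)) * integral {0..c} f + w n (real n) * integral {0..real n} f"
      unfolding split[symmetric] by (simp add: algebra_simps)
    also have "\<dots> \<ge> 0"
    proof (intro add_nonneg_nonneg mult_nonneg_nonneg)
      show "0 \<le> w n 0 - w n (real n)" using wanti[of 0 "real n"] by simp
      show "0 \<le> w n (real n)" using nonneg[of "real n"] by (auto simp: w_def)
    qed (use prim c in auto)
    finally show ?thesis .
  qed
  show ?thesis
    using pos by (intro LIMSEQ_le_const[OF lim]) auto
qed

text \<open>
  The setting of the theorem without the semigroup. In terms of \<open>g = \<phi>' / \<phi>\<close> the assumption on \<open>\<kappa>\<close> says
  that \<open>g\<close> is the Laplace transform of \<open>\<kappa>\<close>. All estimates below compare integrals against \<open>\<kappa>\<close> with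
  values of \<open>g\<close>.
\<close>

locale jurek = unbounded_bernstein +
  fixes \<kappa> :: "real measure"
  assumes kappa: "log_deriv_measure \<phi> \<kappa>"
    and powers: "\<forall>\<tau>\<in>{0<..<1}. (\<lambda>u. \<phi> u powr \<tau>) \<in> Bernstein_J"
begin

definition g :: "real \<Rightarrow> real" where "g u = (\<integral>y. exp (- (u * y)) \<partial>\<kappa>)"

lemma pos_kappa: "pos_measure \<kappa>"
  using kappa by (simp add: log_deriv_measure_def)

lemma sets_kappa [measurable_cong]: "sets \<kappa> = sets borel"
  using pos_kappa by (simp add: pos_measure_def)

lemmas AE_kappa = pos_measure_AE[OF pos_kappa]

lemma integrable_exp: "integrable \<kappa> (\<lambda>y. exp (- (u * y)))" and g_eq: "g u = dphi u / \<phi> u" if "0 < u"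
  using kappa that unfolding log_deriv_measure_def g_def
  by (auto simp: has_bochner_integral_iff deriv_phi)

lemma integrable_kappa_bound:
  fixes f :: "real \<Rightarrow> 'b :: {banach, second_countable_topology}"
  assumes "0 < u" "f \<in> borel_measurable borel" "\<And>y. 0 < y \<Longrightarrow> norm (f y) \<le> B * exp (- (u * y))"
  shows "integrable \<kappa> f"
proof (rule Bochner_Integration.integrable_bound)
  show "integrable \<kappa> (\<lambda>y. B * exp (- (u * y)))" using integrable_exp[OF assms(1)] by simp
  show "f \<in> borel_measurable \<kappa>" using assms(2) by measurable
  show "AE y in \<kappa>. norm (f y) \<le> norm (B * exp (- (u * y)))"
    using AE_kappa
  proof eventually_elim
    case (elim y)
    then show ?case using assms(3)[OF elim] by simp
  qed
qed

lemma norm_integral_kappa_le: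
  fixes f :: "real \<Rightarrow> 'b :: {banach, second_countable_topology}"
  assumes "0 < u" "f \<in> borel_measurable borel" "\<And>y. 0 < y \<Longrightarrow> norm (f y) \<le> B * exp (- (u * y))"
  shows "norm (\<integral>y. f y \<partial>\<kappa>) \<le> B * g u"
proof -
  have "norm (\<integral>y. f y \<partial>\<kappa>) \<le> (\<integral>y. norm (f y) \<partial>\<kappa>)"
    by (rule integral_norm_bound)
  also have "\<dots> \<le> (\<integral>y. B * exp (- (u * y)) \<partial>\<kappa>)"
  proof (rule integral_mono_AE)
    show "integrable \<kappa> (\<lambda>y. norm (f y))" by (intro integrable_norm integrable_kappa_bound[OF assms])
    show "integrable \<kappa> (\<lambda>y. B * exp (- (u * y)))" using integrable_exp[OF assms(1)] by simp
    show "AE y in \<kappa>. norm (f y) \<le> B * exp (- (u * y))" using AE_kappa by eventually_elim (rule assms(3))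
  qed
  finally show ?thesis by (simp add: g_def)
qed

lemma g_pos: "0 < u \<Longrightarrow> 0 < g u"
  using dphi_pos phi_pos by (simp add: g_eq)

lemma g_antimono: "0 < u \<Longrightarrow> u \<le> v \<Longrightarrow> g v \<le> g u"
  unfolding g_def using AE_kappa
  by (intro integral_mono_AE integrable_exp) (auto elim!: eventually_mono)

lemma g_tendsto_0: "(g \<longlongrightarrow> 0) at_top"
proof (rule tendsto_sandwich[OF _ _ tendsto_const])
  show "\<forall>\<^sub>F u in at_top. 0 \<le> g u"
    using eventually_gt_at_top[of 0] by eventually_elim (use g_pos in force)
  show "\<forall>\<^sub>F u in at_top. g u \<le> dphi 1 / \<phi> u"
    using eventually_ge_at_top[of 1]
  proof eventually_elim
    case (elim u)
    then show ?case using dphi_antimono[of 1 u] phi_pos[of u] by (simp add: g_eq divide_right_mono)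
  qed
  show "((\<lambda>u. dphi 1 / \<phi> u) \<longlongrightarrow> 0) at_top"
    by (rule tendsto_divide_0[OF tendsto_const filterlim_at_top_imp_at_infinity[OF phi_at_top]])
qed

text \<open>
  Differentiating \<open>\<phi> powr \<tau>\<close> and its Levy-Khintchine representation with nonincreasing density \<open>v\<close>
  identifies \<open>\<tau> \<phi>\<^sup>\<tau> g\<close> as the Laplace transform of \<open>y v(y)\<close>. The drift of \<open>\<phi> powr \<tau>\<close> is \<open>0\<close> because
  \<open>\<phi>\<close> grows at most linearly and \<open>\<tau> < 1\<close>.
\<close>

lemma power_jurek_density:
  assumes \<tau>: "0 < \<tau>" "\<tau> < 1"
  obtains v where "antimono_on {0<..} v" "\<And>y. 0 < y \<Longrightarrow> 0 \<le> v y"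
    "\<And>u. 0 < u \<Longrightarrow> has_bochner_integral lborel (\<lambda>y. indicator {0<..} y * (y * exp (- (u * y)) * v y)) (\<tau> * \<phi> u powr \<tau> * g u)"
proof -
  from powers \<tau> obtain k' d' v where v: "antimono_on {0<..} v" "\<forall>y>0. 0 \<le> v y"
    and bt: "bernstein_triplet (\<lambda>u. \<phi> u powr \<tau>) k' d' (density lborel (\<lambda>y. ennreal (v y) * indicator {0<..} y))"
    unfolding Bernstein_J_def by force
  have v_meas [measurable]: "(\<lambda>y. indicator {0<..} y * v y) \<in> borel_measurable borel"
    by (rule antimono_on_indicator_measurable[OF v(1)])
  have dens: "(\<lambda>y. ennreal (v y) * indicator {0<..} y) = (\<lambda>y. ennreal (indicator {0<..} y * v y))"
    by (auto simp: indicator_def fun_eq_iff)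
  interpret B: bernstein "\<lambda>u. \<phi> u powr \<tau>" k' d' "density lborel (\<lambda>y. ennreal (indicator {0<..} y * v y))"
    using bt unfolding dens by unfold_locales
  have nn: "AE y in lborel. 0 \<le> indicator {0<..} y * v y"
    using v(2) by (auto simp: indicator_def)
  have d'0: "d' = 0"
  proof -
    have "((\<lambda>u. \<phi> u powr \<tau> / u) \<longlongrightarrow> 0) at_top"
    proof (rule tendsto_sandwich[OF _ _ tendsto_const])
      show "\<forall>\<^sub>F u in at_top. 0 \<le> \<phi> u powr \<tau> / u"
        using eventually_gt_at_top[of 0] by eventually_elim simp
      show "\<forall>\<^sub>F u in at_top. \<phi> u powr \<tau> / u \<le> (u * \<phi> 1) powr \<tau> / u"
        using eventually_ge_at_top[of 1]
      proof eventually_elim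
        case (elim u)
        then show ?case using phi_le_linear[of u] phi_pos[of u] \<tau> by (intro divide_right_mono powr_mono2) auto
      qed
      have "0 < \<phi> 1" by (rule phi_pos) simp
      then show "((\<lambda>u. (u * \<phi> 1) powr \<tau> / u) \<longlongrightarrow> 0) at_top"
        using \<tau> by real_asymp
    qed
    then show ?thesis using B.phi_over_tendsto tendsto_unique trivial_limit_at_top_linorder by blast
  qed
  show thesis
  proof (rule that[OF v(1)])
    fix u :: real assume u: "0 < u"
    have "((\<lambda>u. \<phi> u powr \<tau>) has_real_derivative \<tau> * \<phi> u powr (\<tau> - 1) * dphi u) (at u)"
      using phi_pos[OF u] by (auto intro!: derivative_eq_intros phi_deriv[OF u])
    then have "B.dphi u = \<tau> * \<phi> u powr (\<tau> - 1) * dphi u"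
      using B.phi_deriv[OF u] DERIV_unique by blast
    also have "\<dots> = \<tau> * \<phi> u powr \<tau> * g u"
      using phi_pos[OF u] by (simp add: g_eq[OF u] powr_diff)
    finally have "(\<integral>y. y * exp (- (u * y)) \<partial>density lborel (\<lambda>y. ennreal (indicator {0<..} y * v y))) = \<tau> * \<phi> u powr \<tau> * g u"
      using B.dphi_def[of u] d'0 by linarith
    moreover have "integrable (density lborel (\<lambda>y. ennreal (indicator {0<..} y * v y))) (\<lambda>y. y * exp (- (u * y)))"
      by (rule B.integrable_dphi[OF u])
    ultimately have "has_bochner_integral lborel (\<lambda>y. (indicator {0<..} y * v y) *\<^sub>R (y * exp (- (u * y)))) (\<tau> * \<phi> u powr \<tau> * g u)"
      using nn by (simp add: integral_density integrable_density has_bochner_integral_iff)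
    then show "has_bochner_integral lborel (\<lambda>y. indicator {0<..} y * (y * exp (- (u * y)) * v y)) (\<tau> * \<phi> u powr \<tau> * g u)"
      by (simp add: ac_simps)
  qed (use v(2) in auto)
qed


text \<open>
  The only use of the hypothesis on the powers of \<open>\<phi>\<close>. Morally \<open>\<kappa>\<close> is \<open>y q(y) dy\<close> with \<open>q\<close>
  nonincreasing, so that the integral in the conclusion is the integral of \<open>y exp (- a y) h(y)\<close> against
  a nonincreasing weight. Instead of constructing \<open>q\<close>, the inequality is proved for the measures
  \<open>y v\<^sub>\<tau>(y) dy / \<tau>\<close> with Laplace transform \<open>\<phi>\<^sup>\<tau> g\<close> and carried to the limit \<open>\<tau> \<rightarrow> 0\<close>, where these
  transforms tend to \<open>g\<close>. In the variable \<open>w = exp (- y)\<close> the function \<open>h\<close> is continuous on \<open>[0,1]\<close>,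
  hence uniformly close to polynomials, and integrals of polynomials in \<open>exp (- y)\<close> are combinations of
  Laplace transforms; so convergence of the transforms suffices.
\<close>

theorem kappa_positivity:
  fixes h :: "real \<Rightarrow> real"
  assumes a: "0 < a" and cont: "continuous_on {0..} h" and lim: "(h \<longlongrightarrow> L) at_top"
    and prim: "\<And>r. 0 \<le> r \<Longrightarrow> 0 \<le> integral {0..r} (\<lambda>y. y * exp (- (a * y)) * h y)"
    and meas: "h \<in> borel_measurable borel"
  shows "0 \<le> (\<integral>y. h y * exp (- (a * y)) \<partial>\<kappa>)"
proof -
  define f where "f = (\<lambda>w. if w = 0 then L else h (- ln w))"
  have f_exp: "f (exp (- y)) = h y" for y by (simp add: f_def)
  have "continuous_on {0..1} f"
    unfolding continuous_on_eq_continuous_within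
  proof
    fix w :: real assume w: "w \<in> {0..1}"
    show "continuous (at w within {0..1}) f"
    proof (cases "w = 0")
      case True
      have "((\<lambda>w. h (- ln w)) \<longlongrightarrow> L) (at_right 0)"
        by (rule filterlim_compose[OF lim]) real_asymp
      then have "(f \<longlongrightarrow> L) (at_right 0)"
        by (rule Lim_transform_eventually) (auto simp: eventually_at_filter f_def)
      then have "(f \<longlongrightarrow> f 0) (at 0 within {0..1})"
        by (simp add: f_def at_within_Icc_at_right)
      then show ?thesis using True by (simp add: continuous_within)
    next
      case False
      have "continuous_on {0<..1} (\<lambda>w. h (- ln w))"
        by (intro continuous_on_compose2[OF cont] continuous_intros) auto
      then have "continuous_on {0<..1} f"
        by (rule continuous_on_eq) (auto simp: f_def)
      then have c: "continuous (at w within {0<..1}) f"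
        using False w by (auto simp: continuous_on_eq_continuous_within)
      have "at w within {0..1} = at w within {0<..1}"
        by (rule at_within_nhd[of w "{0<..}"]) (use False w in auto)
      then show ?thesis using c by (simp add: continuous_within)
    qed
  qed
  note f_cont = this
  have h_bound: "\<exists>B. \<forall>y\<ge>0. \<bar>h y\<bar> \<le> B"
  proof -
    have "bounded (f ` {0..1})"
      by (rule compact_imp_bounded[OF compact_continuous_image[OF f_cont]]) simp
    then obtain B where B: "\<And>w. w \<in> {0..1} \<Longrightarrow> \<bar>f w\<bar> \<le> B" unfolding bounded_iff by (metis imageI real_norm_def)
    have "\<bar>h y\<bar> \<le> B" if "y \<ge> 0" for y
      using B[of "exp (- y)"] that by (simp add: f_exp)
    then show ?thesis by blast
  qed
  then obtain B where B: "\<And>y. y \<ge> 0 \<Longrightarrow> \<bar>h y\<bar> \<le> B" by blast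
  have int_h: "integrable \<kappa> (\<lambda>y. h y * exp (- (a * y)))"
    by (rule integrable_kappa_bound[OF a, where B=B]) (use meas B in \<open>auto simp: abs_mult intro!: mult_right_mono\<close>)
  \<comment> \<open>one \<open>\<epsilon> g(a)\<close> is lost when h is replaced by a polynomial under the approximating measures, and a second
    one when it is replaced under \<open>\<kappa>\<close>\<close>
  have key: "- (2 * g a) * \<epsilon> \<le> (\<integral>y. h y * exp (- (a * y)) \<partial>\<kappa>)" if \<epsilon>: "0 < \<epsilon>" for \<epsilon>
  proof -
    obtain P where P: "real_polynomial_function P" and Pf: "\<And>w. w \<in> {0..1} \<Longrightarrow> \<bar>f w - P w\<bar> < \<epsilon>"
      using Stone_Weierstrass_real_polynomial_function[OF _ f_cont \<epsilon>] by auto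
    obtain c n where c: "P = (\<lambda>w. \<Sum>i\<le>n. c i * w ^ i)" using P real_polynomial_function_iff_sum by auto
    define Q where "Q = (\<lambda>y. \<Sum>i\<le>n. c i * exp (- ((a + real i) * y)))"
    have Q_eq: "Q y = P (exp (- y)) * exp (- (a * y))" for y
      unfolding Q_def c sum_distrib_right
      by (intro sum.cong refl) (simp add: exp_of_nat_mult[symmetric] exp_add[symmetric] algebra_simps)
    have hQ: "\<bar>h y * exp (- (a * y)) - Q y\<bar> \<le> \<epsilon> * exp (- (a * y))" if "0 < y" for y
    proof -
      have "\<bar>h y - P (exp (- y))\<bar> \<le> \<epsilon>" using Pf[of "exp (- y)"] that by (simp add: f_exp)
      moreover have "h y * exp (- (a * y)) - Q y = (h y - P (exp (- y))) * exp (- (a * y))"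
        by (simp add: Q_eq algebra_simps)
      ultimately show ?thesis by (simp add: abs_mult)
    qed
    have int_i: "integrable \<kappa> (\<lambda>y. c i * exp (- ((a + real i) * y)))" for i
      by (rule integrable_mult_right) (use a in \<open>auto intro!: integrable_exp\<close>)
    have intQ: "integrable \<kappa> Q"
      unfolding Q_def by (intro Bochner_Integration.integrable_sum int_i)
    have intQ2: "(\<integral>y. Q y \<partial>\<kappa>) = (\<Sum>i\<le>n. c i * g (a + real i))"
      unfolding Q_def g_def by (subst Bochner_Integration.integral_sum) (use int_i in auto)
    have step: "0 \<le> (\<Sum>i\<le>n. c i * (\<phi> (a + real i) powr \<tau> * g (a + real i))) + \<epsilon> * (\<phi> a powr \<tau> * g a)"
      if \<tau>: "0 < \<tau>" "\<tau> < 1" for \<tau>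
    proof -
      obtain v where v: "antimono_on {0<..} v" "\<And>y. 0 < y \<Longrightarrow> 0 \<le> v y"
        and hb: "\<And>u. 0 < u \<Longrightarrow> has_bochner_integral lborel (\<lambda>y. indicator {0<..} y * (y * exp (- (u * y)) * v y)) (\<tau> * \<phi> u powr \<tau> * g u)"
        using power_jurek_density[OF \<tau>] by blast
      note v_meas = antimono_on_indicator_measurable[OF v(1)]
      have hbQ: "has_bochner_integral lborel (\<lambda>y. \<Sum>i\<le>n. c i * (indicator {0<..} y * (y * exp (- ((a + real i) * y)) * v y)))
          (\<Sum>i\<le>n. c i * (\<tau> * \<phi> (a + real i) powr \<tau> * g (a + real i)))"
        using a by (intro has_bochner_integral_sum has_bochner_integral_mult_right hb) auto
      have hbS: "has_bochner_integral lborel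
          (\<lambda>y. (\<Sum>i\<le>n. c i * (indicator {0<..} y * (y * exp (- ((a + real i) * y)) * v y))) + \<epsilon> * (indicator {0<..} y * (y * exp (- (a * y)) * v y)))
          ((\<Sum>i\<le>n. c i * (\<tau> * \<phi> (a + real i) powr \<tau> * g (a + real i))) + \<epsilon> * (\<tau> * \<phi> a powr \<tau> * g a))"
        by (intro has_bochner_integral_add hbQ has_bochner_integral_mult_right hb a)
      have S_eq: "(\<Sum>i\<le>n. c i * (indicator {0<..} y * (y * exp (- ((a + real i) * y)) * v y))) = indicator {0<..} y * (y * Q y * v y)" for y
        unfolding Q_def sum_distrib_left sum_distrib_right by (intro sum.cong refl) (simp add: ac_simps)
      have int: "integrable lborel (\<lambda>y. indicator {0<..} y * ((y * exp (- (a * y)) * h y) * v y))"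
      proof (rule Bochner_Integration.integrable_bound)
        show "integrable lborel (\<lambda>y. B * (indicator {0<..} y * (y * exp (- (a * y)) * v y)))"
          using hb[OF a] by (auto simp: has_bochner_integral_iff)
        have "(\<lambda>y. (indicator {0<..} y * v y) * (y * exp (- (a * y)) * h y)) \<in> borel_measurable borel"
          using v_meas meas by measurable
        then show "(\<lambda>y. indicator {0<..} y * ((y * exp (- (a * y)) * h y) * v y)) \<in> borel_measurable lborel"
          by (simp add: ac_simps)
        show "AE y in lborel. norm (indicator {0<..} y * ((y * exp (- (a * y)) * h y) * v y)) \<le> norm (B * (indicator {0<..} y * (y * exp (- (a * y)) * v y)))"
        proof (intro always_eventually allI)
          fix y
          show "norm (indicator {0<..} y * ((y * exp (- (a * y)) * h y) * v y)) \<le> norm (B * (indicator {0<..} y * (y * exp (- (a * y)) * v y)))"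
          proof (cases "0 < y")
            case True
            have "\<bar>h y\<bar> * \<bar>y * exp (- (a * y)) * v y\<bar> \<le> \<bar>B\<bar> * \<bar>y * exp (- (a * y)) * v y\<bar>"
              using B[of y] True by (intro mult_right_mono) auto
            then show ?thesis using True by (simp add: abs_mult ac_simps)
          qed simp
        qed
      qed
      have "0 \<le> (\<integral>y. indicator {0<..} y * ((y * exp (- (a * y)) * h y) * v y) \<partial>lborel)"
        by (rule decreasing_weight_integral_nonneg[OF v])
           (use cont prim int in \<open>auto intro!: continuous_intros\<close>)
      also have "\<dots> \<le> (\<integral>y. (\<Sum>i\<le>n. c i * (indicator {0<..} y * (y * exp (- ((a + real i) * y)) * v y))) + \<epsilon> * (indicator {0<..} y * (y * exp (- (a * y)) * v y)) \<partial>lborel)"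
      proof (rule integral_mono[OF int])
        show "integrable lborel (\<lambda>y. (\<Sum>i\<le>n. c i * (indicator {0<..} y * (y * exp (- ((a + real i) * y)) * v y))) + \<epsilon> * (indicator {0<..} y * (y * exp (- (a * y)) * v y)))"
          using hbS by (auto simp: has_bochner_integral_iff)
        show "indicator {0<..} y * ((y * exp (- (a * y)) * h y) * v y) \<le> (\<Sum>i\<le>n. c i * (indicator {0<..} y * (y * exp (- ((a + real i) * y)) * v y))) + \<epsilon> * (indicator {0<..} y * (y * exp (- (a * y)) * v y))" for y
        proof (cases "0 < y")
          case True
          have "h y * exp (- (a * y)) \<le> Q y + \<epsilon> * exp (- (a * y))" using hQ[OF True] by linarith
          then have "(y * v y) * (h y * exp (- (a * y))) \<le> (y * v y) * (Q y + \<epsilon> * exp (- (a * y)))"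
            using True v(2)[OF True] by (intro mult_left_mono) auto
          then show ?thesis using True unfolding S_eq by (simp add: algebra_simps)
        qed simp
      qed
      also have "\<dots> = (\<Sum>i\<le>n. c i * (\<tau> * \<phi> (a + real i) powr \<tau> * g (a + real i))) + \<epsilon> * (\<tau> * \<phi> a powr \<tau> * g a)"
        using hbS by (auto simp: has_bochner_integral_iff)
      also have "\<dots> = \<tau> * ((\<Sum>i\<le>n. c i * (\<phi> (a + real i) powr \<tau> * g (a + real i))) + \<epsilon> * (\<phi> a powr \<tau> * g a))"
        by (simp add: distrib_left sum_distrib_left ac_simps)
      finally show ?thesis using \<tau>(1) by (simp add: zero_le_mult_iff)
    qed
    have "((\<lambda>\<tau>. (\<Sum>i\<le>n. c i * (\<phi> (a + real i) powr \<tau> * g (a + real i))) + \<epsilon> * (\<phi> a powr \<tau> * g a)) \<longlongrightarrow>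
        (\<Sum>i\<le>n. c i * (\<phi> (a + real i) powr 0 * g (a + real i))) + \<epsilon> * (\<phi> a powr 0 * g a)) (at_right 0)"
      using phi_pos a by (intro tendsto_intros) (auto simp: less_imp_neq[symmetric] add_pos_nonneg)
    moreover have "\<forall>\<^sub>F \<tau> in at_right (0::real). 0 \<le> (\<Sum>i\<le>n. c i * (\<phi> (a + real i) powr \<tau> * g (a + real i))) + \<epsilon> * (\<phi> a powr \<tau> * g a)"
      using eventually_at_right_real[of 0 1] by (auto elim!: eventually_mono intro!: step)
    ultimately have "0 \<le> (\<Sum>i\<le>n. c i * (\<phi> (a + real i) powr 0 * g (a + real i))) + \<epsilon> * (\<phi> a powr 0 * g a)"
      by (intro tendsto_lowerbound[where F="at_right (0::real)"]) auto
    moreover have "\<phi> (a + real i) powr 0 = 1" "\<phi> a powr 0 = 1" for i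
      using phi_pos[of "a + real i"] phi_pos[of a] a by auto
    ultimately have "- \<epsilon> * g a \<le> (\<integral>y. Q y \<partial>\<kappa>)" by (simp add: intQ2)
    moreover have "(\<integral>y. Q y \<partial>\<kappa>) \<le> (\<integral>y. h y * exp (- (a * y)) + \<epsilon> * exp (- (a * y)) \<partial>\<kappa>)"
    proof (rule integral_mono_AE)
      show "AE y in \<kappa>. Q y \<le> h y * exp (- (a * y)) + \<epsilon> * exp (- (a * y))"
        using AE_kappa
      proof eventually_elim
        case (elim y)
        then show ?case using hQ[OF elim] by linarith
      qed
    qed (use intQ int_h integrable_exp[OF a] in auto)
    moreover have "\<dots> = (\<integral>y. h y * exp (- (a * y)) \<partial>\<kappa>) + \<epsilon> * g a"
      using int_h integrable_exp[OF a] by (simp add: g_def)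
    ultimately show ?thesis by (simp add: algebra_simps)
  qed
  have "((\<lambda>\<epsilon>. - (2 * g a) * \<epsilon>) \<longlongrightarrow> - (2 * g a) * 0) (at_right 0)"
    by (intro tendsto_intros)
  moreover have "\<forall>\<^sub>F \<epsilon> in at_right 0. - (2 * g a) * \<epsilon> \<le> (\<integral>y. h y * exp (- (a * y)) \<partial>\<kappa>)"
    using eventually_at_right_less by (rule eventually_mono) (rule key)
  ultimately show ?thesis
    using tendsto_upperbound[of _ _ "at_right (0::real)"] by (auto simp del: mult_minus_left)
qed

end

section \<open>Growth of the logarithmic derivative and decay on vertical lines\<close>

lemma integral_exp_moment:
  fixes a r :: real
  assumes "0 < a" "0 \<le> r"
  shows "((\<lambda>y. y * exp (- (a * y))) has_integral (1 - (1 + a * r) * exp (- (a * r))) / a\<^sup>2) {0..r}"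
proof -
  have "((\<lambda>y. y * exp (- (a * y))) has_integral
      (- (1 + a * r) * exp (- (a * r)) / a\<^sup>2 - (- (1 + a * 0) * exp (- (a * 0)) / a\<^sup>2))) {0..r}"
  proof (rule fundamental_theorem_of_calculus[OF assms(2)])
    fix x assume "x \<in> {0..r}"
    have "((\<lambda>y. - (1 + a * y) * exp (- (a * y)) / a\<^sup>2) has_real_derivative x * exp (- (a * x))) (at x within {0..r})"
      using assms(1) by (auto intro!: derivative_eq_intros simp: field_simps power2_eq_square)
    then show "((\<lambda>y. - (1 + a * y) * exp (- (a * y)) / a\<^sup>2) has_vector_derivative x * exp (- (a * x))) (at x within {0..r})"
      by (simp add: has_real_derivative_iff_has_vector_derivative)
  qed
  moreover have "- (1 + a * r) * exp (- (a * r)) / a\<^sup>2 - (- (1 + a * 0) * exp (- (a * 0)) / a\<^sup>2) = (1 - (1 + a * r) * exp (- (a * r))) / a\<^sup>2"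
  proof -
    have "- (1 + a * r) * exp (- (a * r)) / a\<^sup>2 - (- (1 + a * 0) * exp (- (a * 0)) / a\<^sup>2) = (- (1 + a * r) * exp (- (a * r)) - (- (1 + a * 0) * exp (- (a * 0)))) / a\<^sup>2"
      by (simp only: diff_divide_distrib)
    also have "- (1 + a * r) * exp (- (a * r)) - (- (1 + a * 0) * exp (- (a * 0))) = 1 - (1 + a * r) * exp (- (a * r))"
      by (simp add: algebra_simps)
    finally show ?thesis .
  qed
  ultimately show ?thesis by simp
qed

lemma integral_exp_sin:
  fixes a b r :: real
  assumes "0 < a" "0 \<le> r"
  shows "((\<lambda>y. sin (b * y) * exp (- (a * y))) has_integral
    (b - (b * cos (b * r) + a * sin (b * r)) * exp (- (a * r))) / (a\<^sup>2 + b\<^sup>2)) {0..r}"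
proof -
  have nz: "a\<^sup>2 + b\<^sup>2 \<noteq> 0" using assms(1) by (simp add: sum_power2_eq_zero_iff)
  define F where "F = (\<lambda>y. - (b * cos (b * y) + a * sin (b * y)) * exp (- (a * y)) / (a\<^sup>2 + b\<^sup>2))"
  have "((\<lambda>y. sin (b * y) * exp (- (a * y))) has_integral (F r - F 0)) {0..r}"
  proof (rule fundamental_theorem_of_calculus[OF assms(2)])
    fix x assume "x \<in> {0..r}"
    have "(F has_real_derivative
       (((b\<^sup>2 * sin (b * x) - a * b * cos (b * x)) + a * (b * cos (b * x) + a * sin (b * x))) * exp (- (a * x))) / (a\<^sup>2 + b\<^sup>2)) (at x within {0..r})"
    proof -
      have "((\<lambda>y. - (b * cos (b * y) + a * sin (b * y)) * exp (- (a * y))) has_real_derivative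
         ((b\<^sup>2 * sin (b * x) - a * b * cos (b * x)) + a * (b * cos (b * x) + a * sin (b * x))) * exp (- (a * x))) (at x within {0..r})"
        by (auto intro!: derivative_eq_intros simp: algebra_simps power2_eq_square)
      then show ?thesis unfolding F_def by (rule DERIV_cdivide)
    qed
    also have "((b\<^sup>2 * sin (b * x) - a * b * cos (b * x)) + a * (b * cos (b * x) + a * sin (b * x))) * exp (- (a * x)) / (a\<^sup>2 + b\<^sup>2) = sin (b * x) * exp (- (a * x))"
    proof -
      have "((b\<^sup>2 * sin (b * x) - a * b * cos (b * x)) + a * (b * cos (b * x) + a * sin (b * x))) * exp (- (a * x)) = (sin (b * x) * exp (- (a * x))) * (a\<^sup>2 + b\<^sup>2)"
        by (simp add: algebra_simps power2_eq_square)
      then show ?thesis using nz by simp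
    qed
    finally show "(F has_vector_derivative sin (b * x) * exp (- (a * x))) (at x within {0..r})"
      by (simp add: has_real_derivative_iff_has_vector_derivative)
  qed
  moreover have "F r - F 0 = (b - (b * cos (b * r) + a * sin (b * r)) * exp (- (a * r))) / (a\<^sup>2 + b\<^sup>2)"
  proof -
    have "F r - F 0 = (- (b * cos (b * r) + a * sin (b * r)) * exp (- (a * r)) - (- (b * cos (b * 0) + a * sin (b * 0)) * exp (- (a * 0)))) / (a\<^sup>2 + b\<^sup>2)"
      by (simp only: F_def diff_divide_distrib)
    also have "- (b * cos (b * r) + a * sin (b * r)) * exp (- (a * r)) - (- (b * cos (b * 0) + a * sin (b * 0)) * exp (- (a * 0))) = b - (b * cos (b * r) + a * sin (b * r)) * exp (- (a * r))"
      by (simp add: algebra_simps)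
    finally show ?thesis .
  qed
  ultimately show ?thesis by simp
qed

lemma exp_minus_1_pos: "0 < exp y - 1" if "0 < y" for y :: real
  using that by simp

lemma le_exp_minus_1: "y \<le> exp y - 1" for y :: real
  using exp_ge_add_one_self[of y] by linarith

lemma exp_div_le: "exp (- y) / y \<le> 1 / (exp y - 1)" if "0 < y" for y :: real
proof -
  have "exp (- y) * (exp y - 1) = 1 - exp (- y)" by (simp add: algebra_simps exp_minus)
  also have "\<dots> \<le> y" using exp_ge_add_one_self[of "- y"] by linarith
  finally show ?thesis using that exp_minus_1_pos[OF that] by (simp add: field_simps)
qed

lemma one_minus_cos_le: "1 - cos x \<le> x\<^sup>2 / 2" for x :: real
proof -
  have "cos x = 1 - 2 * (sin (x / 2))\<^sup>2" using cos_double_sin[of "x / 2"] by simp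
  moreover have "(sin (x / 2))\<^sup>2 \<le> (x / 2)\<^sup>2"
    using abs_sin_x_le_abs_x[of "x / 2"] by (simp only: abs_le_square_iff)
  ultimately show ?thesis by (simp add: power_divide)
qed

context jurek
begin

text \<open>
  If \<open>\<kappa>\<close> has the density \<open>y q(y)\<close> with \<open>q\<close> nonincreasing, then \<open>a\<^sup>2 g(a)\<close> is the integral of
  \<open>w exp (- w) q(w / a)\<close>, which increases with \<open>a\<close>. As \<open>g\<close> itself decreases, this fixes the
  variation of \<open>g\<close> up to constants: \<open>g(a) \<le> (b/a)\<^sup>2 g(b)\<close> for \<open>a \<le> b\<close>.
\<close>

lemma g_scaled_mono: "a\<^sup>2 * g a \<le> b\<^sup>2 * g b" if "0 < a" "a \<le> b"
proof (cases "a = b")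
  case False
  then have ab: "a < b" using that by simp
  have "0 \<le> (\<integral>y. (b\<^sup>2 * exp (- ((b - a) * y)) - a\<^sup>2) * exp (- (a * y)) \<partial>\<kappa>)"
  proof (rule kappa_positivity[OF that(1)])
    show "((\<lambda>y. b\<^sup>2 * exp (- ((b - a) * y)) - a\<^sup>2) \<longlongrightarrow> - a\<^sup>2) at_top"
      using ab by real_asymp
    fix r :: real assume r: "0 \<le> r"
    have "((\<lambda>y. b\<^sup>2 * (y * exp (- (b * y))) - a\<^sup>2 * (y * exp (- (a * y)))) has_integral
       (b\<^sup>2 * ((1 - (1 + b * r) * exp (- (b * r))) / b\<^sup>2) - a\<^sup>2 * ((1 - (1 + a * r) * exp (- (a * r))) / a\<^sup>2))) {0..r}"
      using that r by (intro has_integral_diff has_integral_mult_right integral_exp_moment) auto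
    moreover have "b\<^sup>2 * (y * exp (- (b * y))) - a\<^sup>2 * (y * exp (- (a * y))) = y * exp (- (a * y)) * (b\<^sup>2 * exp (- ((b - a) * y)) - a\<^sup>2)" for y
    proof -
      have "exp (- (b * y)) = exp (- (a * y)) * exp (- ((b - a) * y))" by (simp add: exp_add[symmetric] algebra_simps)
      then show ?thesis by (simp add: algebra_simps)
    qed
    ultimately have "integral {0..r} (\<lambda>y. y * exp (- (a * y)) * (b\<^sup>2 * exp (- ((b - a) * y)) - a\<^sup>2)) = (1 + a * r) * exp (- (a * r)) - (1 + b * r) * exp (- (b * r))"
      using that by (auto dest: integral_unique)
    moreover have "(1 + b * r) * exp (- (b * r)) \<le> (1 + a * r) * exp (- (a * r))"
    proof (rule DERIV_nonpos_imp_nonincreasing[where f="\<lambda>x. (1 + x) * exp (- x)"])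
      show "a * r \<le> b * r" using that r by (intro mult_right_mono)
      fix x assume "a * r \<le> x"
      moreover have "0 \<le> a * r" using that r by simp
      ultimately have "0 \<le> x" by linarith
      then show "\<exists>y. ((\<lambda>x. (1 + x) * exp (- x)) has_real_derivative y) (at x) \<and> y \<le> 0"
        by (intro exI[of _ "- x * exp (- x)"]) (auto intro!: derivative_eq_intros simp: algebra_simps)
    qed
    ultimately show "0 \<le> integral {0..r} (\<lambda>y. y * exp (- (a * y)) * (b\<^sup>2 * exp (- ((b - a) * y)) - a\<^sup>2))" by simp
  qed (auto intro!: continuous_intros)
  also have "(\<integral>y. (b\<^sup>2 * exp (- ((b - a) * y)) - a\<^sup>2) * exp (- (a * y)) \<partial>\<kappa>) = (\<integral>y. b\<^sup>2 * exp (- (b * y)) - a\<^sup>2 * exp (- (a * y)) \<partial>\<kappa>)"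
    by (intro Bochner_Integration.integral_cong refl) (simp add: algebra_simps exp_add[symmetric])
  also have "\<dots> = b\<^sup>2 * g b - a\<^sup>2 * g a"
    unfolding g_def using that by (subst Bochner_Integration.integral_diff) (auto intro!: integrable_exp)
  finally show ?thesis by simp
qed simp

text \<open>
  The derivative in \<open>b\<close> of the next estimate, where the oscillation is harmless: on every interval
  \<open>[0,r]\<close> the required inequality reduces to \<open>b cos (b r) + a sin (b r) \<le> b (1 + a r)\<close>.
  For \<open>\<kappa>(dy) = y dy\<close> it is an equality.
\<close>

lemma kappa_sin_lower: "a\<^sup>2 * b / (a\<^sup>2 + b\<^sup>2) * g a \<le> (\<integral>y. sin (b * y) / y * exp (- (a * y)) \<partial>\<kappa>)"
  if a: "0 < a" and b: "0 \<le> b"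
proof -
  define c where "c = a\<^sup>2 * b / (a\<^sup>2 + b\<^sup>2)"
  have "0 \<le> (\<integral>y. (b * sinc (b * y) - c) * exp (- (a * y)) \<partial>\<kappa>)"
  proof (rule kappa_positivity[OF a])
    show "continuous_on {0..} (\<lambda>y. b * sinc (b * y) - c)"
      by (intro continuous_intros continuous_on_compose2[OF continuous_at_imp_continuous_on[of UNIV sinc]] ballI isCont_sinc) auto
    show "(\<lambda>y. b * sinc (b * y) - c) \<in> borel_measurable borel" by measurable
    have "((\<lambda>y. sin (b * y) / y) \<longlongrightarrow> 0) at_top"
    proof (rule Lim_null_comparison)
      show "((\<lambda>y::real. 1 / y) \<longlongrightarrow> 0) at_top" by real_asymp
      show "\<forall>\<^sub>F y in at_top. norm (sin (b * y) / y) \<le> 1 / y"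
        using eventually_gt_at_top[of 0] by eventually_elim (auto simp: divide_right_mono)
    qed
    then have "((\<lambda>y. sin (b * y) / y - c) \<longlongrightarrow> 0 - c) at_top" by (intro tendsto_intros)
    then show "((\<lambda>y. b * sinc (b * y) - c) \<longlongrightarrow> 0 - c) at_top"
    proof (rule Lim_transform_eventually)
      show "\<forall>\<^sub>F y in at_top. sin (b * y) / y - c = b * sinc (b * y) - c"
        using eventually_gt_at_top[of 0]
      proof eventually_elim
        case (elim y)
        then show ?case by (cases "b = 0") auto
      qed
    qed
    fix r :: real assume r: "0 \<le> r"
    have "((\<lambda>y. sin (b * y) * exp (- (a * y)) - c * (y * exp (- (a * y)))) has_integral
       ((b - (b * cos (b * r) + a * sin (b * r)) * exp (- (a * r))) / (a\<^sup>2 + b\<^sup>2) - c * ((1 - (1 + a * r) * exp (- (a * r))) / a\<^sup>2))) {0..r}"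
      using a r by (intro has_integral_diff has_integral_mult_right integral_exp_moment integral_exp_sin)
    moreover have "sin (b * y) * exp (- (a * y)) - c * (y * exp (- (a * y))) = y * exp (- (a * y)) * (b * sinc (b * y) - c)" for y
      by (cases "b = 0"; cases "y = 0") (auto simp: algebra_simps)
    ultimately have "integral {0..r} (\<lambda>y. y * exp (- (a * y)) * (b * sinc (b * y) - c)) =
       (b - (b * cos (b * r) + a * sin (b * r)) * exp (- (a * r))) / (a\<^sup>2 + b\<^sup>2) - c * ((1 - (1 + a * r) * exp (- (a * r))) / a\<^sup>2)"
      by (auto dest: integral_unique)
    also have "c * ((1 - (1 + a * r) * exp (- (a * r))) / a\<^sup>2) = (b - b * (1 + a * r) * exp (- (a * r))) / (a\<^sup>2 + b\<^sup>2)"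
    proof -
      have "c / a\<^sup>2 = b / (a\<^sup>2 + b\<^sup>2)" using a by (simp add: c_def)
      then have e: "c * (X / a\<^sup>2) = (b * X) / (a\<^sup>2 + b\<^sup>2)" for X by (metis times_divide_eq_left times_divide_eq_right)
      have "b * (1 - (1 + a * r) * exp (- (a * r))) = b - b * (1 + a * r) * exp (- (a * r))" by (simp add: algebra_simps)
      then show ?thesis unfolding e by simp
    qed
    also have "(b - (b * cos (b * r) + a * sin (b * r)) * exp (- (a * r))) / (a\<^sup>2 + b\<^sup>2) - \<dots>
       = (b * (1 + a * r) - (b * cos (b * r) + a * sin (b * r))) * exp (- (a * r)) / (a\<^sup>2 + b\<^sup>2)"
      by (simp add: diff_divide_distrib[symmetric] algebra_simps)
    also have "\<dots> \<ge> 0"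
    proof -
      have "b * cos (b * r) \<le> b * 1" using b by (intro mult_left_mono) auto
      moreover have "a * sin (b * r) \<le> a * (b * r)" using a b r by (intro mult_left_mono sin_x_le_x) auto
      ultimately have "0 \<le> b * (1 + a * r) - (b * cos (b * r) + a * sin (b * r))" by (simp add: algebra_simps)
      then show ?thesis by simp
    qed
    finally show "0 \<le> integral {0..r} (\<lambda>y. y * exp (- (a * y)) * (b * sinc (b * y) - c))" .
  qed
  also have "\<dots> = (\<integral>y. sin (b * y) / y * exp (- (a * y)) - c * exp (- (a * y)) \<partial>\<kappa>)"
  proof (rule integral_cong_AE)
    show "AE y in \<kappa>. (b * sinc (b * y) - c) * exp (- (a * y)) = sin (b * y) / y * exp (- (a * y)) - c * exp (- (a * y))"
      using AE_kappa by eventually_elim (use b in \<open>cases "b = 0", auto simp: algebra_simps\<close>)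
  qed auto
  also have "\<dots> = (\<integral>y. sin (b * y) / y * exp (- (a * y)) \<partial>\<kappa>) - c * g a"
  proof -
    have "integrable \<kappa> (\<lambda>y. sin (b * y) / y * exp (- (a * y)))"
    proof (rule integrable_kappa_bound[OF a, where B=b])
      fix y :: real assume y: "0 < y"
      have "\<bar>sin (b * y)\<bar> \<le> b * y" using abs_sin_x_le_abs_x[of "b * y"] b y by simp
      then have "\<bar>sin (b * y) / y\<bar> \<le> b" using y by (simp add: field_simps)
      then show "norm (sin (b * y) / y * exp (- (a * y))) \<le> b * exp (- (a * y))"
        using mult_right_mono[of "\<bar>sin (b * y) / y\<bar>" b "exp (- (a * y))"] by (simp only: real_norm_def abs_mult abs_exp_cancel exp_ge_zero)
    qed auto
    then show ?thesis using integrable_exp[OF a] by (simp add: g_def)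
  qed
  finally show ?thesis by (simp add: c_def)
qed

text \<open>
  Both sides vanish at \<open>b = 0\<close>, and the previous lemma compares their derivatives in \<open>b\<close>.
\<close>

lemma kappa_cos_lower: "a\<^sup>2 / 2 * ln (1 + (b / a)\<^sup>2) * g a \<le> (\<integral>y. (1 - cos (b * y)) / y\<^sup>2 * exp (- (a * y)) \<partial>\<kappa>)"
  if a: "0 < a" and b: "0 \<le> b"
proof -
  define G where "G = (\<lambda>b. (\<integral>y. (1 - cos (b * y)) / y\<^sup>2 * exp (- (a * y)) \<partial>\<kappa>) - a\<^sup>2 / 2 * ln (1 + (b / a)\<^sup>2) * g a)"
  have int: "integrable \<kappa> (\<lambda>y. (1 - cos (x * y)) / y\<^sup>2 * exp (- (a * y)))" for x
  proof (rule integrable_kappa_bound[OF a, where B="x\<^sup>2 / 2"])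
    fix y :: real assume y: "0 < y"
    have "(1 - cos (x * y)) / y\<^sup>2 \<le> x\<^sup>2 / 2" using one_minus_cos_le[of "x * y"] y by (simp add: field_simps)
    moreover have "0 \<le> (1 - cos (x * y)) / y\<^sup>2" by simp
    ultimately show "norm ((1 - cos (x * y)) / y\<^sup>2 * exp (- (a * y))) \<le> x\<^sup>2 / 2 * exp (- (a * y))"
      using mult_right_mono[of "(1 - cos (x * y)) / y\<^sup>2" "x\<^sup>2 / 2" "exp (- (a * y))"] by (simp only: real_norm_def abs_mult abs_exp_cancel abs_of_nonneg exp_ge_zero)
  qed auto
  have D: "(G has_real_derivative (\<integral>y. sin (x * y) / y * exp (- (a * y)) \<partial>\<kappa>) - a\<^sup>2 * x / (a\<^sup>2 + x\<^sup>2) * g a) (at x)" for x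
  proof -
    have "((\<lambda>x. \<integral>y. (1 - cos (x * y)) / y\<^sup>2 * exp (- (a * y)) \<partial>\<kappa>) has_vector_derivative (\<integral>y. sin (x * y) / y * exp (- (a * y)) \<partial>\<kappa>)) (at x)"
    proof (rule has_vector_derivative_lebesgue_integral(1)[where S="{-(\<bar>x\<bar>+1)<..<\<bar>x\<bar>+1}" and h="\<lambda>y. (\<bar>x\<bar>+1) * exp (- (a * y))" and f'="\<lambda>x y. sin (x * y) / y * exp (- (a * y))"])
      show "AE y in \<kappa>. \<forall>u\<in>{-(\<bar>x\<bar>+1)<..<\<bar>x\<bar>+1}. ((\<lambda>u. (1 - cos (u * y)) / y\<^sup>2 * exp (- (a * y))) has_vector_derivative sin (u * y) / y * exp (- (a * y))) (at u) \<and> norm (sin (u * y) / y * exp (- (a * y))) \<le> (\<bar>x\<bar>+1) * exp (- (a * y))"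
        using AE_kappa
      proof eventually_elim
        case (elim y)
        show ?case
        proof (intro ballI conjI)
          fix u assume u: "u \<in> {-(\<bar>x\<bar>+1)<..<\<bar>x\<bar>+1}"
          show "((\<lambda>u. (1 - cos (u * y)) / y\<^sup>2 * exp (- (a * y))) has_vector_derivative sin (u * y) / y * exp (- (a * y))) (at u)"
            unfolding has_real_derivative_iff_has_vector_derivative[symmetric]
            using elim by (auto intro!: derivative_eq_intros simp: field_simps power2_eq_square)
          have "\<bar>sin (u * y)\<bar> \<le> \<bar>u\<bar> * y" using abs_sin_x_le_abs_x[of "u * y"] elim by (simp add: abs_mult)
          also have "\<dots> \<le> (\<bar>x\<bar>+1) * y" using u elim by (intro mult_right_mono) auto
          finally have "\<bar>sin (u * y) / y\<bar> \<le> \<bar>x\<bar>+1" using elim by (simp add: field_simps)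
          then show "norm (sin (u * y) / y * exp (- (a * y))) \<le> (\<bar>x\<bar>+1) * exp (- (a * y))"
            using mult_right_mono[of "\<bar>sin (u * y) / y\<bar>" "\<bar>x\<bar>+1" "exp (- (a * y))"] by (simp only: real_norm_def abs_mult abs_exp_cancel exp_ge_zero)
        qed
      qed
    qed (use int integrable_exp[OF a] in auto)
    moreover have "((\<lambda>x. a\<^sup>2 / 2 * ln (1 + (x / a)\<^sup>2) * g a) has_real_derivative a\<^sup>2 * x / (a\<^sup>2 + x\<^sup>2) * g a) (at x)"
    proof -
      have nz: "1 + (x / a)\<^sup>2 > 0" by (simp add: add_pos_nonneg)
      have "((\<lambda>x. a\<^sup>2 / 2 * ln (1 + (x / a)\<^sup>2) * g a) has_real_derivative a\<^sup>2 / 2 * ((2 * (x / a) * (1 / a)) / (1 + (x / a)\<^sup>2)) * g a) (at x)"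
      proof -
        have h: "((\<lambda>x. 1 + (x / a)\<^sup>2) has_real_derivative 2 * (x / a) * (1 / a)) (at x)"
          using a by (auto intro!: derivative_eq_intros)
        have "((\<lambda>x. ln (1 + (x / a)\<^sup>2)) has_real_derivative (2 * (x / a) * (1 / a)) / (1 + (x / a)\<^sup>2)) (at x)"
          using DERIV_chain2[OF DERIV_ln_divide[OF nz] h] by (simp only: times_divide_eq_left mult_1_left)
        then show ?thesis by (intro DERIV_cmult DERIV_cmult_right)
      qed
      moreover have "a\<^sup>2 / 2 * ((2 * (x / a) * (1 / a)) / (1 + (x / a)\<^sup>2)) = a\<^sup>2 * x / (a\<^sup>2 + x\<^sup>2)"
      proof -
        have "1 + (x / a)\<^sup>2 = (a\<^sup>2 + x\<^sup>2) / a\<^sup>2" using a by (simp add: field_simps)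
        then show ?thesis using a by (simp add: power2_eq_square)
      qed
      ultimately show ?thesis by (simp only:)
    qed
    ultimately show ?thesis
      unfolding G_def has_real_derivative_iff_has_vector_derivative[symmetric] by (intro DERIV_diff)
  qed
  have "G 0 \<le> G b"
  proof (rule DERIV_nonneg_imp_nondecreasing[OF b])
    fix x assume x: "0 \<le> x" "x \<le> b"
    show "\<exists>y. (G has_real_derivative y) (at x) \<and> 0 \<le> y"
      using D[of x] kappa_sin_lower[OF a x(1)] by (intro exI conjI) auto
  qed
  then show ?thesis by (simp add: G_def)
qed

text \<open>
  A bound \<open>g(a) \<le> Z / a\<^sup>2\<close> would make \<open>g = (ln \<phi>)'\<close> integrable at infinity and \<open>\<phi>\<close> bounded.
\<close>

lemma g_scaled_at_top: "filterlim (\<lambda>a. a\<^sup>2 * g a) at_top at_top"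
  unfolding filterlim_at_top
proof
  fix Z :: real
  have "\<exists>a>0. Z \<le> a\<^sup>2 * g a"
  proof (rule ccontr)
    assume "\<not> ?thesis"
    then have Z: "a\<^sup>2 * g a < Z" if "0 < a" for a using that by force
    have "ln (\<phi> u) \<le> ln (\<phi> 1) + Z" if u: "1 \<le> u" for u
    proof -
      have "ln (\<phi> u) + Z / u \<le> ln (\<phi> 1) + Z / 1"
      proof (rule DERIV_nonpos_imp_nonincreasing[OF u, where f="\<lambda>u. ln (\<phi> u) + Z / u"])
        fix x :: real assume x: "1 \<le> x"
        then have x0: "0 < x" by simp
        have "((\<lambda>u. ln (\<phi> u) + Z / u) has_real_derivative g x - Z / x\<^sup>2) (at x)"
          using x0 phi_pos[OF x0]
          by (auto intro!: derivative_eq_intros phi_deriv[OF x0] simp: g_eq power2_eq_square divide_inverse)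
        moreover have "g x - Z / x\<^sup>2 \<le> 0" using Z[OF x0] x0 by (simp add: field_simps)
        ultimately show "\<exists>y. ((\<lambda>u. ln (\<phi> u) + Z / u) has_real_derivative y) (at x) \<and> y \<le> 0" by blast
      qed
      moreover have "0 \<le> Z / u" using Z[of 1] g_pos[of 1] u by simp
      ultimately show ?thesis by simp
    qed
    moreover have "filterlim (\<lambda>u. ln (\<phi> u)) at_top at_top"
      by (rule filterlim_compose[OF ln_at_top phi_at_top])
    then have "\<forall>\<^sub>F u in at_top. ln (\<phi> 1) + Z < ln (\<phi> u) \<and> 1 \<le> u"
      by (intro eventually_conj eventually_ge_at_top) (auto simp: filterlim_at_top_dense)
    ultimately show False by (force simp: eventually_at_top_linorder)
  qed
  then obtain a where "0 < a" "Z \<le> a\<^sup>2 * g a" by blast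
  then show "\<forall>\<^sub>F x in at_top. Z \<le> x\<^sup>2 * g x"
  proof (intro eventually_mono[OF eventually_ge_at_top[of a]])
    fix x assume "a \<le> x"
    then show "Z \<le> x\<^sup>2 * g x" using g_scaled_mono[OF \<open>0 < a\<close>, of x] \<open>Z \<le> a\<^sup>2 * g a\<close> by linarith
  qed
qed

text \<open>
  The decay of the modulus of the Mellin transform along a vertical line: the real part of \<open>\<Psi>\<close> drops by
  \<open>decay a b\<close> between \<open>a\<close> and \<open>a + ib\<close>.
\<close>

definition decay :: "real \<Rightarrow> real \<Rightarrow> real" where
  "decay a b = (\<integral>y. (1 - cos (b * y)) * exp (- (a * y)) / (y * (exp y - 1)) \<partial>\<kappa>)"


lemma integrable_decay: "integrable \<kappa> (\<lambda>y. (1 - cos (b * y)) * exp (- (a * y)) / (y * (exp y - 1)))"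
  if a: "0 < a"
proof (rule integrable_kappa_bound[OF a, where B="b\<^sup>2 / 2"])
  fix y :: real assume y: "0 < y"
  have "(1 - cos (b * y)) / (y * (exp y - 1)) \<le> ((b * y)\<^sup>2 / 2) / (y * y)"
    using one_minus_cos_le[of "b * y"] y le_exp_minus_1[of y] by (intro frac_le) auto
  also have "\<dots> = b\<^sup>2 / 2" using y by (simp add: power2_eq_square)
  finally have 1: "(1 - cos (b * y)) / (y * (exp y - 1)) \<le> b\<^sup>2 / 2" .
  have 2: "0 \<le> (1 - cos (b * y)) / (y * (exp y - 1))" using y by simp
  have "norm ((1 - cos (b * y)) * exp (- (a * y)) / (y * (exp y - 1))) = (1 - cos (b * y)) / (y * (exp y - 1)) * exp (- (a * y))"
    using y by (simp add: abs_mult)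
  also have "\<dots> \<le> b\<^sup>2 / 2 * exp (- (a * y))" by (rule mult_right_mono[OF 1]) simp
  finally show "norm ((1 - cos (b * y)) * exp (- (a * y)) / (y * (exp y - 1))) \<le> b\<^sup>2 / 2 * exp (- (a * y))" .
qed auto

text \<open>
  Since \<open>1 / (exp y - 1) \<ge> exp (- y) / y\<close>, the Levy measure of the exponent may be replaced by
  \<open>\<kappa>(dy) / y\<^sup>2\<close> at the price of passing from \<open>a\<close> to \<open>a + 1\<close>. Larger values of \<open>A\<close> are allowed so that, on a fixed line, the modulus is
  seen to decay faster than any power of \<open>b\<close>.
\<close>

lemma decay_lower: "A\<^sup>2 / 2 * ln (1 + (b / A)\<^sup>2) * g A \<le> decay a b" if a: "0 < a" and A: "a + 1 \<le> A"
proof -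
  have A0: "0 < A" using a A by simp
  have even: "cos (\<bar>b\<bar> * y) = cos (b * y)" for y by (cases "0 \<le> b") auto
  have "A\<^sup>2 / 2 * ln (1 + (b / A)\<^sup>2) * g A = A\<^sup>2 / 2 * ln (1 + (\<bar>b\<bar> / A)\<^sup>2) * g A" by (simp add: power_divide)
  also have "\<dots> \<le> (\<integral>y. (1 - cos (\<bar>b\<bar> * y)) / y\<^sup>2 * exp (- (A * y)) \<partial>\<kappa>)"
    by (rule kappa_cos_lower[OF A0]) simp
  also have "\<dots> = (\<integral>y. (1 - cos (b * y)) / y\<^sup>2 * exp (- (A * y)) \<partial>\<kappa>)" by (simp only: even)
  also have "\<dots> \<le> decay a b"
    unfolding decay_def
  proof (rule integral_mono_AE'[OF integrable_decay[OF a]])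
    show "AE y in \<kappa>. (1 - cos (b * y)) / y\<^sup>2 * exp (- (A * y)) \<le> (1 - cos (b * y)) * exp (- (a * y)) / (y * (exp y - 1))"
      using AE_kappa
    proof eventually_elim
      case (elim y)
      have "exp (- (A * y)) \<le> exp (- ((a + 1) * y))" using A elim by simp
      also have "\<dots> = exp (- (a * y)) * exp (- y)" by (simp add: exp_add[symmetric] algebra_simps)
      finally have "exp (- (A * y)) / y \<le> exp (- (a * y)) * (exp (- y) / y)" using elim by (simp add: divide_right_mono)
      also have "\<dots> \<le> exp (- (a * y)) * (1 / (exp y - 1))" using exp_div_le[OF elim] by (intro mult_left_mono) auto
      finally have "(1 - cos (b * y)) / y * (exp (- (A * y)) / y) \<le> (1 - cos (b * y)) / y * (exp (- (a * y)) * (1 / (exp y - 1)))"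
        using elim by (intro mult_left_mono) auto
      then show ?case by (simp add: power2_eq_square)
    qed
    show "AE y in \<kappa>. 0 \<le> (1 - cos (b * y)) * exp (- (a * y)) / (y * (exp y - 1))"
      using AE_kappa by eventually_elim simp
  qed
  finally show ?thesis .
qed

end

section \<open>The exponent near the real axis and Stirling's formula\<close>

lemma exp_minus_taylor2: "cmod (exp (- w) - 1 + w) \<le> cmod w ^ 2" if "0 \<le> Re w"
proof -
  have "cmod (exp (- w) - (\<Sum>i\<le>1. exp 0 * (- w - 0) ^ i / fact i)) \<le> 1 * cmod (- w - 0) ^ Suc 1 / fact 1"
    by (rule complex_Taylor[where S="{z. Re z \<le> 0}" and f="\<lambda>i. exp" and w=0 and z="- w" and n=1 and B=1])
       (use that in \<open>auto intro!: convex_halfspace_Re_le DERIV_subset[OF DERIV_exp]\<close>)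
  then show ?thesis by (simp add: power2_eq_square algebra_simps)
qed

lemma exp_minus_taylor3: "cmod (exp (- w) - 1 + w - w\<^sup>2 / 2) \<le> cmod w ^ 3" if "0 \<le> Re w"
proof -
  have "cmod (exp (- w) - (\<Sum>i\<le>2. exp 0 * (- w - 0) ^ i / fact i)) \<le> 1 * cmod (- w - 0) ^ Suc 2 / fact 2"
    by (rule complex_Taylor[where S="{z. Re z \<le> 0}" and f="\<lambda>i. exp" and w=0 and z="- w" and n=2 and B=1])
       (use that in \<open>auto intro!: convex_halfspace_Re_le DERIV_subset[OF DERIV_exp]\<close>)
  then have "cmod (exp (- w) - 1 + w - w\<^sup>2 / 2) \<le> cmod w ^ 3 / 2"
    by (simp add: numeral_2_eq_2 power2_eq_square power3_eq_cube algebra_simps)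
  also have "\<dots> \<le> cmod w ^ 3" by simp
  finally show ?thesis .
qed

lemma div_exp_minus_1_le: "y / (exp y - 1) \<le> 2 * exp (- (1 / 2 * y))" if "0 < y" for y :: real
proof -
  have "exp (y / 2) * (y / 2) \<le> (exp (y / 2) + 1) * (exp (y / 2) - 1)"
    using le_exp_minus_1[of "y / 2"] that by (intro mult_mono) auto
  also have "\<dots> = exp (y / 2) * exp (y / 2) - 1" by (simp add: algebra_simps)
  also have "\<dots> = exp y - 1" by (simp add: exp_add[symmetric])
  finally have "y * exp (y / 2) \<le> 2 * (exp y - 1)" by (simp add: mult.commute)
  then have "y / (exp y - 1) \<le> 2 / exp (y / 2)"
    using that by (simp add: field_simps)
  then show ?thesis by (simp add: exp_minus inverse_eq_divide)
qed

lemma exp_minus_le_quadratic: "exp (- y) \<le> 1 - y + y\<^sup>2 / 2" if "0 \<le> y" for y :: real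
proof -
  have "1 - 0 + 0\<^sup>2 / 2 - exp (- 0) \<le> 1 - y + y\<^sup>2 / 2 - exp (- y)"
  proof (rule DERIV_nonneg_imp_nondecreasing[OF that, where f="\<lambda>y. 1 - y + y\<^sup>2 / 2 - exp (- y)"])
    fix x :: real
    have "0 \<le> -1 + x + exp (- x)" using exp_ge_add_one_self[of "- x"] by linarith
    then show "\<exists>d. ((\<lambda>y. 1 - y + y\<^sup>2 / 2 - exp (- y)) has_real_derivative d) (at x) \<and> 0 \<le> d"
      by (intro exI[of _ "-1 + x + exp (- x)"]) (auto intro!: derivative_eq_intros)
  qed
  then show ?thesis by simp
qed

text \<open>
  The kernel of Binet's formula for the logarithm of the Gamma function, which is the case \<open>\<phi>(u) = u\<close>.
\<close>

definition binet :: "real \<Rightarrow> real" where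
  "binet y = (1 / (exp y - 1) - 1 / y + 1 / 2) / y"

lemma binet_bounds: "0 \<le> binet y" "binet y \<le> exp y" if y: "0 < y"
proof -
  \<comment> \<open>the numerator of \<open>binet y\<close>, which vanishes to third order at 0\<close>
  define n where "n = y + 2 + (y - 2) * exp y"
  have e: "0 < exp y - 1" "y \<le> exp y - 1" using y le_exp_minus_1[of y] by auto
  have b: "binet y = n / (2 * y\<^sup>2 * (exp y - 1))"
  proof -
    define E where "E = exp y - 1"
    have "n = 2 * y - 2 * E + y * E" by (simp add: n_def E_def algebra_simps)
    moreover have "E \<noteq> 0" using e by (simp add: E_def)
    ultimately show ?thesis
      using y unfolding binet_def E_def[symmetric] by (simp add: field_simps power2_eq_square)
  qed
  have "0 + 2 + (0 - 2) * exp 0 \<le> y + 2 + (y - 2) * exp y"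
  proof (rule DERIV_nonneg_imp_nondecreasing[where f="\<lambda>y. y + 2 + (y - 2) * exp y"])
    fix x :: real
    have "exp x * (1 - x) \<le> exp x * exp (- x)" using exp_ge_add_one_self[of "- x"] by (intro mult_left_mono) auto
    then have "0 \<le> 1 + (x - 1) * exp x" by (simp add: exp_minus algebra_simps)
    then show "\<exists>d. ((\<lambda>y. y + 2 + (y - 2) * exp y) has_real_derivative d) (at x) \<and> 0 \<le> d"
      by (intro exI[of _ "1 + (x - 1) * exp x"]) (auto intro!: derivative_eq_intros simp: algebra_simps)
  qed (use y in simp)
  then have n0: "0 \<le> n" by (simp add: n_def)
  then show "0 \<le> binet y" using b y e by simp
  have "(y + 2) * exp (- y) \<le> (y + 2) * (1 - y + y\<^sup>2 / 2)"
    using exp_minus_le_quadratic[of y] y by (intro mult_left_mono) auto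
  also have "\<dots> = 2 - y + y ^ 3 / 2" by (simp add: algebra_simps power2_eq_square power3_eq_cube)
  finally have "(y + 2) * exp (- y) * exp y \<le> (2 - y + y ^ 3 / 2) * exp y" by (intro mult_right_mono) auto
  moreover have "(y + 2) * exp (- y) * exp y = y + 2" by (simp add: exp_minus)
  ultimately have "n \<le> y ^ 3 / 2 * exp y" unfolding n_def by (simp add: algebra_simps)
  then have "binet y \<le> (y ^ 3 / 2 * exp y) / (2 * y\<^sup>2 * y)"
    unfolding b using y e n0 by (intro frac_le) auto
  also have "\<dots> = exp y / 4" using y by (simp add: power2_eq_square power3_eq_cube)
  also have "\<dots> \<le> exp y" by simp
  finally show "binet y \<le> exp y" .
qed

context jurek
begin

text \<open>
  Differentiation under the integral against \<open>\<kappa>\<close>, with integrability of \<open>f u\<close> deduced from \<open>f 1 = 0\<close> and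
  the bound on the derivative. It represents functions with a known derivative as integrals against \<open>\<kappa>\<close>.
\<close>

lemma kappa_parameter_integral:
  fixes f f' :: "real \<Rightarrow> real \<Rightarrow> real"
  assumes u: "0 < u"
    and meas: "\<And>v. f v \<in> borel_measurable borel" "\<And>v. f' v \<in> borel_measurable borel"
    and base: "\<And>y. 0 < y \<Longrightarrow> f 1 y = 0"
    and der: "\<And>v y. 0 < v \<Longrightarrow> 0 < y \<Longrightarrow> ((\<lambda>v. f v y) has_real_derivative f' v y) (at v)"
    and bnd: "\<And>v y. 0 < v \<Longrightarrow> 0 < y \<Longrightarrow> \<bar>f' v y\<bar> \<le> (1 + v) * exp (- (v * y))"
  shows "((\<lambda>v. \<integral>y. f v y \<partial>\<kappa>) has_real_derivative (\<integral>y. f' u y \<partial>\<kappa>)) (at u) \<and> integrable \<kappa> (f u)"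
proof -
  \<comment> \<open>the interval (l,r) contains both u and the base point 1 and stays away from 0\<close>
  define l where "l = min 1 u / 2"
  define r where "r = max 1 u + 1"
  have lr: "0 < l" "l < 1" "l < u" "1 < r" "u < r" using u unfolding l_def r_def by linarith+
  define h where "h = (\<lambda>y. (1 + r) * exp (- (l * y)))"
  have h_int: "integrable \<kappa> h" unfolding h_def by (rule integrable_mult_right) (rule integrable_exp[OF lr(1)])
  have bnd': "\<bar>f' v y\<bar> \<le> h y" if v: "v \<in> {l<..<r}" and y: "0 < y" for v y
  proof -
    have v': "0 < v" "l \<le> v" "v \<le> r" using v lr by auto
    have "\<bar>f' v y\<bar> \<le> (1 + v) * exp (- (v * y))" by (rule bnd[OF v'(1) y])
    also have "\<dots> \<le> (1 + r) * exp (- (l * y))"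
    proof (rule mult_mono)
      have "l * y \<le> v * y" by (rule mult_right_mono[OF v'(2)]) (use y in simp)
      then show "exp (- (v * y)) \<le> exp (- (l * y))" by simp
    qed (use v' lr in simp_all)
    finally show ?thesis by (simp only: h_def)
  qed
  have int: "integrable \<kappa> (f v)" if v: "v \<in> {l<..<r}" for v
  proof (rule integrable_kappa_bound[OF lr(1), where B="\<bar>v - 1\<bar> * (1 + r)"])
    show "f v \<in> borel_measurable borel" by (rule meas)
    fix y :: real assume y: "0 < y"
    have "\<bar>f v y - f 1 y\<bar> \<le> h y * \<bar>v - 1\<bar>"
    proof -
      have "norm (f v y - f 1 y) \<le> h y * norm (v - 1)"
      proof (rule field_differentiable_bound[of "{l<..<r}" "\<lambda>v. f v y" "\<lambda>v. f' v y" "h y"])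
        fix z assume z: "z \<in> {l<..<r}"
        then have z0: "0 < z" using lr by simp
        show "((\<lambda>v. f v y) has_real_derivative f' z y) (at z within {l<..<r})"
          by (rule has_field_derivative_at_within[OF der[OF z0 y]])
        show "norm (f' z y) \<le> h y" using bnd'[OF z y] by (simp only: real_norm_def)
      next
        show "convex {l<..<r}" by (rule convex_real_interval)
        show "v \<in> {l<..<r}" by (rule v)
        show "1 \<in> {l<..<r}" using lr by simp
      qed
      then show ?thesis by (simp only: real_norm_def)
    qed
    then show "norm (f v y) \<le> \<bar>v - 1\<bar> * (1 + r) * exp (- (l * y))"
      unfolding base[OF y] h_def real_norm_def diff_0_right by (simp only: mult.commute mult.left_commute mult.assoc)
  qed
  have "((\<lambda>v. \<integral>y. f v y \<partial>\<kappa>) has_vector_derivative (\<integral>y. f' u y \<partial>\<kappa>)) (at u)"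
  proof (rule has_vector_derivative_lebesgue_integral(1)[where S="{l<..<r}" and h=h])
    show "AE y in \<kappa>. \<forall>v\<in>{l<..<r}. ((\<lambda>u. f u y) has_vector_derivative f' v y) (at v) \<and> norm (f' v y) \<le> h y"
      using AE_kappa
    proof eventually_elim
      case (elim y)
      show ?case
      proof (intro ballI conjI)
        fix v assume v: "v \<in> {l<..<r}"
        then have "0 < v" using lr by simp
        from der[OF this elim] show "((\<lambda>u. f u y) has_vector_derivative f' v y) (at v)"
          by (simp only: has_real_derivative_iff_has_vector_derivative)
        show "norm (f' v y) \<le> h y" using bnd'[OF v elim] by (simp only: real_norm_def)
      qed
    qed
    show "f' u \<in> borel_measurable \<kappa>" using meas(2)[of u] measurable_cong_sets[OF sets_kappa refl] by blast
    show "open {l<..<r}" "convex {l<..<r}" by (rule open_greaterThanLessThan convex_real_interval)+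
    show "u \<in> {l<..<r}" using lr by simp
    show "integrable \<kappa> h" by (rule h_int)
    show "integrable \<kappa> (f v)" if "v \<in> {l<..<r}" for v by (rule int[OF that])
  qed
  then have "((\<lambda>v. \<integral>y. f v y \<partial>\<kappa>) has_real_derivative (\<integral>y. f' u y \<partial>\<kappa>)) (at u)"
    by (simp only: has_real_derivative_iff_has_vector_derivative)
  moreover have "integrable \<kappa> (f u)" by (rule int) (use lr in simp)
  ultimately show ?thesis by (rule conjI)
qed

lemma
  assumes u: "0 < u"
  shows ln_phi_eq: "ln (\<phi> u) = ln (\<phi> 1) + (\<integral>y. (exp (- y) - exp (- (u * y))) / y \<partial>\<kappa>)"
    and integrable_ln_phi: "integrable \<kappa> (\<lambda>y. (exp (- y) - exp (- (u * y))) / y)"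
proof -
  have DI: "((\<lambda>v. \<integral>y. (exp (- y) - exp (- (v * y))) / y \<partial>\<kappa>) has_real_derivative (\<integral>y. exp (- (v * y)) \<partial>\<kappa>)) (at v)
    \<and> integrable \<kappa> (\<lambda>y. (exp (- y) - exp (- (v * y))) / y)" if v: "0 < v" for v
  proof (rule kappa_parameter_integral[OF v, where f="\<lambda>v y. (exp (- y) - exp (- (v * y))) / y" and f'="\<lambda>v y. exp (- (v * y))"])
    fix v y :: real assume vy: "0 < v" "0 < y"
    have "((\<lambda>v. (exp (- y) - exp (- (v * y))) / y) has_real_derivative (exp (- (v * y)) * y) / y) (at v)"
      by (rule DERIV_cdivide) (auto intro!: derivative_eq_intros)
    then show "((\<lambda>v. (exp (- y) - exp (- (v * y))) / y) has_real_derivative exp (- (v * y))) (at v)"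
      using vy by simp
    show "\<bar>exp (- (v * y))\<bar> \<le> (1 + v) * exp (- (v * y))" using vy by simp
  qed (simp_all, measurable)
  note D = DI[THEN conjunct1] and I = DI[THEN conjunct2]
  show "integrable \<kappa> (\<lambda>y. (exp (- y) - exp (- (u * y))) / y)" by (rule I[OF u])
  define F where "F = (\<lambda>u. ln (\<phi> u) - (\<integral>y. (exp (- y) - exp (- (u * y))) / y \<partial>\<kappa>))"
  have "\<exists>c. \<forall>x\<in>{0<..}. F x = c"
  proof (rule has_field_derivative_zero_constant)
    fix x :: real assume "x \<in> {0<..}"
    then have x: "0 < x" by simp
    have "((\<lambda>u. ln (\<phi> u)) has_real_derivative g x) (at x)"
      using x phi_pos[OF x] by (auto intro!: derivative_eq_intros phi_deriv[OF x] simp: g_eq[OF x] divide_inverse)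
    then have "(F has_real_derivative g x - (\<integral>y. exp (- (x * y)) \<partial>\<kappa>)) (at x)"
      unfolding F_def by (intro DERIV_diff D x)
    then show "(F has_real_derivative 0) (at x within {0<..})" by (simp add: g_def has_field_derivative_at_within)
  qed auto
  then have "F u = F 1" using u by force
  then show "ln (\<phi> u) = ln (\<phi> 1) + (\<integral>y. (exp (- y) - exp (- (u * y))) / y \<partial>\<kappa>)" by (simp add: F_def)
qed

text \<open>
  The primitive of \<open>u g(u)\<close> that vanishes at \<open>1\<close>, as an integral against \<open>\<kappa>\<close>.
\<close>

definition phase :: "real \<Rightarrow> real" where
  "phase u = (\<integral>y. ((1 + y) * exp (- y) - (1 + u * y) * exp (- (u * y))) / y\<^sup>2 \<partial>\<kappa>)"

lemma
  assumes u: "0 < u"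
  shows phase_deriv: "(phase has_real_derivative u * g u) (at u)"
    and integrable_phase: "integrable \<kappa> (\<lambda>y. ((1 + y) * exp (- y) - (1 + u * y) * exp (- (u * y))) / y\<^sup>2)"
proof -
  have "((\<lambda>v. \<integral>y. ((1 + y) * exp (- y) - (1 + v * y) * exp (- (v * y))) / y\<^sup>2 \<partial>\<kappa>) has_real_derivative (\<integral>y. u * exp (- (u * y)) \<partial>\<kappa>)) (at u)
     \<and> integrable \<kappa> (\<lambda>y. ((1 + y) * exp (- y) - (1 + u * y) * exp (- (u * y))) / y\<^sup>2)"
  proof (rule kappa_parameter_integral[OF u, where f="\<lambda>u y. ((1 + y) * exp (- y) - (1 + u * y) * exp (- (u * y))) / y\<^sup>2" and f'="\<lambda>u y. u * exp (- (u * y))"])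
    fix v y :: real assume "0 < v" "0 < y"
    have "((\<lambda>v. ((1 + y) * exp (- y) - (1 + v * y) * exp (- (v * y))) / y\<^sup>2) has_real_derivative (v * exp (- (v * y)) * y\<^sup>2) / y\<^sup>2) (at v)"
      by (rule DERIV_cdivide) (auto intro!: derivative_eq_intros simp: algebra_simps power2_eq_square)
    then show "((\<lambda>v. ((1 + y) * exp (- y) - (1 + v * y) * exp (- (v * y))) / y\<^sup>2) has_real_derivative v * exp (- (v * y))) (at v)"
      using \<open>0 < y\<close> by simp
    show "\<bar>v * exp (- (v * y))\<bar> \<le> (1 + v) * exp (- (v * y))" using \<open>0 < v\<close> by (simp add: abs_mult)
  qed (simp_all, measurable)
  then show "(phase has_real_derivative u * g u) (at u)" "integrable \<kappa> (\<lambda>y. ((1 + y) * exp (- y) - (1 + u * y) * exp (- (u * y))) / y\<^sup>2)"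
    unfolding phase_def g_def by simp_all
qed

abbreviation \<Psi> :: "complex \<Rightarrow> complex" where "\<Psi> \<equiv> berg_urbanik_exponent \<phi> \<kappa>"

text \<open>
  The numerator is \<open>O(y\<^sup>2)\<close> at \<open>0\<close>, which cancels the singularity of the denominator, and
  \<open>y / (exp y - 1)\<close> decays exponentially.
\<close>

lemma integrable_Psi:
  assumes z: "0 \<le> Re z"
  shows "integrable \<kappa> (\<lambda>y. (exp (- (z * of_real y)) - 1 - z * of_real (exp (- y) - 1)) / of_real (y * (exp y - 1)))"
proof (rule integrable_kappa_bound[where u="1/2" and B="(cmod z ^ 2 + cmod z) * 2"])
  fix y :: real assume y: "0 < y"
  have e: "0 < exp y - 1" using y by simp
  have "exp (- (z * of_real y)) - 1 - z * of_real (exp (- y) - 1) =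
     (exp (- (z * of_real y)) - 1 + z * of_real y) - z * (exp (- of_real y) - 1 + of_real y)"
    by (simp add: algebra_simps flip: exp_of_real)
  also have "cmod \<dots> \<le> cmod (exp (- (z * of_real y)) - 1 + z * of_real y) + cmod (z * (exp (- of_real y) - 1 + of_real y))"
    by (rule norm_triangle_ineq4)
  also have "\<dots> \<le> cmod (z * of_real y) ^ 2 + cmod z * cmod (of_real y) ^ 2"
    unfolding norm_mult[of z "exp (- of_real y) - 1 + of_real y"] using z y
    by (intro add_mono mult_left_mono exp_minus_taylor2) auto
  also have "\<dots> = (cmod z ^ 2 + cmod z) * (y * y)"
    using y by (simp add: norm_mult power_mult_distrib algebra_simps power2_eq_square)
  finally have "cmod (exp (- (z * of_real y)) - 1 - z * of_real (exp (- y) - 1)) / (y * (exp y - 1)) \<le> (cmod z ^ 2 + cmod z) * (y * y) / (y * (exp y - 1))"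
    using y e by (intro divide_right_mono) auto
  also have "\<dots> = (cmod z ^ 2 + cmod z) * (y / (exp y - 1))" using y by simp
  also have "\<dots> \<le> (cmod z ^ 2 + cmod z) * (2 * exp (- (1 / 2 * y)))"
    by (intro mult_left_mono div_exp_minus_1_le y) auto
  finally show "norm ((exp (- (z * of_real y)) - 1 - z * of_real (exp (- y) - 1)) / of_real (y * (exp y - 1))) \<le> (cmod z ^ 2 + cmod z) * 2 * exp (- (1 / 2 * y))"
    using y e by (simp only: norm_divide norm_of_real abs_of_pos mult_pos_pos mult.assoc)
qed auto

lemma Re_Psi_real:
  assumes a: "0 < a"
  shows "\<Psi> (of_real a) = of_real (a * ln (\<phi> 1) + (\<integral>y. (exp (- (a * y)) - 1 - a * (exp (- y) - 1)) / (y * (exp y - 1)) \<partial>\<kappa>))"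
    and "integrable \<kappa> (\<lambda>y. (exp (- (a * y)) - 1 - a * (exp (- y) - 1)) / (y * (exp y - 1)))"
proof -
  have eq: "(exp (- (of_real a * of_real y)) - 1 - of_real a * of_real (exp (- y) - 1)) / of_real (y * (exp y - 1))
    = complex_of_real ((exp (- (a * y)) - 1 - a * (exp (- y) - 1)) / (y * (exp y - 1)))" for y
    by (simp add: exp_of_real[symmetric])
  show "\<Psi> (of_real a) = of_real (a * ln (\<phi> 1) + (\<integral>y. (exp (- (a * y)) - 1 - a * (exp (- y) - 1)) / (y * (exp y - 1)) \<partial>\<kappa>))"
    unfolding berg_urbanik_exponent_def eq integral_complex_of_real by simp
  show "integrable \<kappa> (\<lambda>y. (exp (- (a * y)) - 1 - a * (exp (- y) - 1)) / (y * (exp y - 1)))"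
    using integrable_Re[OF integrable_Psi[of "of_real a"]] a unfolding eq by (simp only: Re_complex_of_real less_imp_le)
qed

text \<open>
  Stirling's formula for \<open>\<Psi>\<close> on the real axis, by Binet's argument. All terms are integrals against \<open>\<kappa>\<close>,
  and their combined integrand is \<open>binet y exp (- a y)\<close> plus a function of \<open>y\<close> that does not depend on
  \<open>a\<close>. Comparing with the value at \<open>a = 2\<close> removes this function, and what remains is \<open>O(g(a - 1))\<close>.
\<close>

lemma stirling: "\<exists>c. ((\<lambda>a. Re (\<Psi> (of_real a)) - (a + 1 / 2) * ln (\<phi> a) + phase a) \<longlongrightarrow> c) at_top"
proof -
  define R where "R = (\<lambda>a. Re (\<Psi> (of_real a)) - (a + 1 / 2) * ln (\<phi> a) + phase a)"
  define I :: "real \<Rightarrow> real \<Rightarrow> real" where "I = (\<lambda>a y. (exp (- (a * y)) - 1 - a * (exp (- y) - 1)) / (y * (exp y - 1))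
      - (a + 1 / 2) * ((exp (- y) - exp (- (a * y))) / y)
      + ((1 + y) * exp (- y) - (1 + a * y) * exp (- (a * y))) / y\<^sup>2)"
  have I_int: "integrable \<kappa> (I a)" and R_eq: "R a = - (1 / 2) * ln (\<phi> 1) + (\<integral>y. I a y \<partial>\<kappa>)" if a: "0 < a" for a
  proof -
    note i = Re_Psi_real(2)[OF a] integrable_ln_phi[OF a] integrable_phase[OF a]
    show "integrable \<kappa> (I a)" unfolding I_def
      by (intro Bochner_Integration.integrable_add Bochner_Integration.integrable_diff integrable_mult_right i)
    have "(\<integral>y. I a y \<partial>\<kappa>) = (\<integral>y. (exp (- (a * y)) - 1 - a * (exp (- y) - 1)) / (y * (exp y - 1)) \<partial>\<kappa>)
       - (a + 1 / 2) * (\<integral>y. (exp (- y) - exp (- (a * y))) / y \<partial>\<kappa>) + phase a"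
      unfolding I_def phase_def
      by (subst Bochner_Integration.integral_add, intro Bochner_Integration.integrable_diff integrable_mult_right i, rule i(3),
          subst Bochner_Integration.integral_diff, rule i(1), intro integrable_mult_right i, subst Bochner_Integration.integral_mult_right, rule i(2), rule refl)
    then show "R a = - (1 / 2) * ln (\<phi> 1) + (\<integral>y. I a y \<partial>\<kappa>)"
      unfolding R_def Re_Psi_real(1)[OF a] ln_phi_eq[OF a] by (simp add: algebra_simps)
  qed
  have I_diff: "I a y - I 2 y = binet y * exp (- (a * y)) - binet y * exp (- (2 * y))" if y: "0 < y" for a y
  proof -
    have e: "exp y - 1 \<noteq> 0" using y by simp
    have "I a y - binet y * exp (- (a * y)) = - 1 / (y * (exp y - 1)) - exp (- y) / (2 * y) + (1 + y) * exp (- y) / y\<^sup>2" for a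
    proof -
      have x: "a * (exp (- y) - 1) / (y * (exp y - 1)) = - a * exp (- y) / y"
      proof -
        have "exp (- y) - 1 = - exp (- y) * (exp y - 1)" by (simp add: algebra_simps exp_minus)
        then show ?thesis using y e by simp
      qed
      have "I a y = exp (- (a * y)) / (y * (exp y - 1)) - 1 / (y * (exp y - 1)) - a * (exp (- y) - 1) / (y * (exp y - 1))
         - (a + 1 / 2) * ((exp (- y) - exp (- (a * y))) / y) + ((1 + y) * exp (- y) - (1 + a * y) * exp (- (a * y))) / y\<^sup>2"
        by (simp add: I_def diff_divide_distrib)
      moreover have "E / (y * G) - 1 / (y * G) - - a * F / y - (a + 1 / 2) * ((F - E) / y) + ((1 + y) * F - (1 + a * y) * E) / y\<^sup>2 - (1 / G - 1 / y + 1 / 2) / y * E = - 1 / (y * G) - F / (2 * y) + (1 + y) * F / y\<^sup>2"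
        if "G \<noteq> 0" for E F G
        using that y by (simp add: field_simps power2_eq_square)
      from this[OF e, of "exp (- (a * y))" "exp (- y)"] show ?thesis
        using calculation unfolding x binet_def by simp
    qed
    from this[of a] this[of 2] show ?thesis by simp
  qed
  have B_int: "integrable \<kappa> (\<lambda>y. binet y * exp (- (a * y)))" and B_le: "norm (\<integral>y. binet y * exp (- (a * y)) \<partial>\<kappa>) \<le> 1 * g (a - 1)" if a: "1 < a" for a
  proof -
    have m: "(\<lambda>y. binet y * exp (- (a * y))) \<in> borel_measurable borel" unfolding binet_def by measurable
    have b: "norm (binet y * exp (- (a * y))) \<le> 1 * exp (- ((a - 1) * y))" if y: "0 < y" for y
    proof -
      have "binet y * exp (- (a * y)) \<le> exp y * exp (- (a * y))" by (intro mult_right_mono binet_bounds y) auto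
      also have "\<dots> = exp (- ((a - 1) * y))" by (simp add: exp_add[symmetric] algebra_simps)
      finally show ?thesis using binet_bounds(1)[OF y] by (simp add: abs_mult)
    qed
    show "integrable \<kappa> (\<lambda>y. binet y * exp (- (a * y)))" using a by (intro integrable_kappa_bound[OF _ m b]) auto
    show "norm (\<integral>y. binet y * exp (- (a * y)) \<partial>\<kappa>) \<le> 1 * g (a - 1)" using a by (intro norm_integral_kappa_le[OF _ m b]) auto
  qed
  define c where "c = R 2 - (\<integral>y. binet y * exp (- (2 * y)) \<partial>\<kappa>)"
  have R: "R a = c + (\<integral>y. binet y * exp (- (a * y)) \<partial>\<kappa>)" if a: "1 < a" for a
  proof -
    have "(\<integral>y. I a y \<partial>\<kappa>) - (\<integral>y. I 2 y \<partial>\<kappa>) = (\<integral>y. I a y - I 2 y \<partial>\<kappa>)"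
      using a by (subst Bochner_Integration.integral_diff) (auto intro!: I_int)
    also have "\<dots> = (\<integral>y. binet y * exp (- (a * y)) - binet y * exp (- (2 * y)) \<partial>\<kappa>)"
    proof (rule integral_cong_AE)
      show "AE y in \<kappa>. I a y - I 2 y = binet y * exp (- (a * y)) - binet y * exp (- (2 * y))"
        using AE_kappa by eventually_elim (rule I_diff)
    qed (use a I_int[of a] I_int[of 2] B_int[of a] B_int[of 2] in auto)
    also have "\<dots> = (\<integral>y. binet y * exp (- (a * y)) \<partial>\<kappa>) - (\<integral>y. binet y * exp (- (2 * y)) \<partial>\<kappa>)"
      using a by (subst Bochner_Integration.integral_diff) (auto intro!: B_int)
    finally show ?thesis using R_eq[of a] R_eq[of 2] a by (simp add: c_def)
  qed
  have "((\<lambda>a. \<integral>y. binet y * exp (- (a * y)) \<partial>\<kappa>) \<longlongrightarrow> 0) at_top"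
  proof (rule Lim_null_comparison)
    show "((\<lambda>a. g (a - 1)) \<longlongrightarrow> 0) at_top"
      by (rule filterlim_compose[OF g_tendsto_0]) real_asymp
    show "\<forall>\<^sub>F a in at_top. norm (\<integral>y. binet y * exp (- (a * y)) \<partial>\<kappa>) \<le> g (a - 1)"
      using eventually_gt_at_top[of 1] by (rule eventually_mono) (use B_le in simp)
  qed
  then have "((\<lambda>a. c + (\<integral>y. binet y * exp (- (a * y)) \<partial>\<kappa>)) \<longlongrightarrow> c + 0) at_top" by (intro tendsto_intros)
  then have "(R \<longlongrightarrow> c + 0) at_top"
    by (rule Lim_transform_eventually) (use R in \<open>auto intro!: eventually_mono[OF eventually_gt_at_top[of 1]]\<close>)
  then show ?thesis unfolding R_def by blast
qed


text \<open>
  A bound on \<open>- g'(a)\<close>: half of the exponential absorbs the factor \<open>y\<close>, and the scaling property of \<open>g\<close>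
  gives back \<open>g(a)\<close> for \<open>g(a/2)\<close>.
\<close>

lemma kappa_first_moment: "(\<integral>y. y * exp (- (a * y)) \<partial>\<kappa>) \<le> 8 * g a / a"
  and integrable_first_moment: "integrable \<kappa> (\<lambda>y. y * exp (- (a * y)))" if a: "0 < a"
proof -
  have m: "(\<lambda>y::real. y * exp (- (a * y))) \<in> borel_measurable borel" by measurable
  have b: "norm (y * exp (- (a * y))) \<le> 2 / a * exp (- (a / 2 * y))" if y: "0 < y" for y
  proof -
    have "y * exp (- (a * y)) = y * exp (- (a / 2 * y)) * exp (- (a / 2 * y))" by (simp add: exp_add[symmetric] mult.assoc)
    also have "\<dots> \<le> 1 / (a / 2) * exp (- (a / 2 * y))" using a by (intro mult_right_mono mult_exp_le) auto
    finally show ?thesis using y by simp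
  qed
  show "integrable \<kappa> (\<lambda>y. y * exp (- (a * y)))" using a by (intro integrable_kappa_bound[OF _ m b]) auto
  have "(\<integral>y. y * exp (- (a * y)) \<partial>\<kappa>) \<le> norm (\<integral>y. y * exp (- (a * y)) \<partial>\<kappa>)" by simp
  also have "\<dots> \<le> 2 / a * g (a / 2)" using a by (intro norm_integral_kappa_le[OF _ m b]) auto
  also have "\<dots> \<le> 2 / a * (4 * g a)"
    using g_scaled_mono[of "a / 2" a] a by (intro mult_left_mono) (auto simp: power2_eq_square)
  finally show "(\<integral>y. y * exp (- (a * y)) \<partial>\<kappa>) \<le> 8 * g a / a" by simp
qed

text \<open>
  The second derivative of \<open>\<Psi>\<close> on the real axis. It is squeezed between \<open>g(a + 1)\<close> and \<open>g(a)\<close>, so \<open>g\<close> can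
  replace it as the variance of the tilted law.
\<close>

definition variance_integral :: "real \<Rightarrow> real" where
  "variance_integral a = (\<integral>y. y / (exp y - 1) * exp (- (a * y)) \<partial>\<kappa>)"

lemma variance_integral_bounds: "g (a + 1) \<le> variance_integral a" "variance_integral a \<le> g a"
  and integrable_variance: "integrable \<kappa> (\<lambda>y. y / (exp y - 1) * exp (- (a * y)))" if a: "0 < a"
proof -
  have b: "y / (exp y - 1) * exp (- (a * y)) \<le> exp (- (a * y))" "0 \<le> y / (exp y - 1) * exp (- (a * y))"
      "exp (- ((a + 1) * y)) \<le> y / (exp y - 1) * exp (- (a * y))" if y: "0 < y" for y
  proof -
    have "y / (exp y - 1) \<le> 1" "0 \<le> y / (exp y - 1)" using le_exp_minus_1[of y] y by (auto simp: divide_le_eq_1)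
    then show "y / (exp y - 1) * exp (- (a * y)) \<le> exp (- (a * y))" "0 \<le> y / (exp y - 1) * exp (- (a * y))"
      using mult_right_mono[of "y / (exp y - 1)" 1 "exp (- (a * y))"] mult_nonneg_nonneg[of "y / (exp y - 1)" "exp (- (a * y))"]
      by (simp_all only: exp_ge_zero mult_1_left)
    have "exp (- y) \<le> y / (exp y - 1)" using exp_div_le[OF y] y by (simp add: field_simps)
    then have "exp (- y) * exp (- (a * y)) \<le> y / (exp y - 1) * exp (- (a * y))" by (intro mult_right_mono) auto
    then show "exp (- ((a + 1) * y)) \<le> y / (exp y - 1) * exp (- (a * y))"
      by (simp add: exp_add[symmetric] algebra_simps)
  qed
  show i: "integrable \<kappa> (\<lambda>y. y / (exp y - 1) * exp (- (a * y)))"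
  proof (rule integrable_kappa_bound[OF a, where B=1])
    show "norm (y / (exp y - 1) * exp (- (a * y))) \<le> 1 * exp (- (a * y))" if "0 < y" for y
      using b(1,2)[OF that] by (simp only: real_norm_def abs_of_nonneg mult_1_left)
  qed measurable
  show "variance_integral a \<le> g a" unfolding variance_integral_def g_def
  proof (intro integral_mono_AE i integrable_exp a)
    show "AE y in \<kappa>. y / (exp y - 1) * exp (- (a * y)) \<le> exp (- (a * y))"
      using AE_kappa by eventually_elim (rule b(1))
  qed
  show "g (a + 1) \<le> variance_integral a" unfolding variance_integral_def g_def
  proof (intro integral_mono_AE i integrable_exp)
    show "AE y in \<kappa>. exp (- ((a + 1) * y)) \<le> y / (exp y - 1) * exp (- (a * y))"
      using AE_kappa by eventually_elim (rule b(3))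
  qed (use a in simp)
qed

lemma inverse_exp_gap: "0 \<le> 1 / y - 1 / (exp y - 1)" "1 / y - 1 / (exp y - 1) \<le> 1" if y: "0 < y" for y :: real
proof -
  have e: "0 < exp y - 1" "y \<le> exp y - 1" using y le_exp_minus_1[of y] by auto
  show "0 \<le> 1 / y - 1 / (exp y - 1)" using frac_le[of 1 1 y "exp y - 1"] y e by simp
  have "(1 - y) * exp y \<le> exp (- y) * exp y" using exp_ge_add_one_self[of "- y"] by (intro mult_right_mono) auto
  then have "exp y - 1 - y \<le> y * (exp y - 1)" by (simp add: exp_minus algebra_simps)
  moreover have "1 / y - 1 / (exp y - 1) = (exp y - 1 - y) / (y * (exp y - 1))" using y e by (simp add: field_simps)
  ultimately show "1 / y - 1 / (exp y - 1) \<le> 1" using y e by (simp add: divide_le_eq_1)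
qed

text \<open>
  Second order expansion of \<open>\<Psi>\<close> at \<open>a\<close> along the vertical line. The linear term is taken to be
  \<open>b ln (\<phi> a)\<close> and not \<open>b \<Psi>'(a)\<close>, so that the saddle point for \<open>x = \<phi> a\<close> is exactly \<open>a\<close>; the price is
  the error \<open>\<bar>b\<bar> g a\<close>, which comes from \<open>0 \<le> 1/y - 1/(exp y - 1) \<le> 1\<close>.
\<close>

lemma Psi_increment_bound:
  assumes a: "0 < a"
  shows "cmod (\<Psi> (Complex a b) - \<Psi> (of_real a) - \<i> * of_real (b * ln (\<phi> a)) + of_real (b\<^sup>2 / 2 * variance_integral a))
     \<le> \<bar>b\<bar> ^ 3 * (8 * g a / a) + \<bar>b\<bar> * g a"
proof -
  let ?K = "\<lambda>y. y * (exp y - 1)"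
  define f1 where "f1 = (\<lambda>z y. (exp (- (z * complex_of_real y)) - 1 - z * of_real (exp (- y) - 1)) / of_real (?K y))"
  have f1_int: "integrable \<kappa> (f1 z)" if "0 \<le> Re z" for z
    unfolding f1_def by (rule integrable_Psi[OF that])
  have Psi: "\<Psi> z = z * of_real (ln (\<phi> 1)) + (\<integral>y. f1 z y \<partial>\<kappa>)" for z
    unfolding berg_urbanik_exponent_def f1_def ..
  let ?l = "\<lambda>y. (exp (- y) - exp (- (a * y))) / y"
  let ?v = "\<lambda>y. y / (exp y - 1) * exp (- (a * y))"
  let ?d = "\<lambda>y. f1 (Complex a b) y - f1 (of_real a) y - \<i> * of_real b * of_real (?l y) + of_real (b\<^sup>2 / 2) * of_real (?v y)"
  note il = integrable_ln_phi[OF a] and iv = integrable_variance[OF a]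
  have il': "integrable \<kappa> (\<lambda>y. \<i> * of_real b * complex_of_real (?l y))"
    by (intro integrable_mult_right integrable_of_real il)
  have iv': "integrable \<kappa> (\<lambda>y. of_real (b\<^sup>2 / 2) * complex_of_real (?v y))"
    by (intro integrable_mult_right integrable_of_real iv)
  have ia: "integrable \<kappa> (f1 (Complex a b))" "integrable \<kappa> (f1 (of_real a))" using a by (auto intro!: f1_int)
  have "(\<integral>y. ?d y \<partial>\<kappa>) = (\<integral>y. f1 (Complex a b) y \<partial>\<kappa>) - (\<integral>y. f1 (of_real a) y \<partial>\<kappa>) - (\<integral>y. \<i> * of_real b * complex_of_real (?l y) \<partial>\<kappa>) + (\<integral>y. of_real (b\<^sup>2 / 2) * complex_of_real (?v y) \<partial>\<kappa>)"
    using ia il' iv' by (simp only: Bochner_Integration.integral_add Bochner_Integration.integral_diff Bochner_Integration.integrable_diff)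
  also have "(\<integral>y. \<i> * of_real b * complex_of_real (?l y) \<partial>\<kappa>) = \<i> * of_real b * complex_of_real (\<integral>y. ?l y \<partial>\<kappa>)"
    by (simp only: integral_mult_right_zero integral_complex_of_real)
  also have "(\<integral>y. of_real (b\<^sup>2 / 2) * complex_of_real (?v y) \<partial>\<kappa>) = of_real (b\<^sup>2 / 2) * complex_of_real (variance_integral a)"
    by (simp only: integral_mult_right_zero integral_complex_of_real variance_integral_def)
  also have "(\<integral>y. f1 (Complex a b) y \<partial>\<kappa>) = \<Psi> (Complex a b) - Complex a b * of_real (ln (\<phi> 1))" by (simp add: Psi)
  also have "(\<integral>y. f1 (of_real a) y \<partial>\<kappa>) = \<Psi> (of_real a) - of_real a * of_real (ln (\<phi> 1))" by (simp add: Psi)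
  also have "(\<integral>y. ?l y \<partial>\<kappa>) = ln (\<phi> a) - ln (\<phi> 1)" using ln_phi_eq[OF a] by simp
  finally have eq: "\<Psi> (Complex a b) - \<Psi> (of_real a) - \<i> * of_real (b * ln (\<phi> a)) + of_real (b\<^sup>2 / 2 * variance_integral a) = (\<integral>y. ?d y \<partial>\<kappa>)"
    by (simp add: Complex_eq algebra_simps)
  have ib: "integrable \<kappa> (\<lambda>y. \<bar>b\<bar> ^ 3 * (y * exp (- (a * y))) + \<bar>b\<bar> * exp (- (a * y)))"
    by (intro Bochner_Integration.integrable_add integrable_mult_right integrable_first_moment integrable_exp a)
  have "cmod (\<integral>y. ?d y \<partial>\<kappa>) \<le> (\<integral>y. cmod (?d y) \<partial>\<kappa>)" by (rule integral_norm_bound)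
  also have "\<dots> \<le> (\<integral>y. \<bar>b\<bar> ^ 3 * (y * exp (- (a * y))) + \<bar>b\<bar> * exp (- (a * y)) \<partial>\<kappa>)"
  proof (rule integral_mono_AE[OF _ ib])
    show "integrable \<kappa> (\<lambda>y. cmod (?d y))"
      by (intro integrable_norm Bochner_Integration.integrable_add Bochner_Integration.integrable_diff ia il' iv')
    show "AE y in \<kappa>. cmod (?d y) \<le> \<bar>b\<bar> ^ 3 * (y * exp (- (a * y))) + \<bar>b\<bar> * exp (- (a * y))"
      using AE_kappa
    proof eventually_elim
      case (elim y)
      have e: "0 < exp y - 1" "y \<le> exp y - 1" using elim le_exp_minus_1[of y] by auto
      define w where "w = \<i> * complex_of_real (b * y)"
      define E where "E = complex_of_real (exp (- (a * y)))"
      define G where "G = complex_of_real (exp y - 1)"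
      define Y where "Y = complex_of_real y"
      have nz: "G \<noteq> 0" "Y \<noteq> 0" using e elim by (auto simp: G_def Y_def simp del: of_real_diff)
      have x: "complex_of_real (exp (- y)) * (G + 1) = 1"
        unfolding G_def by (simp add: exp_minus flip: of_real_mult of_real_add)
      have ez: "exp (- (Complex a b * complex_of_real y)) = E * exp (- w)"
        by (simp add: E_def w_def Complex_eq exp_add[symmetric] algebra_simps flip: exp_of_real)
      have ea: "exp (- (complex_of_real a * complex_of_real y)) = E" by (simp add: E_def flip: exp_of_real)
      have "?d y = E * (exp (- w) - 1 + w - w\<^sup>2 / 2) / (Y * G) + \<i> * of_real b * E * (1 / Y - 1 / G)"
      proof -
        define F where "F = complex_of_real (exp (- y))"
        have alg: "(E * X - 1 - (A' + c) * - (F * G)) / (Y * G) - (E - 1 - A' * - (F * G)) / (Y * G) - c * ((F - E) / Y) + q * (Y / G * E)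
            = E * (X - 1 + c * Y + q * Y\<^sup>2) / (Y * G) + c * E * (1 / Y - 1 / G)" for X A' c q
          using nz by (simp add: field_simps power2_eq_square)
        have l: "complex_of_real (?l y) = (F - E) / Y" by (simp add: F_def E_def Y_def)
        have v: "complex_of_real (?v y) = Y / G * E" by (simp add: G_def E_def Y_def)
        have K: "complex_of_real (?K y) = Y * G" by (simp add: G_def Y_def)
        have F: "complex_of_real (exp (- y) - 1) = - (F * G)"
        proof -
          have "F * (G + 1) = 1" using x by (simp add: F_def)
          then have "F - 1 = - (F * G)" by (simp add: algebra_simps)
          then show ?thesis by (simp add: F_def)
        qed
        have wY: "w = \<i> * of_real b * Y" by (simp add: w_def Y_def)
        have w2: "exp (- w) - 1 + w - w\<^sup>2 / 2 = exp (- w) - 1 + \<i> * of_real b * Y + of_real (b\<^sup>2 / 2) * Y\<^sup>2"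
          unfolding wY by (simp add: power_mult_distrib)
        show ?thesis
          unfolding f1_def ez ea l v K F w2 unfolding Complex_eq by (rule alg)
      qed
      also have "cmod \<dots> \<le> exp (- (a * y)) * (\<bar>b\<bar> * y) ^ 3 / (y * (exp y - 1)) + \<bar>b\<bar> * exp (- (a * y)) * 1"
      proof (rule norm_triangle_le, rule add_mono)
        have "cmod (exp (- w) - 1 + w - w\<^sup>2 / 2) \<le> cmod w ^ 3" by (rule exp_minus_taylor3) (simp add: w_def)
        also have "cmod w = \<bar>b\<bar> * y" using elim by (simp add: w_def norm_mult abs_mult)
        finally have "exp (- (a * y)) * cmod (exp (- w) - 1 + w - w\<^sup>2 / 2) / (y * (exp y - 1)) \<le> exp (- (a * y)) * (\<bar>b\<bar> * y) ^ 3 / (y * (exp y - 1))"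
          using e elim by (intro divide_right_mono mult_left_mono) auto
        moreover have "cmod (E * (exp (- w) - 1 + w - w\<^sup>2 / 2) / (Y * G)) = exp (- (a * y)) * cmod (exp (- w) - 1 + w - w\<^sup>2 / 2) / (y * (exp y - 1))"
          unfolding norm_divide norm_mult E_def Y_def G_def norm_of_real using e elim by simp
        ultimately show "cmod (E * (exp (- w) - 1 + w - w\<^sup>2 / 2) / (Y * G)) \<le> exp (- (a * y)) * (\<bar>b\<bar> * y) ^ 3 / (y * (exp y - 1))" by simp
        have "1 / Y - 1 / G = of_real (1 / y - 1 / (exp y - 1))" by (simp add: Y_def G_def)
        then have "cmod (1 / Y - 1 / G) = 1 / y - 1 / (exp y - 1)"
          using inverse_exp_gap(1)[OF elim] by (simp only: norm_of_real abs_of_nonneg)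
        then have "cmod (1 / Y - 1 / G) \<le> 1" using inverse_exp_gap(2)[OF elim] by simp
        then have "\<bar>b\<bar> * exp (- (a * y)) * cmod (1 / Y - 1 / G) \<le> \<bar>b\<bar> * exp (- (a * y)) * 1"
          by (intro mult_left_mono) auto
        then show "cmod (\<i> * of_real b * E * (1 / Y - 1 / G)) \<le> \<bar>b\<bar> * exp (- (a * y)) * 1"
          unfolding norm_mult E_def norm_of_real by simp
      qed
      also have "exp (- (a * y)) * (\<bar>b\<bar> * y) ^ 3 / (y * (exp y - 1)) \<le> exp (- (a * y)) * (\<bar>b\<bar> * y) ^ 3 / (y * y)"
        using e elim by (intro divide_left_mono mult_left_mono) auto
      also have "\<dots> = \<bar>b\<bar> ^ 3 * (y * exp (- (a * y)))" using elim by (simp add: power3_eq_cube)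
      finally show ?case by simp
    qed
  qed
  also have "\<dots> = \<bar>b\<bar> ^ 3 * (\<integral>y. y * exp (- (a * y)) \<partial>\<kappa>) + \<bar>b\<bar> * g a"
    unfolding g_def by (subst Bochner_Integration.integral_add) (auto intro!: integrable_mult_right integrable_first_moment integrable_exp a)
  also have "\<dots> \<le> \<bar>b\<bar> ^ 3 * (8 * g a / a) + \<bar>b\<bar> * g a"
    by (intro add_right_mono mult_left_mono kappa_first_moment a) auto
  finally show ?thesis unfolding eq .
qed

lemma Re_Psi_decay: "Re (\<Psi> (Complex a b)) = Re (\<Psi> (of_real a)) - decay a b" if a: "0 < a"
proof -
  let ?f = "\<lambda>z y. (exp (- (z * complex_of_real y)) - 1 - z * of_real (exp (- y) - 1)) / of_real (y * (exp y - 1))"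
  have i: "integrable \<kappa> (?f (Complex a b))" "integrable \<kappa> (?f (of_real a))"
    using integrable_Psi[of "Complex a b"] integrable_Psi[of "of_real a"] a by simp_all
  have "Re (\<Psi> (Complex a b)) - Re (\<Psi> (of_real a)) = Re (\<integral>y. ?f (Complex a b) y \<partial>\<kappa>) - Re (\<integral>y. ?f (of_real a) y \<partial>\<kappa>)"
    unfolding berg_urbanik_exponent_def by simp
  also have "\<dots> = (\<integral>y. Re (?f (Complex a b) y) - Re (?f (of_real a) y) \<partial>\<kappa>)"
    using i by (simp only: integral_Re integrable_Re Bochner_Integration.integral_diff)
  also have "\<dots> = (\<integral>y. - ((1 - cos (b * y)) * exp (- (a * y)) / (y * (exp y - 1))) \<partial>\<kappa>)"
  proof (rule Bochner_Integration.integral_cong[OF refl])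
    fix y
    have "Re (?f z y) = (exp (- (Re z * y)) * cos (Im z * y) - 1 - Re z * (exp (- y) - 1)) / (y * (exp y - 1))" for z
      by (simp only: Re_divide_of_real minus_complex.sel Re_exp Im_exp uminus_complex.sel times_complex.sel Re_complex_of_real Im_complex_of_real one_complex.sel mult_zero_right diff_0_right add_0_right cos_minus)
         simp
    from this[of "Complex a b"] this[of "of_real a"]
    show "Re (?f (Complex a b) y) - Re (?f (of_real a) y) = - ((1 - cos (b * y)) * exp (- (a * y)) / (y * (exp y - 1)))"
      by (simp only: complex.sel Re_complex_of_real Im_complex_of_real mult_zero_left cos_zero diff_divide_distrib[symmetric] minus_divide_left)
         (simp add: algebra_simps)
  qed
  also have "\<dots> = - decay a b" by (simp add: decay_def)
  finally show ?thesis by simp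
qed

end

section \<open>Fourier inversion\<close>

text \<open>
  For an integrable characteristic function the limit in Levy's inversion formula is an integral over the
  whole line, and its kernel is bounded by the length of the interval.
\<close>

lemma (in real_distribution) Levy_inversion_integrable:
  assumes int: "integrable lborel (char M)" and ab: "a \<le> b"
    and atoms: "measure M {a} = 0" "measure M {b} = 0"
  shows "complex_of_real (measure M {a<..b}) = 1 / (2 * pi) * (CLBINT t. (iexp (- (t * a)) - iexp (- (t * b))) / (\<i> * t) * char M t)"
    and "measure M {a<..b} \<le> (b - a) * (\<integral>t. cmod (char M t) \<partial>lborel)"
proof -
  let ?k = "\<lambda>t::real. (iexp (- (t * a)) - iexp (- (t * b))) / (\<i> * t)"
  have k_le: "cmod (?k t) \<le> b - a" if "t \<noteq> 0" for t
  proof -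
    have "cmod ((iexp (t * (- a)) - iexp (t * (- b))) / (\<i> * t)) \<le> (- a) - (- b)"
      by (rule Levy_Inversion_aux2) (use ab that in auto)
    then show ?thesis by simp
  qed
  have ne: "AE t in lborel. t \<noteq> (0::real)" by (rule AE_lborel_singleton)
  have kc_int: "complex_integrable lborel (\<lambda>t. ?k t * char M t)"
  proof (rule Bochner_Integration.integrable_bound)
    show "integrable lborel (\<lambda>t. (b - a) *\<^sub>R char M t)" using int by simp
    show "AE t in lborel. norm (?k t * char M t) \<le> norm ((b - a) *\<^sub>R char M t)"
      using ne
    proof eventually_elim
      case (elim t)
      have "cmod (?k t) * cmod (char M t) \<le> (b - a) * cmod (char M t)" by (rule mult_right_mono[OF k_le[OF elim]]) simp
      then show ?case unfolding norm_mult norm_scaleR using ab by simp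
    qed
  qed measurable
  have lim: "(\<lambda>T::nat. CLBINT t=-real T..real T. ?k t * char M t) \<longlonglongrightarrow> (CLBINT t. ?k t * char M t)"
  proof -
    have "(\<lambda>T::nat. CLBINT t. indicator {-real T<..<real T} t *\<^sub>R (?k t * char M t)) \<longlonglongrightarrow> (CLBINT t. ?k t * char M t)"
    proof (rule integral_dominated_convergence[where w="\<lambda>t. norm (?k t * char M t)"])
      show "AE t in lborel. (\<lambda>T. indicator {-real T<..<real T} t *\<^sub>R (?k t * char M t)) \<longlonglongrightarrow> ?k t * char M t"
      proof (rule always_eventually, rule allI, rule tendsto_eventually)
        fix t :: real
        obtain N :: nat where N: "\<bar>t\<bar> < real N" using reals_Archimedean2 by blast
        show "\<forall>\<^sub>F T in sequentially. indicator {-real T<..<real T} t *\<^sub>R (?k t * char M t) = ?k t * char M t"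
          using eventually_ge_at_top[of N]
        proof eventually_elim
          case (elim T)
          then have "real N \<le> real T" by simp
          then have "t \<in> {-real T<..<real T}" using N by auto
          then show ?case by simp
        qed
      qed
      show "AE t in lborel. norm (indicator {-real T<..<real T} t *\<^sub>R (?k t * char M t)) \<le> norm (?k t * char M t)" for T :: nat
        by (rule AE_I2) (simp add: indicator_def)
      show "integrable lborel (\<lambda>t. norm (?k t * char M t))" by (rule integrable_norm[OF kc_int])
      show "(\<lambda>t. ?k t * char M t) \<in> borel_measurable lborel" by measurable
      show "(\<lambda>t. indicator {-real T<..<real T} t *\<^sub>R (?k t * char M t)) \<in> borel_measurable lborel" for T :: nat by measurable
    qed
    moreover have "(CLBINT t=-real T..real T. f t) = (CLBINT t. indicator {-real T<..<real T} t *\<^sub>R f t)" for T :: nat and f :: "real \<Rightarrow> complex"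
      by (simp add: interval_lebesgue_integral_def set_lebesgue_integral_def)
    ultimately show ?thesis by (simp only:)
  qed
  have L: "(\<lambda>T::nat. 1 / (2 * pi) * (CLBINT t=-real T..real T. ?k t * char M t)) \<longlonglongrightarrow> 1 / (2 * pi) * (CLBINT t. ?k t * char M t)"
    by (intro tendsto_mult_left lim)
  show eq: "complex_of_real (measure M {a<..b}) = 1 / (2 * pi) * (CLBINT t. ?k t * char M t)"
    by (rule LIMSEQ_unique[OF Levy_Inversion[OF ab atoms, unfolded of_int_minus of_int_of_nat_eq] L])
  have "measure M {a<..b} = cmod (complex_of_real (measure M {a<..b}))" by simp
  also have "\<dots> = 1 / (2 * pi) * cmod (CLBINT t. ?k t * char M t)" unfolding eq by (simp add: norm_mult norm_divide)
  also have "\<dots> \<le> 1 * (b - a) * (\<integral>t. cmod (char M t) \<partial>lborel)"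
  proof -
    have "cmod (CLBINT t. ?k t * char M t) \<le> (\<integral>t. cmod (?k t * char M t) \<partial>lborel)" by (rule integral_norm_bound)
    also have "\<dots> \<le> (\<integral>t. (b - a) * cmod (char M t) \<partial>lborel)"
    proof (rule integral_mono_AE)
      show "AE t in lborel. cmod (?k t * char M t) \<le> (b - a) * cmod (char M t)"
        using ne by eventually_elim (unfold norm_mult, rule mult_right_mono[OF k_le], auto)
    qed (use kc_int int in auto)
    also have "\<dots> = (b - a) * (\<integral>t. cmod (char M t) \<partial>lborel)" by simp
    finally have "cmod (CLBINT t. ?k t * char M t) \<le> (b - a) * (\<integral>t. cmod (char M t) \<partial>lborel)" .
    moreover have "1 / (2 * pi) \<le> 1" using pi_gt3 by (simp add: field_simps)
    ultimately show ?thesis unfolding mult.assoc by (intro mult_mono) auto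
  qed
  finally show "measure M {a<..b} \<le> (b - a) * (\<integral>t. cmod (char M t) \<partial>lborel)" by simp
qed

lemma (in real_distribution) no_atoms_of_integrable_char:
  assumes int: "integrable lborel (char M)"
  shows "measure M {x} = 0"
proof (rule antisym)
  let ?C = "\<integral>t. cmod (char M t) \<partial>lborel"
  show "measure M {x} \<le> 0"
  proof (rule tendsto_lowerbound[where F="at_right (0::real)"])
    show "((\<lambda>e. 2 * e * ?C) \<longlongrightarrow> 0) (at_right 0)" by (auto intro!: tendsto_eq_intros)
    have "measure M {x} \<le> 2 * e * ?C" if e: "0 < e" for e
    proof -
      obtain a where a: "a \<in> {x - e<..<x}" "measure M {a} = 0"
        using open_minus_countable[OF countable_support, of "{x - e<..<x}"] e by auto
      obtain b where b: "b \<in> {x<..<x + e}" "measure M {b} = 0"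
        using open_minus_countable[OF countable_support, of "{x<..<x + e}"] e by auto
      have "measure M {x} \<le> measure M {a<..b}" using a b by (intro finite_measure_mono) auto
      also have "\<dots> \<le> (b - a) * ?C" using a b by (intro Levy_inversion_integrable(2)[OF int]) auto
      also have "\<dots> \<le> 2 * e * ?C" using a b by (intro mult_right_mono) auto
      finally show ?thesis .
    qed
    then show "\<forall>\<^sub>F e in at_right 0. measure M {x} \<le> 2 * e * ?C"
      using eventually_at_right_less by (rule eventually_mono[rotated])
  qed simp
qed simp

text \<open>
  Fourier inversion, in the form of a derivative of the distribution function: the inversion formula
  holds for all intervals as there are no atoms, and it is differentiated in the right end point.
\<close>

theorem (in real_distribution) cdf_has_derivative_of_integrable_char:
  assumes int: "integrable lborel (char M)"
  shows "(cdf M has_real_derivative Re (1 / (2 * pi) * (CLBINT t. iexp (- (t * x)) * char M t))) (at x)"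
proof -
  \<comment> \<open>any point to the left of x; the distribution function is written as its value there plus an increment\<close>
  define a where "a = x - 1"
  let ?k = "\<lambda>b (t::real). (iexp (- (t * a)) - iexp (- (t * b))) / (\<i> * t) * char M t"
  have ne: "AE t in lborel. t \<noteq> (0::real)" by (rule AE_lborel_singleton)
  have der: "((\<lambda>b. ?k b t) has_vector_derivative iexp (- (t * b)) * char M t) (at b)" if t: "t \<noteq> 0" for t b
  proof -
    have "((\<lambda>b. iexp (- (t * b))) has_vector_derivative (- (\<i> * t)) * iexp (- (t * b))) (at b)"
    proof -
      have "((\<lambda>b. - (t * b)) has_vector_derivative - t) (at b)"
        by (auto intro!: derivative_eq_intros simp flip: has_real_derivative_iff_has_vector_derivative)
      from vector_diff_chain_at[OF this has_vector_derivative_iexp]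
      show ?thesis by (simp add: comp_def scaleR_conv_of_real mult.assoc mult.left_commute)
    qed
    then have "((\<lambda>b. (iexp (- (t * a)) - iexp (- (t * b))) * (1 / (\<i> * t) * char M t)) has_vector_derivative (0 - (- (\<i> * t)) * iexp (- (t * b))) * (1 / (\<i> * t) * char M t)) (at b)"
      by (intro has_vector_derivative_mult_left has_vector_derivative_diff has_vector_derivative_const)
    moreover have "u * (1 / (\<i> * t) * c) = u / (\<i> * t) * c" for u c :: complex by simp
    moreover have "(0 - (- (\<i> * t)) * e) / (\<i> * t) * c = e * c" for e c :: complex using t by simp
    ultimately show ?thesis by (simp only:)
  qed
  have int_k: "complex_integrable lborel (?k b)" for b
  proof (rule Bochner_Integration.integrable_bound)
    show "integrable lborel (\<lambda>t. \<bar>b - a\<bar> *\<^sub>R char M t)" using int by simp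
    show "AE t in lborel. norm (?k b t) \<le> norm (\<bar>b - a\<bar> *\<^sub>R char M t)"
      using ne
    proof eventually_elim
      case (elim t)
      have "cmod ((iexp (t * (- a)) - iexp (t * (- b))) / (\<i> * t)) \<le> \<bar>b - a\<bar>"
      proof (cases "a \<le> b")
        case True
        then show ?thesis using Levy_Inversion_aux2[of "- b" "- a" t] elim by simp
      next
        case False
        then have "cmod ((iexp (t * (- b)) - iexp (t * (- a))) / (\<i> * t)) \<le> a - b" using Levy_Inversion_aux2[of "- a" "- b" t] elim by simp
        then show ?thesis using False by (simp add: norm_divide norm_minus_commute)
      qed
      then have "cmod ((iexp (- (t * a)) - iexp (- (t * b))) / (\<i> * t)) * cmod (char M t) \<le> \<bar>b - a\<bar> * cmod (char M t)"
        by (intro mult_right_mono) auto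
      then show ?case by (simp only: norm_mult norm_scaleR abs_abs real_norm_def)
    qed
  qed measurable
  have "((\<lambda>b. CLBINT t. ?k b t) has_vector_derivative (CLBINT t. iexp (- (t * x)) * char M t)) (at x)"
  proof (rule has_vector_derivative_lebesgue_integral(1)[where S=UNIV and h="\<lambda>t. cmod (char M t)"])
    show "AE t in lborel. \<forall>u\<in>UNIV. ((\<lambda>u. ?k u t) has_vector_derivative iexp (- (t * u)) * char M t) (at u) \<and> norm (iexp (- (t * u)) * char M t) \<le> cmod (char M t)"
      using ne
    proof eventually_elim
      case (elim t)
      show ?case using der[OF elim] by (auto simp: norm_mult)
    qed
    show "integrable lborel (\<lambda>t. cmod (char M t))" using int by (rule integrable_norm)
    show "complex_integrable lborel (?k b)" for b by (rule int_k)
    show "(\<lambda>t. iexp (- (t * x)) * char M t) \<in> borel_measurable lborel" by measurable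
  qed auto
  then have "((\<lambda>b. 1 / (2 * pi) * (CLBINT t. ?k b t)) has_vector_derivative 1 / (2 * pi) * (CLBINT t. iexp (- (t * x)) * char M t)) (at x)"
    by (rule has_vector_derivative_mult_right)
  then have "((\<lambda>b. Re (1 / (2 * pi) * (CLBINT t. ?k b t))) has_real_derivative Re (1 / (2 * pi) * (CLBINT t. iexp (- (t * x)) * char M t))) (at x)"
    unfolding has_real_derivative_iff_has_vector_derivative
    by (rule bounded_linear.has_vector_derivative[OF bounded_linear_Re])
  then have "((\<lambda>b. cdf M a + Re (1 / (2 * pi) * (CLBINT t. ?k b t))) has_real_derivative 0 + Re (1 / (2 * pi) * (CLBINT t. iexp (- (t * x)) * char M t))) (at x)"
    by (intro DERIV_add DERIV_const)
  moreover have "\<forall>\<^sub>F b in nhds x. cdf M a + Re (1 / (2 * pi) * (CLBINT t. ?k b t)) = cdf M b"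
  proof (rule eventually_mono[OF eventually_nhds_in_open[of "{a<..}" x]])
    fix b assume "b \<in> {a<..}"
    then have ab: "a < b" by simp
    have "Re (1 / (2 * pi) * (CLBINT t. ?k b t)) = Re (complex_of_real (measure M {a<..b}))"
      using ab by (subst Levy_inversion_integrable(1)[OF int]) (auto intro!: no_atoms_of_integrable_char int)
    then show "cdf M a + Re (1 / (2 * pi) * (CLBINT t. ?k b t)) = cdf M b"
      using cdf_diff_eq[OF ab] by simp
  qed (auto simp: a_def)
  ultimately show ?thesis
    by (subst DERIV_cong_ev[OF refl _ refl, symmetric]) auto
qed

text \<open>
  If the increments of \<open>T\<close> are those of \<open>H\<close> weighted by an increasing factor \<open>w\<close>, then \<open>T' = w H'\<close>. This
  undoes an exponential tilting at the level of distribution functions.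
\<close>

lemma has_real_derivative_of_weighted_increments:
  fixes T H w :: "real \<Rightarrow> real"
  assumes T: "(T has_real_derivative D) (at x)" and S: "open S" "x \<in> S"
    and w: "isCont w x" "\<And>u. u \<in> S \<Longrightarrow> 0 < w u"
    and inc: "\<And>u v. u \<in> S \<Longrightarrow> v \<in> S \<Longrightarrow> u < v \<Longrightarrow> w u * (H v - H u) \<le> T v - T u \<and> T v - T u \<le> w v * (H v - H u)"
  shows "(H has_real_derivative D / w x) (at x)"
  unfolding has_field_derivative_iff
proof (rule tendsto_sandwich)
  let ?q = "\<lambda>u. (T u - T x) / (u - x)"
  let ?l = "\<lambda>u. min (?q u / w x) (?q u / w u)" and ?m = "\<lambda>u. max (?q u / w x) (?q u / w u)"
  have q: "(?q \<longlongrightarrow> D) (at x)" using T by (simp add: has_field_derivative_iff)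
  have wl: "(w \<longlongrightarrow> w x) (at x)" using w(1) by (simp add: isCont_def)
  have wx: "w x \<noteq> 0" using w(2)[OF S(2)] by simp
  have 1: "((\<lambda>u. ?q u / w x) \<longlongrightarrow> D / w x) (at x)" by (intro tendsto_intros q wx)
  have 2: "((\<lambda>u. ?q u / w u) \<longlongrightarrow> D / w x) (at x)" by (intro tendsto_intros q wl wx)
  show "(?l \<longlongrightarrow> D / w x) (at x)" using tendsto_min[OF 1 2] by simp
  show "(?m \<longlongrightarrow> D / w x) (at x)" using tendsto_max[OF 1 2] by simp
  have ev: "\<forall>\<^sub>F u in at x. u \<in> S \<and> u \<noteq> x"
    using eventually_at_in_open'[OF S] eventually_neq_at_within[of x x UNIV] by eventually_elim simp
  have key: "?l u \<le> (H u - H x) / (u - x) \<and> (H u - H x) / (u - x) \<le> ?m u" if u: "u \<in> S" "u \<noteq> x" for u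
  proof -
    have pos: "0 < w u" "0 < w x" using w(2) u S by auto
    show ?thesis
    proof (cases "x < u")
      case True
      then have "w x * (H u - H x) \<le> T u - T x" "T u - T x \<le> w u * (H u - H x)" using inc[OF S(2) u(1)] by auto
      then have "w x * (H u - H x) / (u - x) \<le> ?q u" "?q u \<le> w u * (H u - H x) / (u - x)"
        using True by (auto intro!: divide_right_mono)
      then have "(H u - H x) / (u - x) \<le> ?q u / w x" "?q u / w u \<le> (H u - H x) / (u - x)"
        using pos True by (simp_all add: pos_le_divide_eq pos_divide_le_eq mult.commute)
      then show ?thesis by (simp add: min.coboundedI2 max.coboundedI1)
    next
      case False
      then have ux: "u < x" using u by simp
      then have "w u * (H x - H u) \<le> T x - T u" "T x - T u \<le> w x * (H x - H u)" using inc[OF u(1) S(2)] by auto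
      then have "w u * (H x - H u) / (x - u) \<le> (T x - T u) / (x - u)" "(T x - T u) / (x - u) \<le> w x * (H x - H u) / (x - u)"
        using ux by (auto intro!: divide_right_mono)
      moreover have "(T x - T u) / (x - u) = ?q u" "(H x - H u) / (x - u) = (H u - H x) / (u - x)"
        by (metis minus_diff_eq minus_divide_divide)+
      ultimately have "w u * ((H u - H x) / (u - x)) \<le> ?q u" "?q u \<le> w x * ((H u - H x) / (u - x))"
        by (metis times_divide_eq_right)+
      moreover have "p \<le> r / c" if "c * p \<le> r" "0 < c" for p r c :: real using that by (simp add: pos_le_divide_eq mult.commute)
      moreover have "r / c \<le> p" if "r \<le> c * p" "0 < c" for p r c :: real using that by (simp add: pos_divide_le_eq mult.commute)
      ultimately have "(H u - H x) / (u - x) \<le> ?q u / w u" "?q u / w x \<le> (H u - H x) / (u - x)"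
        using pos by blast+
      then show ?thesis by (simp add: min.coboundedI1 max.coboundedI2)
    qed
  qed
  show "\<forall>\<^sub>F u in at x. ?l u \<le> (H u - H x) / (u - x)" using ev by eventually_elim (use key in blast)
  show "\<forall>\<^sub>F u in at x. (H u - H x) / (u - x) \<le> ?m u" using ev by eventually_elim (use key in blast)
qed


section \<open>Densities as inverse Mellin transforms\<close>

lemma integrable_inverse_quadratic: "integrable lborel (\<lambda>x. 1 / (1 + (x / c)\<^sup>2))" if "c \<noteq> 0" for c :: real
proof -
  have "integrable lborel (\<lambda>x::real. 1 / (1 + x\<^sup>2))"
    using integrable_inverse_1_plus_square by (simp add: set_integrable_def inverse_eq_divide)
  from lborel_integrable_real_affine[OF this, of "1 / c" 0] that show ?thesis by simp
qed

text \<open>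
  On the negative half-line the principal branch of the logarithm is \<open>ln \<bar>x\<bar> + \<i> \<pi>\<close>, so the complex power is
  a measurable function of the real variable although it is discontinuous.
\<close>

lemma of_real_powr_measurable [measurable]: "(\<lambda>x. complex_of_real x powr z) \<in> borel_measurable borel"
proof -
  have "(\<lambda>x. complex_of_real x powr z) =
    (\<lambda>x. if x = 0 then 0 else exp (z * (of_real (ln \<bar>x\<bar>) + complex_of_real (if x < 0 then pi else 0) * \<i>)))"
    by (rule ext) (simp add: powr_def Ln_of_real')
  then show ?thesis by simp
qed

text \<open>
  One member \<open>M\<close> of the semigroup, at time \<open>t\<close>, given through its Mellin transform.
\<close>

locale berg_urbanik = jurek +
  fixes M :: "real measure" and t :: real
  assumes t_pos: "0 < t" and prob: "prob_space M" and pos_M: "pos_measure M"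
    and mellin: "\<And>z. 0 < Re z \<Longrightarrow> (\<integral>x. of_real x powr z \<partial>M) = exp (of_real t * \<Psi> z)"
begin

sublocale prob_space M by (rule prob)

lemma sets_M [measurable_cong]: "sets M = sets borel"
  using pos_M by (simp add: pos_measure_def)

lemma space_M: "space M = UNIV"
  using sets_eq_imp_space_eq[OF sets_M] by simp

lemmas AE_M = pos_measure_AE[OF pos_M]

sublocale real_distribution M
  by unfold_locales (simp_all add: sets_M space_M)

definition mass :: "real \<Rightarrow> real" where "mass a = exp (t * Re (\<Psi> (of_real a)))"

lemma Psi_real: "0 < a \<Longrightarrow> \<Psi> (of_real a) = of_real (Re (\<Psi> (of_real a)))"
  using Re_Psi_real(1)[of a] by simp

text \<open>
  The Mellin integral is an exponential and therefore not \<open>0\<close>, which is the value of the integral of a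
  function that is not integrable.
\<close>

lemma powr_moment:
  assumes a: "0 < a"
  shows "has_bochner_integral M (\<lambda>x. x powr a) (mass a)"
proof -
  have eq: "(\<integral>x. of_real x powr of_real a \<partial>M) = (\<integral>x. complex_of_real (x powr a) \<partial>M)"
  proof (rule integral_cong_AE)
    show "AE x in M. complex_of_real x powr of_real a = complex_of_real (x powr a)"
      using AE_M by eventually_elim (simp add: powr_of_real)
    show "(\<lambda>x. complex_of_real x powr of_real a) \<in> borel_measurable M" by measurable
  qed measurable
  have "exp (of_real t * \<Psi> (of_real a)) = complex_of_real (mass a)"
    by (subst Psi_real[OF a]) (simp add: mass_def exp_of_real[symmetric])
  then have e: "complex_of_real (\<integral>x. x powr a \<partial>M) = complex_of_real (mass a)"
    using mellin[of "of_real a"] a eq by simp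
  then have e': "(\<integral>x. x powr a \<partial>M) = mass a" by (simp only: of_real_eq_iff)
  have "integrable M (\<lambda>x. x powr a)"
  proof (rule ccontr)
    assume "\<not> integrable M (\<lambda>x. x powr a)"
    then have "(\<integral>x. x powr a \<partial>M) = 0" by (rule not_integrable_integral_eq)
    then show False using e' by (simp add: mass_def)
  qed
  then show ?thesis using e' by (simp add: has_bochner_integral_iff)
qed

lemma mass_pos: "0 < mass a"
  by (simp add: mass_def)

text \<open>
  The law of \<open>ln X\<close> for \<open>X\<close> distributed as \<open>M\<close>, tilted by \<open>exp (a ln X)\<close> and normalised.
\<close>

definition tilted :: "real \<Rightarrow> real measure" where
  "tilted a = distr (density M (\<lambda>x. ennreal (x powr a / mass a))) borel ln"

lemma real_distribution_tilted:
  assumes a: "0 < a"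
  shows "real_distribution (tilted a)"
proof -
  have i: "integrable M (\<lambda>x. x powr a / mass a)" "(\<integral>x. x powr a / mass a \<partial>M) = 1"
    using powr_moment[OF a] mass_pos[of a] by (auto simp: has_bochner_integral_iff)
  have "emeasure (density M (\<lambda>x. ennreal (x powr a / mass a))) (space M) = (\<integral>\<^sup>+x. ennreal (x powr a / mass a) \<partial>M)"
    by (subst emeasure_density) (auto intro!: nn_integral_cong simp: space_M)
  also have "\<dots> = ennreal 1"
    using i mass_pos[of a] by (subst nn_integral_eq_integral) auto
  finally have "prob_space (density M (\<lambda>x. ennreal (x powr a / mass a)))"
    by (intro prob_spaceI) simp
  then have "prob_space (tilted a)"
    unfolding tilted_def by (rule prob_space.prob_space_distr) simp
  then show ?thesis
    unfolding real_distribution_def real_distribution_axioms_def by (simp add: tilted_def)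
qed

lemma integral_tilted:
  fixes f :: "real \<Rightarrow> 'b :: {banach, second_countable_topology}"
  assumes "f \<in> borel_measurable borel"
  shows "(\<integral>y. f y \<partial>tilted a) = (\<integral>x. (x powr a / mass a) *\<^sub>R f (ln x) \<partial>M)"
proof -
  have "(\<integral>y. f y \<partial>tilted a) = (\<integral>x. f (ln x) \<partial>density M (\<lambda>x. ennreal (x powr a / mass a)))"
    unfolding tilted_def using assms by (subst integral_distr) auto
  also have "\<dots> = (\<integral>x. (x powr a / mass a) *\<^sub>R f (ln x) \<partial>M)"
    using assms mass_pos[of a] by (subst integral_density) auto
  finally show ?thesis .
qed

lemma char_tilted:
  assumes a: "0 < a"
  shows "char (tilted a) b = exp (of_real t * \<Psi> (Complex a b)) / of_real (mass a)"
proof -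
  have "char (tilted a) b = (\<integral>x. (x powr a / mass a) *\<^sub>R iexp (b * ln x) \<partial>M)"
    unfolding char_def by (subst integral_tilted) auto
  also have "\<dots> = (\<integral>x. of_real x powr (Complex a b) / of_real (mass a) \<partial>M)"
  proof (rule integral_cong_AE)
    show "AE x in M. (x powr a / mass a) *\<^sub>R iexp (b * ln x) = of_real x powr (Complex a b) / of_real (mass a)"
      using AE_M
    proof eventually_elim
      case (elim x)
      have "of_real x powr (Complex a b) = exp (Complex a b * of_real (ln x))"
        using elim by (simp add: powr_def Ln_of_real mult.commute)
      also have "\<dots> = exp (of_real (a * ln x)) * iexp (b * ln x)"
        by (simp add: Complex_eq exp_add[symmetric] algebra_simps)
      also have "exp (complex_of_real (a * ln x)) = of_real (x powr a)"
        using elim by (simp only: exp_of_real powr_def) simp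
      finally show ?case by (simp add: scaleR_conv_of_real)
    qed
    show "(\<lambda>x. complex_of_real x powr (Complex a b) / of_real (mass a)) \<in> borel_measurable M" by measurable
  qed measurable
  also have "\<dots> = exp (of_real t * \<Psi> (Complex a b)) / of_real (mass a)"
    using mellin[of "Complex a b"] a by simp
  finally show ?thesis .
qed

lemma cmod_exp_Psi: "0 < a \<Longrightarrow> cmod (exp (of_real t * \<Psi> (Complex a b))) = mass a * exp (- (t * decay a b))"
  by (simp add: Re_Psi_decay mass_def algebra_simps flip: exp_add)

text \<open>
  On a fixed vertical line \<open>A\<close>, and with it \<open>N\<close>, can be chosen as large as desired.
\<close>

lemma exp_decay_le:
  assumes a: "0 < a" and A: "a + 1 \<le> A" and N: "2 * real N \<le> t * (A\<^sup>2 * g A)"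
  shows "exp (- (t * decay a b)) \<le> (1 / (1 + (b / A)\<^sup>2)) ^ N"
proof -
  have l: "0 \<le> ln (1 + (b / A)\<^sup>2)" by simp
  have "real N * ln (1 + (b / A)\<^sup>2) \<le> t * (A\<^sup>2 * g A) / 2 * ln (1 + (b / A)\<^sup>2)"
    using N l by (intro mult_right_mono) auto
  also have "\<dots> = t * (A\<^sup>2 / 2 * ln (1 + (b / A)\<^sup>2) * g A)" by simp
  also have "\<dots> \<le> t * decay a b" using t_pos by (intro mult_left_mono decay_lower a A) auto
  finally have "exp (- (t * decay a b)) \<le> exp (- (real N * ln (1 + (b / A)\<^sup>2)))" by simp
  also have "\<dots> = (1 / (1 + (b / A)\<^sup>2)) ^ N"
  proof -
    have "exp (ln (1 + (b / A)\<^sup>2)) = 1 + (b / A)\<^sup>2" by (intro exp_ln) (simp add: add_pos_nonneg)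
    then show ?thesis by (simp add: exp_minus exp_of_nat_mult power_divide inverse_eq_divide)
  qed
  finally show ?thesis .
qed

text \<open>
  The factor that \<open>n\<close> differentiations of \<open>x powr (- z - 1)\<close> produce.
\<close>

definition coef :: "nat \<Rightarrow> complex \<Rightarrow> complex" where
  "coef n z = (\<Prod>j<n. - (z + 1 + of_nat j))"

lemma cmod_coef_le: "0 \<le> a \<Longrightarrow> cmod (coef n (Complex a b)) \<le> (a + real n + \<bar>b\<bar>) ^ n"
proof -
  assume a: "0 \<le> a"
  have "cmod (coef n (Complex a b)) = (\<Prod>j<n. cmod (- (Complex a b + 1 + of_nat j)))"
    unfolding coef_def by (rule prod_norm[symmetric])
  also have "\<dots> \<le> (\<Prod>j<n. a + real n + \<bar>b\<bar>)"
  proof (rule prod_mono, intro conjI)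
    fix j assume j: "j \<in> {..<n}"
    have "cmod (- (Complex a b + 1 + of_nat j)) = cmod (Complex (a + 1 + real j) b)"
      unfolding norm_minus_cancel by (rule arg_cong[where f=cmod]) (simp add: complex_eq_iff)
    also have "\<dots> \<le> \<bar>a + 1 + real j\<bar> + \<bar>b\<bar>" using cmod_le[of "Complex (a + 1 + real j) b"] by simp
    also have "\<dots> \<le> a + real n + \<bar>b\<bar>" using j a by simp
    finally show "cmod (- (Complex a b + 1 + of_nat j)) \<le> a + real n + \<bar>b\<bar>" .
  qed simp
  finally show ?thesis by simp
qed

lemma coef_measurable [measurable]: "(\<lambda>b. coef n (Complex a b)) \<in> borel_measurable borel"
  unfolding coef_def Complex_eq by measurable

lemma exp_Psi_measurable [measurable]:
  assumes a: "0 < a"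
  shows "(\<lambda>b. exp (of_real t * \<Psi> (Complex a b))) \<in> borel_measurable borel"
proof -
  interpret T: real_distribution "tilted a" by (rule real_distribution_tilted[OF a])
  have "(\<lambda>b. char (tilted a) b * of_real (mass a)) \<in> borel_measurable borel" by measurable
  moreover have "(\<lambda>b. char (tilted a) b * of_real (mass a)) = (\<lambda>b. exp (of_real t * \<Psi> (Complex a b)))"
    using mass_pos[of a] by (simp add: char_tilted[OF a])
  ultimately show ?thesis by simp
qed

lemma eventually_scaled_g_ge: "\<forall>\<^sub>F A in at_top. Z \<le> t * (A\<^sup>2 * g A)"
proof -
  have "filterlim (\<lambda>A. t * (A\<^sup>2 * g A)) at_top at_top"
    by (rule filterlim_tendsto_pos_mult_at_top[OF tendsto_const t_pos g_scaled_at_top])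
  then show ?thesis by (simp add: filterlim_at_top)
qed

lemma integrable_coef_exp_Psi:
  assumes a: "0 < a"
  shows "complex_integrable lborel (\<lambda>b. coef n (Complex a b) * exp (of_real t * \<Psi> (Complex a b)))"
proof -
  obtain A where A: "a + 1 \<le> A" "2 * real (n + 1) \<le> t * (A\<^sup>2 * g A)"
    using eventually_conj[OF eventually_ge_at_top[of "a + 1"] eventually_scaled_g_ge[of "2 * real (n + 1)"]]
    unfolding eventually_at_top_linorder by blast
  have A0: "0 < A" using A a by simp
  \<comment> \<open>chosen so that \<open>a + n + \<bar>b\<bar> \<le> K (1 + (b/A)\<^sup>2)\<close>; each factor of \<open>coef\<close> then costs one power of
    \<open>1 + (b/A)\<^sup>2\<close>, and one more power is left for integrability\<close>
  define K where "K = a + real n + A"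
  show ?thesis
  proof (rule Bochner_Integration.integrable_bound)
    show "integrable lborel (\<lambda>b. K ^ n * mass a * (1 / (1 + (b / A)\<^sup>2)))"
      by (intro integrable_mult_right integrable_inverse_quadratic) (use A0 in simp)
    show "(\<lambda>b. coef n (Complex a b) * exp (of_real t * \<Psi> (Complex a b))) \<in> borel_measurable lborel"
      using a by measurable
    show "AE b in lborel. norm (coef n (Complex a b) * exp (of_real t * \<Psi> (Complex a b))) \<le> norm (K ^ n * mass a * (1 / (1 + (b / A)\<^sup>2)))"
    proof (rule always_eventually, rule allI)
      fix b :: real
      define q where "q = 1 + (b / A)\<^sup>2"
      have q: "1 \<le> q" by (simp add: q_def)
      have "\<bar>b\<bar> / A \<le> q"
      proof -
        have "2 * (\<bar>b\<bar> / A) \<le> 1 + (\<bar>b\<bar> / A)\<^sup>2" using sum_squares_bound[of "\<bar>b\<bar> / A" 1] by simp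
        moreover have "0 \<le> \<bar>b\<bar> / A" using A0 by simp
        ultimately show ?thesis by (simp add: q_def power_divide)
      qed
      then have "\<bar>b\<bar> \<le> A * q" using A0 by (simp add: field_simps)
      moreover have "a + real n \<le> (a + real n) * q" using q a mult_left_mono[of 1 q "a + real n"] by simp
      ultimately have "a + real n + \<bar>b\<bar> \<le> K * q" by (simp add: K_def distrib_right)
      then have "(a + real n + \<bar>b\<bar>) ^ n \<le> (K * q) ^ n" using a by (intro power_mono) auto
      then have c: "cmod (coef n (Complex a b)) \<le> (K * q) ^ n" using cmod_coef_le[of a n b] a by linarith
      have e: "cmod (exp (of_real t * \<Psi> (Complex a b))) \<le> mass a * (1 / q) ^ (n + 1)"
        unfolding cmod_exp_Psi[OF a] q_def using mass_pos[of a] by (intro mult_left_mono exp_decay_le[OF a A]) auto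
      have "norm (coef n (Complex a b) * exp (of_real t * \<Psi> (Complex a b))) \<le> (K * q) ^ n * (mass a * (1 / q) ^ (n + 1))"
        unfolding norm_mult by (rule mult_mono[OF c e]) (use q a A0 in \<open>auto simp: K_def\<close>)
      also have "\<dots> = K ^ n * mass a * (1 / q)" using q by (simp add: power_mult_distrib power_divide)
      finally show "norm (coef n (Complex a b) * exp (of_real t * \<Psi> (Complex a b))) \<le> norm (K ^ n * mass a * (1 / (1 + (b / A)\<^sup>2)))"
        unfolding q_def by (simp only: real_norm_def)
    qed
  qed
qed

text \<open>
  The inverse Mellin transform along the line through \<open>a\<close>, differentiated \<open>n\<close> times in \<open>x\<close>. A different
  line may be used for every \<open>x\<close>.
\<close>

definition mellin_inverse :: "nat \<Rightarrow> real \<Rightarrow> real \<Rightarrow> complex" where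
  "mellin_inverse n a x = 1 / (2 * pi) * (CLBINT b. exp (- ((Complex a b + 1 + of_nat n) * of_real (ln x))) * (coef n (Complex a b) * exp (of_real t * \<Psi> (Complex a b))))"

text \<open>
  Fourier inversion for the tilted law, with the tilting undone. As a derivative is unique, the
  right-hand side does not depend on \<open>a\<close>; this replaces shifting the line of integration.
\<close>

lemma cdf_deriv_mellin:
  assumes a: "0 < a" and x: "0 < x"
  shows "(cdf M has_real_derivative Re (mellin_inverse 0 a x)) (at x)"
proof -
  interpret T: real_distribution "tilted a" by (rule real_distribution_tilted[OF a])
  have char: "char (tilted a) = (\<lambda>b. exp (of_real t * \<Psi> (Complex a b)) / of_real (mass a))"
    by (rule ext) (rule char_tilted[OF a])
  have "complex_integrable lborel (\<lambda>b. exp (of_real t * \<Psi> (Complex a b)))"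
    using integrable_coef_exp_Psi[OF a, of 0] by (simp add: coef_def)
  then have cint: "integrable lborel (char (tilted a))"
    unfolding char by (intro integrable_divide)
  define D where "D = Re (1 / (2 * pi) * (CLBINT b. iexp (- (b * ln x)) * char (tilted a) b))"
  have "((\<lambda>x. mass a * cdf (tilted a) (ln x)) has_real_derivative mass a * (D * (1 / x))) (at x)"
    unfolding D_def using x
    by (intro DERIV_cmult DERIV_chain2[OF T.cdf_has_derivative_of_integrable_char[OF cint]] DERIV_ln_divide)
  then have "(cdf M has_real_derivative (mass a * (D * (1 / x))) / x powr a) (at x)"
  proof (rule has_real_derivative_of_weighted_increments[where S="{0<..}" and w="\<lambda>x. x powr a"])
    show "isCont (\<lambda>x. x powr a) x" using x by (intro continuous_intros) auto
    fix u v :: real assume uv: "u \<in> {0<..}" "v \<in> {0<..}" "u < v"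
    let ?I = "{u<..v}"
    have i0: "integrable M (\<lambda>x. x powr a)" using powr_moment[OF a] by (simp add: has_bochner_integral_iff)
    have i1: "integrable M (\<lambda>x. indicator ?I x * x powr a)"
      using integrable_real_mult_indicator[OF _ i0, of ?I] by (simp add: sets_M mult.commute)
    have i2: "integrable M (\<lambda>x. indicator ?I x * c)" for c :: real
      by (intro integrable_mult_left integrable_real_indicator) (auto simp: sets_M emeasure_finite less_top[symmetric])
    have m: "(\<integral>x. indicator ?I x * c \<partial>M) = c * (cdf M v - cdf M u)" for c :: real
      using cdf_diff_eq[OF uv(3)] by (simp add: sets_M)
    have "mass a * cdf (tilted a) (ln v) - mass a * cdf (tilted a) (ln u) = mass a * measure (tilted a) {ln u<..ln v}"
      using T.cdf_diff_eq[of "ln u" "ln v"] uv by (simp add: algebra_simps)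
    also have "measure (tilted a) {ln u<..ln v} = (\<integral>y. indicator {ln u<..ln v} y \<partial>tilted a)" by (simp add: T.events_eq_borel)
    also have "\<dots> = (\<integral>x. (x powr a / mass a) *\<^sub>R indicator {ln u<..ln v} (ln x) \<partial>M)"
      by (rule integral_tilted) simp
    also have "\<dots> = (\<integral>x. (indicator ?I x * x powr a) / mass a \<partial>M)"
    proof (rule integral_cong_AE)
      show "AE x in M. (x powr a / mass a) *\<^sub>R indicator {ln u<..ln v} (ln x) = (indicator ?I x * x powr a) / mass a"
        using AE_M by eventually_elim (use uv in \<open>auto simp: indicator_def\<close>)
    qed measurable
    finally have T: "mass a * cdf (tilted a) (ln v) - mass a * cdf (tilted a) (ln u) = (\<integral>x. indicator ?I x * x powr a \<partial>M)"
      using mass_pos[of a] by simp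
    have "(\<integral>x. indicator ?I x * u powr a \<partial>M) \<le> (\<integral>x. indicator ?I x * x powr a \<partial>M)"
      by (rule integral_mono[OF i2 i1]) (use uv a in \<open>auto simp: indicator_def intro!: powr_mono2\<close>)
    moreover have "(\<integral>x. indicator ?I x * x powr a \<partial>M) \<le> (\<integral>x. indicator ?I x * v powr a \<partial>M)"
      by (rule integral_mono[OF i1 i2]) (use uv a in \<open>auto simp: indicator_def intro!: powr_mono2\<close>)
    ultimately show "u powr a * (cdf M v - cdf M u) \<le> mass a * cdf (tilted a) (ln v) - mass a * cdf (tilted a) (ln u) \<and>
        mass a * cdf (tilted a) (ln v) - mass a * cdf (tilted a) (ln u) \<le> v powr a * (cdf M v - cdf M u)"
      unfolding T m by simp
  qed (use x in auto)
  moreover have "(mass a * (D * (1 / x))) / x powr a = Re (mellin_inverse 0 a x)"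
  proof -
    have "mellin_inverse 0 a x = 1 / (2 * pi) * (CLBINT b. of_real (mass a / x / x powr a) * (iexp (- (b * ln x)) * char (tilted a) b))"
    proof -
      have "exp (- ((Complex a b + 1 + of_nat 0) * of_real (ln x))) * (coef 0 (Complex a b) * exp (of_real t * \<Psi> (Complex a b))) =
         of_real (mass a / x / x powr a) * (iexp (- (b * ln x)) * char (tilted a) b)" for b
      proof -
      have "exp (- ((Complex a b + 1 + of_nat 0) * of_real (ln x))) = exp (of_real (- ((a + 1) * ln x))) * iexp (- (b * ln x))"
        by (simp add: Complex_eq exp_add[symmetric] algebra_simps)
      also have "exp (complex_of_real (- ((a + 1) * ln x))) = of_real (1 / x / x powr a)"
      proof -
        have "exp (- ((a + 1) * ln x)) = x powr (- a - 1)" using x by (simp add: powr_def algebra_simps)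
        also have "\<dots> = 1 / x / x powr a" using x by (simp add: powr_diff powr_minus field_simps)
        finally show ?thesis by (simp only: exp_of_real)
      qed
      finally show ?thesis
        using mass_pos[of a] by (simp add: coef_def char)
      qed
      then show ?thesis by (simp only: mellin_inverse_def)
    qed
    also have "\<dots> = of_real (mass a / x / x powr a) * (1 / (2 * pi) * (CLBINT b. iexp (- (b * ln x)) * char (tilted a) b))"
      by (simp only: integral_mult_right_zero) (simp only: mult.left_commute)
    finally have "Re (mellin_inverse 0 a x) = mass a / x / x powr a * D"
      unfolding D_def by (simp only: Re_complex_of_real Im_complex_of_real times_complex.sel mult_zero_left diff_0_right) 
    then show ?thesis by simp
  qed
  ultimately show ?thesis by simp
qed


lemma coef_Suc: "coef (Suc n) z = coef n z * - (z + 1 + of_nat n)"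
  by (simp add: coef_def)

lemma cmod_exp_ln: "cmod (exp (- ((Complex a b + 1 + of_nat n) * of_real (ln x)))) = x powr (- (a + 1 + real n))" if "0 < x"
proof -
  have "cmod (exp (- ((Complex a b + 1 + of_nat n) * of_real (ln x)))) = exp (- ((a + 1 + real n) * ln x))"
    by simp
  also have "\<dots> = x powr (- (a + 1 + real n))" unfolding powr_def using that by (simp add: algebra_simps)
  finally show ?thesis .
qed

lemma integrable_mellin_inverse:
  assumes a: "0 < a" and x: "0 < x"
  shows "complex_integrable lborel (\<lambda>b. exp (- ((Complex a b + 1 + of_nat n) * of_real (ln x))) * (coef n (Complex a b) * exp (of_real t * \<Psi> (Complex a b))))"
proof (rule Bochner_Integration.integrable_bound)
  show "integrable lborel (\<lambda>b. x powr (- (a + 1 + real n)) * norm (coef n (Complex a b) * exp (of_real t * \<Psi> (Complex a b))))"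
    by (intro integrable_mult_right integrable_norm integrable_coef_exp_Psi a)
  have m1: "(\<lambda>b. exp (- ((Complex a b + 1 + of_nat n) * of_real (ln x)))) \<in> borel_measurable lborel"
    unfolding Complex_eq by measurable
  show "(\<lambda>b. exp (- ((Complex a b + 1 + of_nat n) * of_real (ln x))) * (coef n (Complex a b) * exp (of_real t * \<Psi> (Complex a b)))) \<in> borel_measurable lborel"
    by (intro borel_measurable_times m1 borel_measurable_integrable[OF integrable_coef_exp_Psi[OF a]])
  show "AE b in lborel. norm (exp (- ((Complex a b + 1 + of_nat n) * of_real (ln x))) * (coef n (Complex a b) * exp (of_real t * \<Psi> (Complex a b))))
     \<le> norm (x powr (- (a + 1 + real n)) * norm (coef n (Complex a b) * exp (of_real t * \<Psi> (Complex a b))))"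
    by (rule AE_I2) (simp only: norm_mult cmod_exp_ln[OF x] real_norm_def abs_mult abs_norm_cancel powr_ge_zero abs_of_nonneg)
qed

lemma mellin_inverse_deriv:
  assumes a: "0 < a" and x: "0 < x"
  shows "((\<lambda>x. Re (mellin_inverse n a x)) has_real_derivative Re (mellin_inverse (Suc n) a x)) (at x)"
proof -
  define W where "W = (\<lambda>n b. coef n (Complex a b) * exp (of_real t * \<Psi> (Complex a b)))"
  have W_int: "complex_integrable lborel (W n)" for n unfolding W_def by (rule integrable_coef_exp_Psi[OF a])
  have "((\<lambda>x. CLBINT b. exp (- ((Complex a b + 1 + of_nat n) * of_real (ln x))) * W n b) has_vector_derivative
      (CLBINT b. exp (- ((Complex a b + 1 + of_nat (Suc n)) * of_real (ln x))) * W (Suc n) b)) (at x)"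
  proof (rule has_vector_derivative_lebesgue_integral(1)[where S="{x / 2<..<2 * x}" and h="\<lambda>b. (x / 2) powr (- (a + 1 + real (Suc n))) * norm (W (Suc n) b)"])
    show "integrable lborel (\<lambda>b. (x / 2) powr (- (a + 1 + real (Suc n))) * norm (W (Suc n) b))"
      by (intro integrable_mult_right integrable_norm W_int)
    show "complex_integrable lborel (\<lambda>b. exp (- ((Complex a b + 1 + of_nat n) * of_real (ln u))) * W n b)" if "u \<in> {x / 2<..<2 * x}" for u
      unfolding W_def by (rule integrable_mellin_inverse[OF a]) (use that x in simp)
    show "(\<lambda>b. exp (- ((Complex a b + 1 + of_nat (Suc n)) * of_real (ln x))) * W (Suc n) b) \<in> borel_measurable lborel"
      unfolding W_def by (rule borel_measurable_integrable[OF integrable_mellin_inverse[OF a x]])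
    show "AE b in lborel. \<forall>u\<in>{x / 2<..<2 * x}.
       ((\<lambda>u. exp (- ((Complex a b + 1 + of_nat n) * of_real (ln u))) * W n b) has_vector_derivative
          exp (- ((Complex a b + 1 + of_nat (Suc n)) * of_real (ln u))) * W (Suc n) b) (at u) \<and>
       norm (exp (- ((Complex a b + 1 + of_nat (Suc n)) * of_real (ln u))) * W (Suc n) b) \<le> (x / 2) powr (- (a + 1 + real (Suc n))) * norm (W (Suc n) b)"
    proof (rule AE_I2, intro ballI conjI)
      fix b u assume u: "u \<in> {x / 2<..<2 * x}"
      then have u0: "0 < u" using x by simp
      define c where "c = Complex a b + 1 + of_nat n"
      have "((\<lambda>u. - (c * of_real (ln u))) has_vector_derivative - (c * of_real (1 / u))) (at u)"
      proof -
        have "((\<lambda>u. complex_of_real (ln u)) has_vector_derivative of_real (1 / u)) (at u)"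
          by (rule has_vector_derivative_of_real) (use u0 in \<open>auto intro!: derivative_eq_intros\<close>)
        then show ?thesis by (intro has_vector_derivative_minus has_vector_derivative_mult_right)
      qed
      from field_vector_diff_chain_at[OF this DERIV_exp]
      have "((\<lambda>u. exp (- (c * of_real (ln u))) * W n b) has_vector_derivative (- (c * of_real (1 / u)) * exp (- (c * of_real (ln u)))) * W n b) (at u)"
        unfolding comp_def by (rule has_vector_derivative_mult_left)
      moreover have "(- (c * of_real (1 / u)) * exp (- (c * of_real (ln u)))) * W n b = exp (- ((Complex a b + 1 + of_nat (Suc n)) * of_real (ln u))) * W (Suc n) b"
      proof -
        have "exp (- ((Complex a b + 1 + of_nat (Suc n)) * of_real (ln u))) = exp (- (c * of_real (ln u))) * exp (of_real (- ln u))"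
        proof -
          have "- ((Complex a b + 1 + of_nat (Suc n)) * of_real (ln u)) = - (c * of_real (ln u)) + of_real (- ln u)"
            by (simp add: c_def algebra_simps)
          then show ?thesis by (simp only: exp_add)
        qed
        also have "exp (complex_of_real (- ln u)) = of_real (1 / u)"
          using u0 by (simp only: exp_of_real exp_minus exp_ln inverse_eq_divide)
        finally have e: "exp (- ((Complex a b + 1 + of_nat (Suc n)) * of_real (ln u))) = exp (- (c * of_real (ln u))) * of_real (1 / u)" .
        have "coef (Suc n) (Complex a b) = coef n (Complex a b) * - c" by (simp only: coef_Suc c_def)
        then show ?thesis unfolding W_def e by (simp add: mult_ac)
      qed
      ultimately show "((\<lambda>u. exp (- ((Complex a b + 1 + of_nat n) * of_real (ln u))) * W n b) has_vector_derivative
          exp (- ((Complex a b + 1 + of_nat (Suc n)) * of_real (ln u))) * W (Suc n) b) (at u)"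
        by (simp only: c_def)
      have "u powr (- (a + 1 + real (Suc n))) \<le> (x / 2) powr (- (a + 1 + real (Suc n)))"
        using u x a by (intro powr_mono2') auto
      then show "norm (exp (- ((Complex a b + 1 + of_nat (Suc n)) * of_real (ln u))) * W (Suc n) b) \<le> (x / 2) powr (- (a + 1 + real (Suc n))) * norm (W (Suc n) b)"
        unfolding norm_mult cmod_exp_ln[OF u0] by (intro mult_right_mono) auto
    qed
    show "open {x / 2<..<2 * x}" "convex {x / 2<..<2 * x}" by (rule open_greaterThanLessThan convex_real_interval)+
    show "x \<in> {x / 2<..<2 * x}" using x by simp
  qed
  then have "((\<lambda>x. mellin_inverse n a x) has_vector_derivative mellin_inverse (Suc n) a x) (at x)"
    unfolding mellin_inverse_def W_def by (rule has_vector_derivative_mult_right)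
  then show ?thesis
    unfolding has_real_derivative_iff_has_vector_derivative
    by (rule bounded_linear.has_vector_derivative[OF bounded_linear_Re])
qed

lemma mellin_inverse_tendsto_0:
  assumes a: "0 < a"
  shows "((\<lambda>x. Re (mellin_inverse n a x)) \<longlongrightarrow> 0) at_top"
proof (rule Lim_null_comparison)
  define C where "C = (\<integral>b. norm (coef n (Complex a b) * exp (of_real t * \<Psi> (Complex a b))) \<partial>lborel)"
  have "((\<lambda>x. x powr (- (a + 1 + real n)) * C) \<longlongrightarrow> 0 * C) at_top"
    by (intro tendsto_intros tendsto_neg_powr) (use a in \<open>auto intro: filterlim_ident\<close>)
  then show "((\<lambda>x. x powr (- (a + 1 + real n)) * C) \<longlongrightarrow> 0) at_top" by simp
  show "\<forall>\<^sub>F x in at_top. norm (Re (mellin_inverse n a x)) \<le> x powr (- (a + 1 + real n)) * C"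
    using eventually_gt_at_top[of 0]
  proof eventually_elim
    case (elim x)
    let ?f = "\<lambda>b. exp (- ((Complex a b + 1 + of_nat n) * of_real (ln x))) * (coef n (Complex a b) * exp (of_real t * \<Psi> (Complex a b)))"
    have "norm (Re (mellin_inverse n a x)) \<le> cmod (mellin_inverse n a x)" using abs_Re_le_cmod by simp
    also have "\<dots> = 1 / (2 * pi) * cmod (CLBINT b. ?f b)" unfolding mellin_inverse_def norm_mult by (simp add: norm_divide)
    also have "\<dots> \<le> 1 * cmod (CLBINT b. ?f b)" using pi_gt3 by (intro mult_right_mono) (auto simp: field_simps)
    also have "\<dots> \<le> (\<integral>b. norm (?f b) \<partial>lborel)" unfolding mult_1_left by (rule integral_norm_bound)
    also have "\<dots> = (\<integral>b. x powr (- (a + 1 + real n)) * norm (coef n (Complex a b) * exp (of_real t * \<Psi> (Complex a b))) \<partial>lborel)"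
      by (simp only: norm_mult cmod_exp_ln[OF elim])
    also have "\<dots> = x powr (- (a + 1 + real n)) * C" unfolding C_def by (rule integral_mult_right_zero)
    finally show ?case .
  qed
qed

text \<open>
  The density is taken to be the derivative of the distribution function, so that its definition does not
  mention a line of integration.
\<close>

definition dens :: "real \<Rightarrow> real" where "dens = deriv (cdf M)"

lemma dens_eq: "0 < a \<Longrightarrow> 0 < x \<Longrightarrow> dens x = Re (mellin_inverse 0 a x)"
  unfolding dens_def by (rule DERIV_imp_deriv[OF cdf_deriv_mellin])

lemma higher_deriv_dens: "0 < a \<Longrightarrow> 0 < x \<Longrightarrow> (deriv ^^ n) dens x = Re (mellin_inverse n a x)"
  and dens_differentiable: "0 < x \<Longrightarrow> (deriv ^^ n) dens differentiable (at x)"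
proof -
  have E: "\<forall>x>0. (deriv ^^ n) dens x = Re (mellin_inverse n a x)" if a: "0 < a" for a n
  proof (induction n)
    case 0
    then show ?case using dens_eq[OF a] by simp
  next
    case (Suc n)
    have "((deriv ^^ n) dens has_real_derivative Re (mellin_inverse (Suc n) a x)) (at x)" if x: "0 < x" for x
      by (rule DERIV_cong_ev[THEN iffD2, OF refl _ refl mellin_inverse_deriv[OF a x, of n]])
         (use Suc x in \<open>auto intro!: eventually_mono[OF eventually_nhds_in_open[of "{0<..}" x]]\<close>)
    then show ?case by (auto dest: DERIV_imp_deriv)
  qed
  show "0 < a \<Longrightarrow> 0 < x \<Longrightarrow> (deriv ^^ n) dens x = Re (mellin_inverse n a x)" using E by blast
  assume x: "0 < x"
  have "((deriv ^^ n) dens has_real_derivative Re (mellin_inverse (Suc n) 1 x)) (at x)"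
    by (rule DERIV_cong_ev[THEN iffD2, OF refl _ refl mellin_inverse_deriv[OF zero_less_one x, of n]])
       (use E[of 1 n] x in \<open>auto intro!: eventually_mono[OF eventually_nhds_in_open[of "{0<..}" x]]\<close>)
  then show "(deriv ^^ n) dens differentiable (at x)" by (auto simp: real_differentiable_def)
qed

lemma dens_C0: "dens \<in> C0_infinity"
proof -
  have "((deriv ^^ n) dens \<longlongrightarrow> 0) at_top" for n
    by (rule Lim_transform_eventually[OF mellin_inverse_tendsto_0[of 1 n]])
       (auto intro!: eventually_mono[OF eventually_gt_at_top[of 0]] simp: higher_deriv_dens[of 1])
  then show ?thesis using dens_differentiable by (simp add: C0_infinity_def)
qed

lemma cdf_deriv: "0 < x \<Longrightarrow> (cdf M has_real_derivative dens x) (at x)"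
  using cdf_deriv_mellin[of 1 x] dens_eq[of 1 x] by simp

lemma dens_nonneg: "0 \<le> dens x" if x: "0 < x"
proof (rule ccontr)
  assume "\<not> 0 \<le> dens x"
  then have "dens x < 0" by simp
  from DERIV_neg_dec_right[OF cdf_deriv[OF x] this]
  obtain e where e: "e > 0" "\<And>h. 0 < h \<Longrightarrow> h < e \<Longrightarrow> cdf M (x + h) < cdf M x" by blast
  then have "cdf M (x + e / 2) < cdf M x" by simp
  moreover have "cdf M x \<le> cdf M (x + e / 2)" using e(1) by (intro cdf_nondecreasing) simp
  ultimately show False by simp
qed

text \<open>
  The fundamental theorem of calculus gives the mass of the intervals \<open>(u,v]\<close> with \<open>u > 0\<close>; \<open>u\<close> tends to \<open>0\<close>
  through \<open>x / (n + 1)\<close>, as nothing is known about the density at \<open>0\<close>.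
\<close>

lemma dens_density: "has_pos_density M dens"
proof -
  define q where "q = (\<lambda>x. indicator {0<..} x *\<^sub>R dens x)"
  have "continuous_on {0<..} dens"
    using dens_differentiable[of _ 0] by (intro continuous_at_imp_continuous_on) (auto intro: differentiable_imp_continuous_within)
  then have q_meas [measurable]: "q \<in> borel_measurable borel"
    unfolding q_def by (intro borel_measurable_continuous_on_indicator) auto
  have q_nonneg: "0 \<le> q x" for x using dens_nonneg by (auto simp: q_def indicator_def)
  define N where "N = density lborel (\<lambda>x. ennreal (q x))"
  have N_Ioc: "emeasure N {u<..v} = emeasure M {u<..v}" if uv: "0 < u" "u \<le> v" for u v
  proof -
    have "emeasure N {u<..v} = (\<integral>\<^sup>+x. ennreal (q x) * indicator {u<..v} x \<partial>lborel)"
      unfolding N_def by (rule emeasure_density) auto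
    also have "\<dots> = (\<integral>\<^sup>+x. ennreal (q x) * indicator {u..v} x \<partial>lborel)"
    proof (rule nn_integral_cong_AE)
      show "AE x in lborel. ennreal (q x) * indicator {u<..v} x = ennreal (q x) * indicator {u..v} x"
        using AE_lborel_singleton[of u] by eventually_elim (auto simp: indicator_def)
    qed
    also have "\<dots> = cdf M v - cdf M u"
      by (rule nn_integral_FTC_Icc[OF q_meas]) (use uv dens_nonneg cdf_deriv in \<open>auto simp: q_def\<close>)
    also have "\<dots> = emeasure M {u<..v}"
      using uv cdf_diff_eq[of u v] by (cases "u = v") (auto simp: emeasure_eq_measure)
    finally show ?thesis .
  qed
  have N_0: "emeasure N {..0} = 0"
  proof -
    have "emeasure N {..0} = (\<integral>\<^sup>+x. ennreal (q x) * indicator {..0} x \<partial>lborel)"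
      unfolding N_def by (rule emeasure_density) auto
    also have "\<dots> = (\<integral>\<^sup>+(x::real). 0 \<partial>lborel)"
      by (rule nn_integral_cong) (auto simp: q_def indicator_def)
    finally show ?thesis by simp
  qed
  have M_0: "emeasure M {..0} = 0" using pos_M by (simp add: pos_measure_def)
  have N_eq: "emeasure N {..x} = emeasure M {..x}" for x
  proof (cases "0 < x")
    case False
    then have s: "{..x} \<subseteq> {..0}" by auto
    have "emeasure N {..x} = 0" by (rule emeasure_eq_0[OF _ N_0 s]) (simp add: N_def)
    moreover have "emeasure M {..x} = 0" by (rule emeasure_eq_0[OF _ M_0 s]) (simp add: sets_M)
    ultimately show ?thesis by simp
  next
    case True
    define A where "A = (\<lambda>n. {x / real (Suc n)<..x})"
    have U: "(\<Union>n. A n) = {0<..x}"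
    proof (intro equalityI subsetI)
      fix y assume "y \<in> {0<..x}"
      then have y: "0 < y" "y \<le> x" by auto
      obtain n where "x / y < real n" using reals_Archimedean2 by blast
      then have "x / y < real (Suc n)" by simp
      then have "x / real (Suc n) < y" using y by (simp add: field_simps)
      then show "y \<in> (\<Union>n. A n)" using y by (auto simp: A_def)
    next
      fix y assume "y \<in> (\<Union>n. A n)"
      then obtain n where "x / real (Suc n) < y" "y \<le> x" by (auto simp: A_def)
      moreover have "0 < x / real (Suc n)" using True by simp
      ultimately show "y \<in> {0<..x}" by auto
    qed
    have inc: "incseq A"
      unfolding incseq_def
    proof (intro allI impI)
      fix m n :: nat assume "m \<le> n"
      then have "x / real (Suc n) \<le> x / real (Suc m)" using True by (intro divide_left_mono) auto
      then show "A m \<subseteq> A n" unfolding A_def by auto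
    qed
    have lN: "(\<lambda>n. emeasure N (A n)) \<longlonglongrightarrow> emeasure N {0<..x}"
    proof -
      have "range A \<subseteq> sets N" by (auto simp: A_def N_def)
      from Lim_emeasure_incseq[OF this inc] show ?thesis by (simp only: U)
    qed
    have lM: "(\<lambda>n. emeasure M (A n)) \<longlonglongrightarrow> emeasure M {0<..x}"
    proof -
      have "range A \<subseteq> sets M" by (auto simp: A_def sets_M)
      from Lim_emeasure_incseq[OF this inc] show ?thesis by (simp only: U)
    qed
    have "emeasure N (A n) = emeasure M (A n)" for n
      unfolding A_def using True by (intro N_Ioc) (auto simp: field_simps)
    then have eq: "emeasure N {0<..x} = emeasure M {0<..x}" using lN lM LIMSEQ_unique by simp
    have sp: "{..x} = {..0} \<union> {0<..x}" using True by auto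
    have "emeasure N {..x} = emeasure N {..0} + emeasure N {0<..x}"
      unfolding sp by (rule plus_emeasure[symmetric]) (auto simp: N_def)
    moreover have "emeasure M {..x} = emeasure M {..0} + emeasure M {0<..x}"
      unfolding sp by (rule plus_emeasure[symmetric]) (auto simp: sets_M)
    ultimately show ?thesis using eq N_0 M_0 by simp
  qed
  have "M = N"
  proof (rule measure_eqI_generator_eq[where E="range (\<lambda>x. {..x})" and \<Omega>=UNIV and A="\<lambda>i::nat. {..real i}"])
    show "Int_stable (range (\<lambda>x::real. {..x}))" by (auto simp: Int_stable_def)
    show "sets M = sigma_sets UNIV (range (\<lambda>x::real. {..x}))" by (simp add: sets_M borel_eq_atMost)
    show "sets N = sigma_sets UNIV (range (\<lambda>x::real. {..x}))" by (simp add: N_def borel_eq_atMost)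
    show "(\<Union>i::nat. {..real i}) = UNIV" using real_arch_simple by auto
    show "emeasure M {..real i} \<noteq> \<infinity>" for i :: nat by simp
  qed (use N_eq in auto)
  moreover have "(\<lambda>x. ennreal (q x)) = (\<lambda>x. ennreal (dens x) * indicator {0<..} x)"
    by (auto simp: q_def indicator_def fun_eq_iff)
  ultimately show ?thesis unfolding has_pos_density_def N_def using dens_nonneg by simp
qed

end

section \<open>The saddle point approximation\<close>

text \<open>
  \<open>(1 + x/r)\<^sup>r\<close> is nondecreasing in \<open>r\<close>, by concavity of the logarithm. It yields a majorant that does
  not depend on the saddle point.
\<close>

lemma power_le_exp_ln: "(1 + x / N) ^ n \<le> exp (r * ln (1 + x / r))"
  if x: "0 \<le> x" and N: "N = real n" "0 < N" "N \<le> r" for x N r :: real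
proof -
  have r: "0 < r" using N by simp
  have "(N / r) * ln (1 + x / N) + (1 - N / r) * ln 1 \<le> ln ((N / r) * (1 + x / N) + (1 - N / r) * 1)"
    using concave_onD[OF ln_concave, of "N / r" 1 "1 + x / N"] x N r by (simp add: add_pos_nonneg field_simps)
  also have "(N / r) * (1 + x / N) + (1 - N / r) * 1 = 1 + x / r" using N r by (simp add: field_simps)
  finally have "N * ln (1 + x / N) \<le> r * ln (1 + x / r)" using r by (simp add: field_simps)
  then have "exp (N * ln (1 + x / N)) \<le> exp (r * ln (1 + x / r))" by simp
  moreover have "exp (N * ln (1 + x / N)) = (1 + x / N) ^ n"
    using x N unfolding N(1) by (subst exp_of_nat_mult) (simp add: add_pos_nonneg)
  ultimately show ?thesis by simp
qed

context jurek
begin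

lemma g_ratio_tendsto: "((\<lambda>a. g a / g (a + 1)) \<longlongrightarrow> 1) at_top"
proof (rule tendsto_sandwich[OF _ _ tendsto_const])
  show "\<forall>\<^sub>F a in at_top. 1 \<le> g a / g (a + 1)"
    using eventually_gt_at_top[of 0]
    by eventually_elim (use g_antimono g_pos in \<open>simp add: le_divide_eq_1\<close>)
  show "\<forall>\<^sub>F a in at_top. g a / g (a + 1) \<le> ((a + 1) / a)\<^sup>2"
    using eventually_gt_at_top[of 0]
  proof eventually_elim
    case (elim a)
    have "a\<^sup>2 * g a \<le> (a + 1)\<^sup>2 * g (a + 1)" by (rule g_scaled_mono) (use elim in auto)
    moreover have "0 < g (a + 1)" using g_pos elim by simp
    ultimately show ?case using elim by (simp add: power_divide divide_le_eq le_divide_eq mult.commute)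
  qed
  show "((\<lambda>a::real. ((a + 1) / a)\<^sup>2) \<longlongrightarrow> 1) at_top" by real_asymp
qed

lemma variance_ratio_tendsto: "((\<lambda>a. variance_integral a / g (a + 1)) \<longlongrightarrow> 1) at_top"
proof (rule tendsto_sandwich[OF _ _ tendsto_const g_ratio_tendsto])
  show "\<forall>\<^sub>F a in at_top. 1 \<le> variance_integral a / g (a + 1)"
    using eventually_gt_at_top[of 0]
  proof eventually_elim
    case (elim a)
    then show ?case using variance_integral_bounds(1)[OF elim] g_pos[of "a + 1"] by (simp add: le_divide_eq_1)
  qed
  show "\<forall>\<^sub>F a in at_top. variance_integral a / g (a + 1) \<le> g a / g (a + 1)"
    using eventually_gt_at_top[of 0]
  proof eventually_elim
    case (elim a)
    then show ?case using variance_integral_bounds(2)[OF elim] g_pos[of "a + 1"] by (simp add: divide_right_mono)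
  qed
qed

end

context berg_urbanik
begin

text \<open>
  The standard deviation of the tilted law up to a factor that tends to \<open>1\<close>. The argument \<open>a + 1\<close> is the
  one in the bound on the decay, which then reads \<open>(1 + \<theta>\<^sup>2/m) powr (- m/2)\<close> with \<open>m = (std a * (a + 1))\<^sup>2\<close>.
\<close>

definition std :: "real \<Rightarrow> real" where "std a = sqrt (t * g (a + 1))"

lemma std_pos: "0 < a \<Longrightarrow> 0 < std a"
  using t_pos g_pos[of "a + 1"] by (simp add: std_def)

lemma std_sq: "0 < a \<Longrightarrow> (std a)\<^sup>2 = t * g (a + 1)"
  using t_pos g_pos[of "a + 1"] by (simp add: std_def)

lemma std_tendsto: "(std \<longlongrightarrow> 0) at_top"
proof -
  have "((\<lambda>a. g (a + 1)) \<longlongrightarrow> 0) at_top"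
    by (rule filterlim_compose[OF g_tendsto_0]) real_asymp
  then have "((\<lambda>a. sqrt (t * g (a + 1))) \<longlongrightarrow> sqrt (t * 0)) at_top" by (intro tendsto_intros)
  then show ?thesis by (simp add: std_def[abs_def])
qed

text \<open>
  The scale of the fluctuations tends to \<open>0\<close> but is large compared with \<open>1 / a\<close>. This makes the law of the
  tilted variable asymptotically Gaussian and the polynomial factors asymptotically constant.
\<close>

lemma std_scaled_at_top: "filterlim (\<lambda>a. std a * (a + 1)) at_top at_top"
proof -
  have "filterlim (\<lambda>a. t * (a\<^sup>2 * g a)) at_top at_top"
    by (rule filterlim_tendsto_pos_mult_at_top[OF tendsto_const t_pos g_scaled_at_top])
  then have "filterlim (\<lambda>a. t * ((a + 1)\<^sup>2 * g (a + 1))) at_top at_top"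
    by (rule filterlim_compose) real_asymp
  then have "filterlim (\<lambda>a. sqrt (t * ((a + 1)\<^sup>2 * g (a + 1)))) at_top at_top"
    by (rule filterlim_compose[OF sqrt_at_top])
  moreover have "\<forall>\<^sub>F a in at_top. sqrt (t * ((a + 1)\<^sup>2 * g (a + 1))) = std a * (a + 1)"
    using eventually_gt_at_top[of 0]
    by eventually_elim (simp add: std_def real_sqrt_mult mult_ac)
  ultimately show ?thesis by (rule filterlim_cong[THEN iffD1, rotated -1, OF _ refl refl])
qed

lemma std_mult_at_top: "filterlim (\<lambda>a. std a * a) at_top at_top"
proof -
  have "((\<lambda>a::real. a / (a + 1)) \<longlongrightarrow> 1) at_top" by real_asymp
  from filterlim_tendsto_pos_mult_at_top[OF this zero_less_one std_scaled_at_top]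
  have "filterlim (\<lambda>a. a / (a + 1) * (std a * (a + 1))) at_top at_top" .
  moreover have "\<forall>\<^sub>F a in at_top. a / (a + 1) * (std a * (a + 1)) = std a * a"
    using eventually_gt_at_top[of 0] by eventually_elim simp
  ultimately show ?thesis by (rule filterlim_cong[THEN iffD1, rotated -1, OF _ refl refl])
qed

text \<open>
  The exponent of the characteristic function of the tilted law, centred at \<open>ln (\<phi> a)\<close> and normalised by
  \<open>std a\<close>.
\<close>

definition tilted_exponent :: "real \<Rightarrow> real \<Rightarrow> complex" where
  "tilted_exponent a \<theta> = of_real t * (\<Psi> (Complex a (\<theta> / std a)) - \<Psi> (of_real a) - \<i> * of_real (\<theta> / std a * ln (\<phi> a)))"

lemma tilted_exponent_tendsto: "((\<lambda>a. tilted_exponent a \<theta>) \<longlongrightarrow> - of_real (\<theta>\<^sup>2 / 2)) at_top"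
proof -
  let ?V = "\<lambda>a. variance_integral a / g (a + 1)" and ?r = "\<lambda>a. g a / g (a + 1)"
  let ?e = "\<lambda>a. 8 * \<bar>\<theta>\<bar> ^ 3 * (?r a * inverse (std a * a)) + \<bar>\<theta>\<bar> * (std a * ?r a)"
  have "((\<lambda>a. tilted_exponent a \<theta> + of_real (\<theta>\<^sup>2 / 2 * ?V a)) \<longlongrightarrow> 0) at_top"
  proof (rule Lim_null_comparison)
    have "((\<lambda>a. inverse (std a * a)) \<longlongrightarrow> 0) at_top"
      by (rule tendsto_inverse_0_at_top[OF std_mult_at_top])
    then have "(?e \<longlongrightarrow> 8 * \<bar>\<theta>\<bar> ^ 3 * (1 * 0) + \<bar>\<theta>\<bar> * (0 * 1)) at_top"
      by (intro tendsto_intros std_tendsto g_ratio_tendsto)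
    then show "(?e \<longlongrightarrow> 0) at_top" by simp
    show "\<forall>\<^sub>F a in at_top. norm (tilted_exponent a \<theta> + of_real (\<theta>\<^sup>2 / 2 * ?V a)) \<le> ?e a"
      using eventually_gt_at_top[of 0]
    proof eventually_elim
      case (elim a)
      define s where "s = std a"
      define b where "b = \<theta> / s"
      have s: "0 < s" "s\<^sup>2 = t * g (a + 1)" using std_pos[OF elim] std_sq[OF elim] by (auto simp: s_def)
      have gp: "0 < g (a + 1)" "0 < g a" using g_pos elim by auto
      have tg: "t = s\<^sup>2 / g (a + 1)" using s gp by simp
      have v: "\<theta>\<^sup>2 / 2 * ?V a = t * (b\<^sup>2 / 2 * variance_integral a)"
        using s gp t_pos by (simp add: tg b_def field_simps power2_eq_square)
      have "tilted_exponent a \<theta> + of_real (\<theta>\<^sup>2 / 2 * ?V a)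
        = of_real t * (\<Psi> (Complex a b) - \<Psi> (of_real a) - \<i> * of_real (b * ln (\<phi> a)) + of_real (b\<^sup>2 / 2 * variance_integral a))"
        unfolding v tilted_exponent_def b_def s_def by (simp only: of_real_mult distrib_left)
      also have "cmod \<dots> \<le> t * (\<bar>b\<bar> ^ 3 * (8 * g a / a) + \<bar>b\<bar> * g a)"
        unfolding norm_mult norm_of_real using t_pos Psi_increment_bound[OF elim, of b] by (intro mult_mono) auto
      also have "\<dots> = ?e a"
      proof -
        have "\<bar>b\<bar> = \<bar>\<theta>\<bar> / s" using s by (simp add: b_def)
        moreover have "s\<^sup>2 / H * ((p / s) ^ 3 * (8 * G / a) + p / s * G) = 8 * p ^ 3 * (G / H * inverse (s * a)) + p * (s * (G / H))" if "0 < H" for p G H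
          using s(1) elim that by (simp add: field_simps power2_eq_square power3_eq_cube)
        from this[OF gp(1)] have "t * ((p / s) ^ 3 * (8 * G / a) + p / s * G) = 8 * p ^ 3 * (G / g (a + 1) * inverse (s * a)) + p * (s * (G / g (a + 1)))" for p G
          unfolding tg[symmetric] .
        ultimately show ?thesis unfolding s_def[symmetric] by (simp only:)
      qed
      finally show ?case .
    qed
  qed
  moreover have "((\<lambda>a. complex_of_real (\<theta>\<^sup>2 / 2 * ?V a)) \<longlongrightarrow> of_real (\<theta>\<^sup>2 / 2 * 1)) at_top"
    by (intro tendsto_intros variance_ratio_tendsto)
  ultimately have "((\<lambda>a. tilted_exponent a \<theta> + of_real (\<theta>\<^sup>2 / 2 * ?V a) - of_real (\<theta>\<^sup>2 / 2 * ?V a)) \<longlongrightarrow> 0 - of_real (\<theta>\<^sup>2 / 2 * 1)) at_top"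
    by (rule tendsto_diff)
  then show ?thesis by simp
qed

definition rel_coef :: "nat \<Rightarrow> real \<Rightarrow> real \<Rightarrow> complex" where
  "rel_coef n a \<theta> = (\<Prod>j<n. (Complex a (\<theta> / std a) + 1 + of_nat j) / of_real a)"

lemma rel_coef_tendsto: "((\<lambda>a. rel_coef n a \<theta>) \<longlongrightarrow> 1) at_top"
proof -
  have "((\<lambda>a. (Complex a (\<theta> / std a) + 1 + of_nat j) / of_real a) \<longlongrightarrow> 1) at_top" for j
  proof -
    have i: "((\<lambda>a. inverse (std a * a)) \<longlongrightarrow> 0) at_top"
      by (rule tendsto_inverse_0_at_top[OF std_mult_at_top])
    have "((\<lambda>a. (1 + real j) / a) \<longlongrightarrow> 0) at_top" by real_asymp
    then have "((\<lambda>a. 1 + complex_of_real ((1 + real j) / a) + \<i> * of_real (\<theta> * inverse (std a * a))) \<longlongrightarrow> 1 + of_real 0 + \<i> * of_real (\<theta> * 0)) at_top"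
      by (intro tendsto_intros i)
    moreover have "\<forall>\<^sub>F a in at_top. 1 + complex_of_real ((1 + real j) / a) + \<i> * of_real (\<theta> * inverse (std a * a)) = (Complex a (\<theta> / std a) + 1 + of_nat j) / of_real a"
      using eventually_gt_at_top[of 0]
    proof eventually_elim
      case (elim a)
      then show ?case using std_pos[OF elim] by (simp add: Complex_eq field_simps)
    qed
    ultimately show ?thesis by (simp add: Lim_transform_eventually)
  qed
  then have "((\<lambda>a. rel_coef n a \<theta>) \<longlongrightarrow> (\<Prod>j<n. 1)) at_top"
    unfolding rel_coef_def by (intro tendsto_prod)
  then show ?thesis by simp
qed

lemma cmod_rel_coef_le: "cmod (rel_coef n a \<theta>) \<le> (real n + 1 + \<bar>\<theta>\<bar>) ^ n" if a: "1 \<le> a" "1 \<le> std a * a"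
proof -
  have "cmod (rel_coef n a \<theta>) = (\<Prod>j<n. cmod ((Complex a (\<theta> / std a) + 1 + of_nat j) / of_real a))"
    unfolding rel_coef_def by (rule prod_norm[symmetric])
  also have "\<dots> \<le> (\<Prod>j<n. real n + 1 + \<bar>\<theta>\<bar>)"
  proof (rule prod_mono, intro conjI)
    fix j assume j: "j \<in> {..<n}"
    have sp: "0 < std a" using std_pos a by simp
    have "(Complex a (\<theta> / std a) + 1 + of_nat j) / of_real a = Complex ((a + 1 + real j) / a) (\<theta> / (std a * a))"
      using a by (simp add: complex_eq_iff Re_divide_of_real Im_divide_of_real)
    also have "cmod \<dots> \<le> \<bar>(a + 1 + real j) / a\<bar> + \<bar>\<theta> / (std a * a)\<bar>" using cmod_le[of "Complex ((a + 1 + real j) / a) (\<theta> / (std a * a))"] by simp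
    also have "\<dots> \<le> (real n + 1) + \<bar>\<theta>\<bar>"
    proof (rule add_mono)
      have "(a + 1 + real j) / a \<le> (a + real n) / a" using j a by (intro divide_right_mono) auto
      also have "\<dots> = 1 + real n / a" using a by (simp add: field_simps)
      also have "\<dots> \<le> 1 + real n / 1" using a by (intro add_left_mono divide_left_mono) auto
      finally show "\<bar>(a + 1 + real j) / a\<bar> \<le> real n + 1" using a by simp
      show "\<bar>\<theta> / (std a * a)\<bar> \<le> \<bar>\<theta>\<bar>"
        using divide_left_mono[OF a(2), of "\<bar>\<theta>\<bar>"] a by simp
    qed
    finally show "cmod ((Complex a (\<theta> / std a) + 1 + of_nat j) / of_real a) \<le> real n + 1 + \<bar>\<theta>\<bar>" .
  qed simp
  finally show ?thesis by simp
qed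

lemma cmod_exp_tilted_exponent: "cmod (exp (tilted_exponent a \<theta>)) = exp (- (t * decay a (\<theta> / std a)))" if "0 < a"
  using that by (simp add: tilted_exponent_def Re_Psi_decay)

definition local_integral :: "nat \<Rightarrow> real \<Rightarrow> complex" where
  "local_integral n a = (CLBINT \<theta>. rel_coef n a \<theta> * exp (tilted_exponent a \<theta>))"

lemma exp_tilted_exponent_measurable [measurable]:
  assumes a: "0 < a"
  shows "(\<lambda>\<theta>. exp (tilted_exponent a \<theta>)) \<in> borel_measurable borel"
proof -
  have "(\<lambda>\<theta>. exp (of_real t * \<Psi> (Complex a (\<theta> / std a)))) \<in> borel_measurable borel"
    by (rule measurable_compose[OF _ exp_Psi_measurable[OF a]]) measurable
  then have "(\<lambda>\<theta>. exp (of_real t * \<Psi> (Complex a (\<theta> / std a))) * exp (- (of_real t * (\<Psi> (of_real a) + \<i> * of_real (\<theta> / std a * ln (\<phi> a)))))) \<in> borel_measurable borel"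
    by measurable
  also have "(\<lambda>\<theta>. exp (of_real t * \<Psi> (Complex a (\<theta> / std a))) * exp (- (of_real t * (\<Psi> (of_real a) + \<i> * of_real (\<theta> / std a * ln (\<phi> a)))))) = (\<lambda>\<theta>. exp (tilted_exponent a \<theta>))"
    by (rule ext) (simp add: tilted_exponent_def exp_add[symmetric] algebra_simps)
  finally show ?thesis .
qed

lemma rel_coef_measurable [measurable]: "(\<lambda>\<theta>. rel_coef n a \<theta>) \<in> borel_measurable borel"
  unfolding rel_coef_def Complex_eq by measurable

text \<open>
  The local central limit theorem, by dominated convergence. Once \<open>m = t (a+1)\<^sup>2 g (a+1)\<close> exceeds \<open>2N\<close>, the
  modulus of the characteristic function is at most \<open>(1 + \<theta>\<^sup>2/(2N)) powr (- N)\<close>. With \<open>N = n + 1\<close> this absorbs the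
  \<open>n\<close> factors of \<open>rel_coef\<close> and leaves an integrable function.
\<close>

lemma local_integral_tendsto: "(local_integral n \<longlongrightarrow> of_real (sqrt (2 * pi))) at_top"
proof -
  define N where "N = real (n + 1)"
  \<comment> \<open>chosen so that \<open>n + 1 + \<bar>\<theta>\<bar> \<le> K (1 + \<theta>\<^sup>2/(2N))\<close>\<close>
  define K where "K = real n + 1 + 2 * N"
  have N0: "0 < N" by (simp add: N_def)
  let ?s = "\<lambda>a \<theta>. rel_coef n a \<theta> * exp (tilted_exponent a \<theta>)"
  let ?w = "\<lambda>\<theta>. K ^ n * (1 / (1 + (\<theta> / sqrt (2 * N))\<^sup>2))"
  have dom: "norm (?s a \<theta>) \<le> ?w \<theta>" if a: "1 \<le> a" "1 \<le> std a * a" "2 * N \<le> t * ((a + 1)\<^sup>2 * g (a + 1))" for a \<theta>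
  proof -
    define m where "m = t * ((a + 1)\<^sup>2 * g (a + 1))"
    define q where "q = 1 + \<theta>\<^sup>2 / 2 / N"
    have q1: "1 \<le> q" using N0 by (simp add: q_def)
    have a0: "0 < a" using a by simp
    have m: "2 * N \<le> m" "0 < m" using a(3) N0 by (auto simp: m_def)
    have bA: "(\<theta> / std a / (a + 1))\<^sup>2 = \<theta>\<^sup>2 / 2 / (m / 2)"
      using std_sq[OF a0] by (simp add: power_divide m_def power_mult_distrib mult_ac)
    have "m / 2 * ln (1 + \<theta>\<^sup>2 / 2 / (m / 2)) = t * ((a + 1)\<^sup>2 / 2 * ln (1 + (\<theta> / std a / (a + 1))\<^sup>2) * g (a + 1))"
      unfolding bA by (simp add: m_def mult_ac)
    also have "\<dots> \<le> t * decay a (\<theta> / std a)" using t_pos a0 by (intro mult_left_mono decay_lower) auto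
    finally have e: "exp (m / 2 * ln (1 + \<theta>\<^sup>2 / 2 / (m / 2))) \<le> exp (t * decay a (\<theta> / std a))" by simp
    have "q ^ (n + 1) \<le> exp (m / 2 * ln (1 + \<theta>\<^sup>2 / 2 / (m / 2)))"
      unfolding q_def by (rule power_le_exp_ln) (use m N0 in \<open>auto simp: N_def\<close>)
    then have "q ^ (n + 1) \<le> exp (t * decay a (\<theta> / std a))" using e by linarith
    then have E: "cmod (exp (tilted_exponent a \<theta>)) \<le> (1 / q) ^ (n + 1)"
      unfolding cmod_exp_tilted_exponent[OF a0] exp_minus inverse_eq_divide power_one_over
      using q1 by (intro divide_left_mono) auto
    have "\<bar>\<theta>\<bar> \<le> 2 * N * q"
    proof -
      have "2 * \<bar>\<theta>\<bar> \<le> 1 + \<theta>\<^sup>2" using sum_squares_bound[of "\<bar>\<theta>\<bar>" 1] by simp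
      moreover have "2 * N * q = 2 * N + \<theta>\<^sup>2" using N0 by (simp add: q_def field_simps)
      moreover have "1 \<le> 2 * N" by (simp add: N_def)
      ultimately show ?thesis by linarith
    qed
    moreover have "real n + 1 \<le> (real n + 1) * q" using q1 mult_left_mono[of 1 q "real n + 1"] by simp
    ultimately have "real n + 1 + \<bar>\<theta>\<bar> \<le> K * q" by (simp add: K_def distrib_right)
    then have "(real n + 1 + \<bar>\<theta>\<bar>) ^ n \<le> (K * q) ^ n" by (intro power_mono) auto
    then have C: "cmod (rel_coef n a \<theta>) \<le> (K * q) ^ n" using cmod_rel_coef_le[OF a(1,2), of n \<theta>] by linarith
    have "norm (?s a \<theta>) \<le> (K * q) ^ n * (1 / q) ^ (n + 1)"
      unfolding norm_mult by (rule mult_mono[OF C E]) (use q1 N0 in \<open>auto simp: K_def\<close>)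
    also have "\<dots> = K ^ n * (1 / q)" using q1 by (simp add: power_mult_distrib power_divide)
    also have "q = 1 + (\<theta> / sqrt (2 * N))\<^sup>2" using N0 by (simp add: q_def power_divide)
    finally show ?thesis .
  qed
  have ev: "\<forall>\<^sub>F a in at_top. 1 \<le> a \<and> 1 \<le> std a * a \<and> 2 * N \<le> t * ((a + 1)\<^sup>2 * g (a + 1))"
  proof (intro eventually_conj eventually_ge_at_top)
    show "\<forall>\<^sub>F a in at_top. 1 \<le> std a * a" using std_mult_at_top by (simp add: filterlim_at_top)
    have "filterlim (\<lambda>a::real. a + 1) at_top at_top" by real_asymp
    from filterlim_iff[THEN iffD1, OF this, rule_format, OF eventually_scaled_g_ge[of "2 * N"]]
    show "\<forall>\<^sub>F a in at_top. 2 * N \<le> t * ((a + 1)\<^sup>2 * g (a + 1))" .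
  qed
  obtain a0 where a0: "\<And>a. a0 \<le> a \<Longrightarrow> 1 \<le> a \<and> 1 \<le> std a * a \<and> 2 * N \<le> t * ((a + 1)\<^sup>2 * g (a + 1))"
    using ev unfolding eventually_at_top_linorder by blast
  \<comment> \<open>replacing a by \<open>max u a\<close> makes the integrands measurable and dominated for every a, not just eventually\<close>
  define u where "u = max a0 1"
  have "((\<lambda>a. CLBINT \<theta>. ?s (max u a) \<theta>) \<longlongrightarrow> (CLBINT \<theta>. exp (- of_real (\<theta>\<^sup>2 / 2)))) at_top"
  proof (rule integral_dominated_convergence_at_top)
    show "integrable lborel ?w"
      by (intro integrable_mult_right integrable_inverse_quadratic) (use N0 in simp)
    show "(\<lambda>\<theta>. exp (- complex_of_real (\<theta>\<^sup>2 / 2))) \<in> borel_measurable lborel" by measurable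
    show "(\<lambda>\<theta>. ?s (max u a) \<theta>) \<in> borel_measurable lborel" for a
    proof -
      have "0 < max u a" by (simp add: u_def)
      then show ?thesis by measurable
    qed
    show "\<forall>\<^sub>F a in at_top. AE \<theta> in lborel. norm (?s (max u a) \<theta>) \<le> ?w \<theta>"
    proof (rule always_eventually, rule allI, rule AE_I2)
      fix a \<theta>
      show "norm (?s (max u a) \<theta>) \<le> ?w \<theta>"
        using a0[of "max u a"] by (intro dom) (auto simp: u_def)
    qed
    show "AE \<theta> in lborel. ((\<lambda>a. ?s (max u a) \<theta>) \<longlongrightarrow> exp (- complex_of_real (\<theta>\<^sup>2 / 2))) at_top"
    proof (rule AE_I2)
      fix \<theta> :: real
      have "((\<lambda>a. ?s a \<theta>) \<longlongrightarrow> 1 * exp (- of_real (\<theta>\<^sup>2 / 2))) at_top"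
        by (intro tendsto_mult rel_coef_tendsto tendsto_exp tilted_exponent_tendsto)
      moreover have "\<forall>\<^sub>F a in at_top. ?s a \<theta> = ?s (max u a) \<theta>"
        using eventually_ge_at_top[of u] by eventually_elim (simp add: max_absorb2)
      ultimately have "((\<lambda>a. ?s (max u a) \<theta>) \<longlongrightarrow> 1 * exp (- of_real (\<theta>\<^sup>2 / 2))) at_top"
        by (rule Lim_transform_eventually)
      then show "((\<lambda>a. ?s (max u a) \<theta>) \<longlongrightarrow> exp (- complex_of_real (\<theta>\<^sup>2 / 2))) at_top" by simp
    qed
  qed
  then have lim: "((\<lambda>a. local_integral n (max u a)) \<longlongrightarrow> (CLBINT \<theta>. exp (- of_real (\<theta>\<^sup>2 / 2)))) at_top"
    by (simp only: local_integral_def)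
  have "(CLBINT \<theta>. exp (- complex_of_real (\<theta>\<^sup>2 / 2))) = (CLBINT \<theta>. complex_of_real (sqrt (2 * pi) * std_normal_density \<theta>))"
    by (intro Bochner_Integration.integral_cong refl) (simp add: std_normal_density_def exp_of_real[symmetric])
  also have "\<dots> = of_real (sqrt (2 * pi) * (\<integral>\<theta>. std_normal_density \<theta> \<partial>lborel))"
    by (simp only: integral_complex_of_real integral_mult_right_zero)
  also have "(\<integral>\<theta>. std_normal_density \<theta> \<partial>lborel) = 1"
    using integral_std_normal_moment_even[of 0] by simp
  finally have "((\<lambda>a. local_integral n (max u a)) \<longlongrightarrow> of_real (sqrt (2 * pi))) at_top" using lim by simp
  moreover have "\<forall>\<^sub>F a in at_top. local_integral n (max u a) = local_integral n a"
    using eventually_ge_at_top[of u] by eventually_elim (simp add: max_absorb2)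
  ultimately show ?thesis by (rule Lim_transform_eventually)
qed

text \<open>
  The saddle point approximation of the density at \<open>(\<phi> a) powr t\<close>.
\<close>

definition saddle :: "real \<Rightarrow> real" where
  "saddle a = exp (- (t * ln (\<phi> a))) * exp (t * (Re (\<Psi> (of_real a)) - a * ln (\<phi> a))) / (std a * sqrt (2 * pi))"

text \<open>
  The line of integration passes through the saddle point \<open>a\<close> of \<open>x = \<phi> a\<close>, and \<open>b = \<theta> / std a\<close>.
\<close>

lemma mellin_inverse_saddle:
  assumes a: "0 < a"
  shows "mellin_inverse n a (\<phi> a powr t) = of_real ((-1) ^ n * a ^ n * \<phi> a powr (- (real n * t)) * saddle a) * (local_integral n a / of_real (sqrt (2 * pi)))"
proof -
  define L where "L = ln (\<phi> a)"
  define s where "s = std a"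
  define R where "R = Re (\<Psi> (of_real a))"
  have s: "0 < s" using std_pos[OF a] by (simp add: s_def)
  have phi: "0 < \<phi> a" by (rule phi_pos[OF a])
  have ln: "ln (\<phi> a powr t) = t * L" using phi by (simp add: L_def ln_powr)
  let ?f = "\<lambda>b. exp (- ((Complex a b + 1 + of_nat n) * of_real (t * L))) * (coef n (Complex a b) * exp (of_real t * \<Psi> (Complex a b)))"
  define c where "c = (-1) ^ n * a ^ n * exp (- ((real n + 1) * (t * L))) * exp (t * (R - a * L))"
  have pt: "?f (0 + 1 / s * \<theta>) = of_real c * (rel_coef n a \<theta> * exp (tilted_exponent a \<theta>))" for \<theta>
  proof -
    define z where "z = Complex a (\<theta> / s)"
    have "coef n z = of_real ((-1) ^ n * a ^ n) * rel_coef n a \<theta>"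
    proof -
      have "coef n z = (\<Prod>j<n. of_real (- a) * ((z + 1 + of_nat j) / of_real a))"
        unfolding coef_def using a by (intro prod.cong) auto
      also have "\<dots> = of_real (- a) ^ n * rel_coef n a \<theta>"
        unfolding prod.distrib rel_coef_def z_def s_def by simp
      also have "complex_of_real (- a) ^ n = of_real ((-1) ^ n * a ^ n)"
        by (metis mult_minus1 of_real_power power_mult_distrib)
      finally show ?thesis .
    qed
    moreover have "exp (- ((z + 1 + of_nat n) * of_real (t * L))) * exp (of_real t * \<Psi> z)
        = of_real (exp (- ((real n + 1) * (t * L))) * exp (t * (R - a * L))) * exp (tilted_exponent a \<theta>)"
    proof -
      have P: "\<Psi> (of_real a) = of_real R" unfolding R_def by (rule Psi_real[OF a])
      have arg: "- ((z + 1 + of_nat n) * of_real (t * L)) + of_real t * \<Psi> z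
        = of_real (- ((real n + 1) * (t * L)) + t * (R - a * L)) + tilted_exponent a \<theta>"
        unfolding tilted_exponent_def P by (simp add: z_def[symmetric] s_def[symmetric] L_def[symmetric]) (simp add: z_def Complex_eq algebra_simps)
      define X where "X = - ((real n + 1) * (t * L)) + t * (R - a * L)"
      have "exp (- ((z + 1 + of_nat n) * of_real (t * L))) * exp (of_real t * \<Psi> z) = exp (of_real X + tilted_exponent a \<theta>)"
        by (simp only: exp_add[symmetric] arg X_def)
      also have "\<dots> = of_real (exp X) * exp (tilted_exponent a \<theta>)"
        by (simp only: exp_add[of "of_real X"] exp_of_real)
      finally show ?thesis by (simp only: X_def exp_add)
    qed
    ultimately show ?thesis
      by (simp add: c_def z_def[symmetric] mult_ac)
  qed
  have "mellin_inverse n a (\<phi> a powr t) = 1 / (2 * pi) * (CLBINT b. ?f b)"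
    by (simp only: mellin_inverse_def ln)
  also have "(CLBINT b. ?f b) = \<bar>1 / s\<bar> *\<^sub>R (CLBINT \<theta>. ?f (0 + 1 / s * \<theta>))"
    by (rule lborel_integral_real_affine) (use s in simp)
  also have "(CLBINT \<theta>. ?f (0 + 1 / s * \<theta>)) = of_real c * local_integral n a"
    unfolding pt local_integral_def by (rule integral_mult_right_zero)
  finally have "mellin_inverse n a (\<phi> a powr t) = of_real (1 / (2 * pi) * (1 / s) * c) * local_integral n a"
    using s by (simp add: scaleR_conv_of_real)
  also have "1 / (2 * pi) * (1 / s) * c = (-1) ^ n * a ^ n * \<phi> a powr (- (real n * t)) * saddle a / sqrt (2 * pi)"
  proof -
    have "exp (- ((real n + 1) * (t * L))) = \<phi> a powr (- (real n * t)) * exp (- (t * L))"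
      using phi by (simp add: powr_def L_def exp_add[symmetric] algebra_simps)
    note e = this
    define q where "q = sqrt (2 * pi)"
    have q: "0 < q" by (simp add: q_def)
    have pi: "2 * pi = q * q" unfolding q_def by simp
    have "1 / (q * q) * (1 / s) * (u * v * (w * e1) * e2) = u * v * w * (e1 * e2 / (s * q)) / q" for u v w e1 e2 :: real
      using q s by (simp add: field_simps)
    then show ?thesis
      unfolding c_def saddle_def L_def[symmetric] s_def[symmetric] R_def[symmetric] e q_def[symmetric] unfolding pi .
  qed
  finally show ?thesis by simp
qed

end

section \<open>Asymptotics in terms of the inverse function\<close>

lemma asymp_equiv_of_ratio:
  assumes "((\<lambda>x. f x / g x) \<longlongrightarrow> (1::real)) F"
  shows "f \<sim>[F] g"
  using assms by (rule asymp_equivI')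

lemma set_integrable_Icc_bounded:
  fixes f :: "real \<Rightarrow> real"
  assumes "(\<lambda>r. indicator {k..x} r *\<^sub>R f r) \<in> borel_measurable borel" "\<And>r. r \<in> {k..x} \<Longrightarrow> \<bar>f r\<bar> \<le> B"
  shows "set_integrable lborel {k..x} f"
  unfolding set_integrable_def
proof (rule Bochner_Integration.integrable_bound)
  show "integrable lborel (\<lambda>r. indicator {k..x} r * B)"
    by (intro integrable_mult_left integrable_real_indicator) (auto simp: emeasure_lborel_Icc_eq)
  show "AE r in lborel. norm (indicator {k..x} r *\<^sub>R f r) \<le> norm (indicator {k..x} r * B)"
  proof (rule AE_I2)
    fix r
    show "norm (indicator {k..x} r *\<^sub>R f r) \<le> norm (indicator {k..x} r * B)"
      using assms(2)[of r] by (cases "r \<in> {k..x}") auto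
  qed
qed (use assms(1) in simp)

context unbounded_bernstein
begin

lemma inv_mono: "k \<le> x \<Longrightarrow> x \<le> y \<Longrightarrow> inv\<phi> x \<le> inv\<phi> y"
  using inv_strict_mono[of x y] by (cases "x = y") auto

text \<open>
  The integrand \<open>inv\<phi> r / r\<close> stays bounded also when \<open>k = 0\<close> and \<open>r\<close> is close to \<open>0\<close>, because \<open>\<phi>\<close> is there
  bounded below by a linear function.
\<close>

lemma inv_ratio_bound: "\<bar>inv\<phi> r / r\<bar> \<le> max 1 (inv\<phi> x) / \<phi> 1" if r: "r \<in> {k..x}"
proof (cases "r = 0")
  case True
  then show ?thesis using phi_pos[of 1] by simp
next
  case False
  define u where "u = inv\<phi> r"
  have u: "0 \<le> u" "\<phi> u = r" using inv_nonneg[of r] phi_inv[of r] r by (auto simp: u_def)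
  have r0: "0 < r" using False r k_nonneg by simp
  have p1: "0 < \<phi> 1" by (rule phi_pos) simp
  have "u * \<phi> 1 \<le> max 1 (inv\<phi> x) * r"
  proof (cases "u \<le> 1")
    case True
    then have "u * \<phi> 1 \<le> 1 * r" using phi_ge_linear[of u] u by simp
    also have "\<dots> \<le> max 1 (inv\<phi> x) * r" using r0 by (intro mult_right_mono) auto
    finally show ?thesis .
  next
    case False
    then have "\<phi> 1 \<le> r" using phi_mono[of 1 u] u by simp
    moreover have "u \<le> max 1 (inv\<phi> x)" using inv_mono[of r x] r by (simp add: u_def)
    ultimately show ?thesis using u p1 by (intro mult_mono) auto
  qed
  then have "u / r \<le> max 1 (inv\<phi> x) / \<phi> 1" using r0 p1 by (simp add: field_simps)
  then show ?thesis using u r0 by (simp add: u_def)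
qed

lemma set_integrable_inv: "set_integrable lborel {k..x} (\<lambda>r. inv\<phi> r / r)"
proof (rule set_integrable_Icc_bounded[OF _ inv_ratio_bound])
  have "mono_on {k..} inv\<phi>" by (auto simp: mono_on_def intro!: inv_mono)
  then have "inv\<phi> \<in> borel_measurable (restrict_space borel {k..})" by (rule borel_measurable_mono_on_fnc)
  then have "(\<lambda>r. indicator {k..} r *\<^sub>R inv\<phi> r) \<in> borel_measurable borel"
    by (subst (asm) borel_measurable_restrict_space_iff) auto
  then have "(\<lambda>r. indicator {k..x} r *\<^sub>R ((indicator {k..} r *\<^sub>R inv\<phi> r) / r)) \<in> borel_measurable borel" by measurable
  also have "(\<lambda>r. indicator {k..x} r *\<^sub>R ((indicator {k..} r *\<^sub>R inv\<phi> r) / r)) = (\<lambda>r. indicator {k..x} r *\<^sub>R (inv\<phi> r / r))"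
    by (auto simp: indicator_def fun_eq_iff)
  finally show "(\<lambda>r. indicator {k..x} r *\<^sub>R (inv\<phi> r / r)) \<in> borel_measurable borel" .
qed

definition inv_integral :: "real \<Rightarrow> real" where
  "inv_integral x = (LBINT r:{k..x}. inv\<phi> r / r)"

lemma inv_integral_deriv: "(inv_integral has_real_derivative inv\<phi> x / x) (at x)" if x: "k < x"
proof -
  define b where "b = x + 1"
  let ?f = "\<lambda>r. inv\<phi> r / r"
  have eq: "inv_integral u = integral {k..u} ?f" for u
    unfolding inv_integral_def by (rule set_borel_integral_eq_integral(2)[OF set_integrable_inv])
  have int: "?f integrable_on {k..b}" by (rule set_borel_integral_eq_integral(1)[OF set_integrable_inv])
  have "isCont inv\<phi> x" by (rule DERIV_isCont[OF inv_deriv[OF x]])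
  then have "isCont ?f x" using x k_nonneg by (intro continuous_intros) auto
  then have c: "continuous (at x within {k..b}) ?f" by (rule continuous_at_imp_continuous_at_within)
  have "((\<lambda>u. integral {k..u} ?f) has_vector_derivative ?f x) (at x within {k..b})"
    using integral_has_vector_derivative_continuous_at[OF int, of x "{}"] c x by (simp add: b_def)
  then have "((\<lambda>u. integral {k..u} ?f) has_real_derivative ?f x) (at x within {k..b})"
    by (simp only: has_real_derivative_iff_has_vector_derivative)
  moreover have "at x within {k..b} = at x" by (rule at_within_Icc_at) (use x in \<open>auto simp: b_def\<close>)
  ultimately show ?thesis unfolding eq[abs_def] by simp
qed

lemma k_less_phi: "0 < u \<Longrightarrow> k < \<phi> u"
  using phi_strict_mono[of 0 u] by (simp add: phi_0)

end

context jurek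
begin

text \<open>
  The substitution \<open>r = \<phi> u\<close>, in the form of two functions with the same derivative.
\<close>

lemma phase_eq: "\<exists>c. \<forall>a>0. phase a = inv_integral (\<phi> a) + c"
proof -
  have "\<exists>c. \<forall>a\<in>{0<..}. phase a - inv_integral (\<phi> a) = c"
  proof (rule has_field_derivative_zero_constant)
    fix a :: real assume "a \<in> {0<..}"
    then have a: "0 < a" by simp
    have "((\<lambda>a. inv_integral (\<phi> a)) has_real_derivative (inv\<phi> (\<phi> a) / \<phi> a) * dphi a) (at a)"
      by (rule DERIV_chain2[OF inv_integral_deriv[OF k_less_phi[OF a]] phi_deriv[OF a]])
    moreover have "(inv\<phi> (\<phi> a) / \<phi> a) * dphi a = a * g a" using a by (simp add: inv_phi g_eq)
    ultimately have "((\<lambda>a. phase a - inv_integral (\<phi> a)) has_real_derivative a * g a - a * g a) (at a)"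
      using phase_deriv[OF a] by (intro DERIV_diff) simp_all
    then have "((\<lambda>a. phase a - inv_integral (\<phi> a)) has_real_derivative 0) (at a)" by simp
    then show "((\<lambda>a. phase a - inv_integral (\<phi> a)) has_real_derivative 0) (at a within {0<..})"
      by (rule has_field_derivative_at_within)
  qed auto
  then obtain c where "\<And>a. 0 < a \<Longrightarrow> phase a - inv_integral (\<phi> a) = c" by auto
  then have "\<forall>a>0. phase a = inv_integral (\<phi> a) + c" by (simp add: algebra_simps)
  then show ?thesis by blast
qed

text \<open>
  The constant of the theorem. It is obtained from \<open>\<phi>\<close> alone, before any \<open>t\<close> is fixed.
\<close>

lemma stirling_inv: "\<exists>C>0. ((\<lambda>a. Re (\<Psi> (of_real a)) - (a + 1 / 2) * ln (\<phi> a) + inv_integral (\<phi> a)) \<longlongrightarrow> ln C) at_top"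
proof -
  obtain c0 where c0: "((\<lambda>a. Re (\<Psi> (of_real a)) - (a + 1 / 2) * ln (\<phi> a) + phase a) \<longlongrightarrow> c0) at_top"
    using stirling by blast
  obtain c1 where c1: "\<And>a. 0 < a \<Longrightarrow> phase a = inv_integral (\<phi> a) + c1" using phase_eq by blast
  have "((\<lambda>a. Re (\<Psi> (of_real a)) - (a + 1 / 2) * ln (\<phi> a) + phase a - c1) \<longlongrightarrow> c0 - c1) at_top"
    by (intro tendsto_diff c0 tendsto_const)
  moreover have "\<forall>\<^sub>F a in at_top. Re (\<Psi> (of_real a)) - (a + 1 / 2) * ln (\<phi> a) + phase a - c1 = Re (\<Psi> (of_real a)) - (a + 1 / 2) * ln (\<phi> a) + inv_integral (\<phi> a)"
    using eventually_gt_at_top[of 0] by (rule eventually_mono) (simp add: c1)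
  ultimately have "((\<lambda>a. Re (\<Psi> (of_real a)) - (a + 1 / 2) * ln (\<phi> a) + inv_integral (\<phi> a)) \<longlongrightarrow> c0 - c1) at_top"
    by (rule Lim_transform_eventually)
  then show ?thesis by (intro exI[of _ "exp (c0 - c1)"]) simp
qed

end

context berg_urbanik
begin

text \<open>
  Inserting Stirling's formula. The half power of \<open>\<phi> a\<close> in it and the powers of \<open>\<phi> a\<close> and \<open>g a\<close> in the saddle
  point approximation combine to \<open>sqrt (x powr (1 - t) * inv\<phi>' x)\<close> as \<open>inv\<phi>' (\<phi> a) = 1 / (\<phi> a * g a)\<close>.
\<close>

lemma saddle_ratio:
  assumes C: "0 < C" "((\<lambda>a. Re (\<Psi> (of_real a)) - (a + 1 / 2) * ln (\<phi> a) + inv_integral (\<phi> a)) \<longlongrightarrow> ln C) at_top"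
  shows "((\<lambda>a. saddle a / (C powr t / sqrt (2 * pi * t) * sqrt (\<phi> a powr (1 - t) * deriv inv\<phi> (\<phi> a)) * exp (- t * inv_integral (\<phi> a)))) \<longlongrightarrow> 1) at_top"
proof -
  let ?R = "\<lambda>a. Re (\<Psi> (of_real a)) - (a + 1 / 2) * ln (\<phi> a) + inv_integral (\<phi> a)"
  have "((\<lambda>a. exp (t * (?R a - ln C)) * sqrt (g a / g (a + 1))) \<longlongrightarrow> exp (t * (ln C - ln C)) * sqrt 1) at_top"
    by (intro tendsto_intros C(2) g_ratio_tendsto)
  then have "((\<lambda>a. exp (t * (?R a - ln C)) * sqrt (g a / g (a + 1))) \<longlongrightarrow> 1) at_top" by simp
  moreover have "\<forall>\<^sub>F a in at_top. exp (t * (?R a - ln C)) * sqrt (g a / g (a + 1)) = saddle a / (C powr t / sqrt (2 * pi * t) * sqrt (\<phi> a powr (1 - t) * deriv inv\<phi> (\<phi> a)) * exp (- t * inv_integral (\<phi> a)))"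
    using eventually_gt_at_top[of 0]
  proof eventually_elim
    case (elim a)
    define L where "L = ln (\<phi> a)"
    define R where "R = Re (\<Psi> (of_real a))"
    define I where "I = inv_integral (\<phi> a)"
    define G where "G = sqrt (g a)"
    define G1 where "G1 = sqrt (g (a + 1))"
    define st where "st = sqrt t"
    define sp where "sp = sqrt (2 * pi)"
    have phi: "0 < \<phi> a" by (rule phi_pos[OF elim])
    have pos: "0 < G" "0 < G1" "0 < st" "0 < sp" using g_pos elim t_pos by (auto simp: G_def G1_def st_def sp_def)
    have "deriv inv\<phi> (\<phi> a) = inverse (dphi a)"
      using deriv_inv[OF k_less_phi[OF elim]] elim by (simp add: inv_phi)
    also have "dphi a = g a * \<phi> a" using g_eq[OF elim] phi by simp
    finally have "\<phi> a powr (1 - t) * deriv inv\<phi> (\<phi> a) = \<phi> a powr (- t) / g a"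
      using phi g_pos[OF elim] by (simp add: powr_diff powr_minus field_simps)
    also have "sqrt \<dots> = exp (- (t * L / 2)) / G"
    proof -
      have "\<phi> a powr (- t) = (exp (- (t * L / 2)))\<^sup>2" using phi by (simp add: powr_def L_def power2_eq_square exp_add[symmetric])
      then show ?thesis by (simp add: real_sqrt_divide G_def)
    qed
    finally have T: "C powr t / sqrt (2 * pi * t) * sqrt (\<phi> a powr (1 - t) * deriv inv\<phi> (\<phi> a)) * exp (- t * inv_integral (\<phi> a))
       = exp (t * ln C) / (sp * st) * (exp (- (t * L / 2)) / G) * exp (- (t * I))"
      using C(1) by (simp add: powr_def real_sqrt_mult sp_def st_def I_def)
    have S: "saddle a = exp (- (t * L)) * exp (t * (R - a * L)) / (st * G1 * sp)"
      by (simp add: saddle_def std_def real_sqrt_mult L_def R_def st_def G1_def sp_def)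
    have E: "exp (t * (R - (a + 1 / 2) * L + I - ln C)) = exp (- (t * L)) * exp (t * (R - a * L)) / (exp (t * ln C) * exp (- (t * L / 2)) * exp (- (t * I)))"
      unfolding exp_add[symmetric] exp_diff[symmetric] by (rule arg_cong[where f=exp]) (simp add: field_simps)
    have Q: "sqrt (g a / g (a + 1)) = G / G1" by (simp add: G_def G1_def real_sqrt_divide)
    show ?case
      unfolding T S Q unfolding L_def[symmetric] R_def[symmetric] I_def[symmetric] unfolding E using pos by (simp add: field_simps)
  qed
  ultimately show ?thesis by (rule Lim_transform_eventually)
qed

lemma local_integral_Re_tendsto: "((\<lambda>a. Re (local_integral n a) / sqrt (2 * pi)) \<longlongrightarrow> 1) at_top"
proof -
  have "((\<lambda>a. Re (local_integral n a) / sqrt (2 * pi)) \<longlongrightarrow> Re (of_real (sqrt (2 * pi))) / sqrt (2 * pi)) at_top"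
    by (intro tendsto_intros local_integral_tendsto) simp
  then show ?thesis by simp
qed

lemma higher_deriv_saddle:
  assumes a: "0 < a"
  shows "(deriv ^^ n) dens (\<phi> a powr t) = (-1) ^ n * a ^ n * \<phi> a powr (- (real n * t)) * saddle a * (Re (local_integral n a) / sqrt (2 * pi))"
proof -
  have "0 < \<phi> a powr t" using phi_pos[OF a] by simp
  then have "(deriv ^^ n) dens (\<phi> a powr t) = Re (of_real ((-1) ^ n * a ^ n * \<phi> a powr (- (real n * t)) * saddle a) * (local_integral n a / of_real (sqrt (2 * pi))))"
    using higher_deriv_dens[OF a] mellin_inverse_saddle[OF a] by simp
  also have "\<dots> = (-1) ^ n * a ^ n * \<phi> a powr (- (real n * t)) * saddle a * (Re (local_integral n a) / sqrt (2 * pi))"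
    by (simp only: Re_divide_of_real times_complex.sel Re_complex_of_real Im_complex_of_real mult_zero_left diff_0_right)
  finally show ?thesis .
qed

lemma saddle_pos: "0 < a \<Longrightarrow> 0 < saddle a"
  unfolding saddle_def using std_pos by simp

lemma asymp_equiv_via_inverse:
  assumes "((\<lambda>a. F (\<phi> a) / G (\<phi> a)) \<longlongrightarrow> (1::real)) at_top"
  shows "F \<sim>[at_top] G"
proof (rule asymp_equiv_of_ratio)
  have "((\<lambda>x. F (\<phi> (inv\<phi> x)) / G (\<phi> (inv\<phi> x))) \<longlongrightarrow> 1) at_top"
    by (rule filterlim_compose[OF assms inv_at_top])
  then show "((\<lambda>x. F x / G x) \<longlongrightarrow> 1) at_top"
    by (rule Lim_transform_eventually) (use eventually_ge_at_top[of k] in \<open>rule eventually_mono, simp add: phi_inv\<close>)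
qed

theorem dens_asymp:
  assumes C: "0 < C" "((\<lambda>a. Re (\<Psi> (of_real a)) - (a + 1 / 2) * ln (\<phi> a) + inv_integral (\<phi> a)) \<longlongrightarrow> ln C) at_top"
  shows "(\<lambda>x. dens (x powr t)) \<sim>[at_top] (\<lambda>x. C powr t / sqrt (2 * pi * t) * sqrt (x powr (1 - t) * deriv inv\<phi> x) * exp (- t * inv_integral x))"
proof (rule asymp_equiv_via_inverse)
  let ?T = "\<lambda>x. C powr t / sqrt (2 * pi * t) * sqrt (x powr (1 - t) * deriv inv\<phi> x) * exp (- t * inv_integral x)"
  have "((\<lambda>a. saddle a / ?T (\<phi> a) * (Re (local_integral 0 a) / sqrt (2 * pi))) \<longlongrightarrow> 1 * 1) at_top"
    by (rule tendsto_mult[OF saddle_ratio[OF C] local_integral_Re_tendsto])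
  then have "((\<lambda>a. saddle a / ?T (\<phi> a) * (Re (local_integral 0 a) / sqrt (2 * pi))) \<longlongrightarrow> 1) at_top" by simp
  moreover have "\<forall>\<^sub>F a in at_top. saddle a / ?T (\<phi> a) * (Re (local_integral 0 a) / sqrt (2 * pi)) = dens (\<phi> a powr t) / ?T (\<phi> a)"
    using eventually_gt_at_top[of 0]
  proof eventually_elim
    case (elim a)
    have "dens (\<phi> a powr t) = saddle a * (Re (local_integral 0 a) / sqrt (2 * pi))"
      using higher_deriv_saddle[OF elim, of 0] phi_pos[OF elim] by simp
    then show ?case by (simp only: times_divide_eq_left)
  qed
  ultimately show "((\<lambda>a. dens (\<phi> a powr t) / ?T (\<phi> a)) \<longlongrightarrow> 1) at_top"
    by (rule Lim_transform_eventually)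
qed

text \<open>
  The derivative and the density have the same saddle point approximation up to the factor \<open>(-1)\<^sup>n a\<^sup>n\<close>
  and a power of \<open>x\<close>; the Gaussian integrals cancel in the limit.
\<close>

theorem higher_deriv_asymp:
  "(\<lambda>x. (deriv ^^ n) dens (x powr t)) \<sim>[at_top] (\<lambda>x. (-1) ^ n * x powr (- (real n * t)) * inv\<phi> x ^ n * dens (x powr t))"
proof (rule asymp_equiv_via_inverse)
  let ?l = "\<lambda>n a. Re (local_integral n a) / sqrt (2 * pi)"
  have "((\<lambda>a. ?l n a / ?l 0 a) \<longlongrightarrow> 1 / 1) at_top"
    by (intro tendsto_divide local_integral_Re_tendsto) simp
  then have "((\<lambda>a. ?l n a / ?l 0 a) \<longlongrightarrow> 1) at_top" by simp
  moreover have "\<forall>\<^sub>F a in at_top. ?l n a / ?l 0 a = (deriv ^^ n) dens (\<phi> a powr t) / ((-1) ^ n * \<phi> a powr (- (real n * t)) * inv\<phi> (\<phi> a) ^ n * dens (\<phi> a powr t))"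
    using eventually_gt_at_top[of 0]
  proof eventually_elim
    case (elim a)
    have phi: "0 < \<phi> a" by (rule phi_pos[OF elim])
    have d0: "dens (\<phi> a powr t) = saddle a * ?l 0 a"
      using higher_deriv_saddle[OF elim, of 0] phi by simp
    define u where "u = (-1) ^ n * a ^ n * \<phi> a powr (- (real n * t)) * saddle a"
    have u: "u \<noteq> 0" using elim phi saddle_pos[OF elim] by (simp add: u_def)
    have "(-1) ^ n * \<phi> a powr (- (real n * t)) * inv\<phi> (\<phi> a) ^ n * dens (\<phi> a powr t) = u * ?l 0 a"
      using elim by (simp add: d0 u_def inv_phi)
    then show ?case
      using u unfolding higher_deriv_saddle[OF elim, of n] u_def[symmetric] by (simp only: nonzero_mult_divide_mult_cancel_left) simp
  qed
  ultimately show "((\<lambda>a. (deriv ^^ n) dens (\<phi> a powr t) / ((-1) ^ n * \<phi> a powr (- (real n * t)) * inv\<phi> (\<phi> a) ^ n * dens (\<phi> a powr t))) \<longlongrightarrow> 1) at_top"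
    by (rule Lim_transform_eventually)
qed

end

section \<open>Positive drift and power growth\<close>

context unbounded_bernstein
begin

lemma inv_over_tendsto_of_drift: "((\<lambda>x. x / inv\<phi> x) \<longlongrightarrow> d) at_top"
  and deriv_inv_tendsto_of_drift: "((\<lambda>x. d * deriv inv\<phi> x) \<longlongrightarrow> 1) at_top" if d: "0 < d"
proof -
  have "((\<lambda>x. \<phi> (inv\<phi> x) / inv\<phi> x) \<longlongrightarrow> d) at_top"
    by (rule filterlim_compose[OF phi_over_tendsto inv_at_top])
  then show "((\<lambda>x. x / inv\<phi> x) \<longlongrightarrow> d) at_top"
    by (rule Lim_transform_eventually) (use eventually_ge_at_top[of k] in \<open>rule eventually_mono, simp add: phi_inv\<close>)
  have "((\<lambda>x. d * inverse (dphi (inv\<phi> x))) \<longlongrightarrow> d * inverse d) at_top"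
    using d by (intro tendsto_intros filterlim_compose[OF dphi_tendsto inv_at_top]) simp
  then have "((\<lambda>x. d * inverse (dphi (inv\<phi> x))) \<longlongrightarrow> 1) at_top" using d by simp
  then show "((\<lambda>x. d * deriv inv\<phi> x) \<longlongrightarrow> 1) at_top"
    by (rule Lim_transform_eventually) (use eventually_gt_at_top[of k] in \<open>rule eventually_mono, simp add: deriv_inv\<close>)
qed

text \<open>
  For \<open>x = \<phi> u\<close> this is the integral of \<open>1 - exp (- u y)\<close> against \<open>\<mu>\<close>, the part of \<open>\<phi>\<close> that is neither constant
  nor linear.
\<close>

definition drift_error :: "real \<Rightarrow> real" where
  "drift_error x = x - k - d * inv\<phi> x"

lemma drift_error_nonneg: "0 \<le> drift_error x" if x: "k \<le> x"
proof -
  have "0 \<le> (\<integral>y. (1 - exp (- (inv\<phi> x * y))) \<partial>\<mu>)"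
    using AE_mu inv_nonneg[OF x] by (intro integral_nonneg_AE) (auto elim!: eventually_mono)
  then show ?thesis using phi_eq[OF inv_nonneg[OF x]] phi_inv[OF x] by (simp add: drift_error_def)
qed

text \<open>
  The quotient \<open>r / r\<close> is kept because it is \<open>0\<close> at \<open>r = 0\<close>, a point of the interval when \<open>k = 0\<close>; so the
  decomposition of \<open>drift_error r / r\<close> holds at every point.
\<close>

lemma set_integrable_ratio: "set_integrable lborel {k..x} (\<lambda>r. r / r)" "set_integrable lborel {k..x} (\<lambda>r. k / r)"
proof -
  show "set_integrable lborel {k..x} (\<lambda>r. r / r)"
    by (rule set_integrable_Icc_bounded[where B=1]) auto
  have "\<bar>k / r\<bar> \<le> 1" if "r \<in> {k..x}" for r
    using that k_nonneg by (cases "r = 0") (auto simp: divide_le_eq_1)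
  then show "set_integrable lborel {k..x} (\<lambda>r. k / r)"
    by (rule set_integrable_Icc_bounded[where B=1, rotated]) simp_all
qed

lemma drift_error_ratio: "drift_error r / r = r / r - k / r - d * (inv\<phi> r / r)"
  by (simp add: drift_error_def diff_divide_distrib)

lemma set_integrable_drift_error: "set_integrable lborel {k..x} (\<lambda>r. drift_error r / r)"
  unfolding drift_error_ratio
  by (intro set_integral_diff(1) set_integrable_mult_right set_integrable_ratio set_integrable_inv)

lemma integral_ratio_self: "(LBINT r:{k..x}. r / r) = x - k" if x: "k \<le> x"
proof -
  have "(LBINT r:{k..x}. r / r) = (LBINT r:{k..x}. 1)"
    unfolding set_lebesgue_integral_def
  proof (rule integral_cong_AE)
    show "AE r in lborel. indicator {k..x} r *\<^sub>R (r / r) = indicator {k..x} r *\<^sub>R (1::real)"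
      using AE_lborel_singleton[of "0::real"] by eventually_elim simp
  qed auto
  also have "\<dots> = x - k" using x by (simp add: set_lebesgue_integral_def)
  finally show ?thesis .
qed

lemma integral_ratio_k: "(LBINT r:{k..x}. k / r) = k * (ln x - ln k)" if x: "k \<le> x"
proof (cases "k = 0")
  case True
  then show ?thesis by (simp add: set_lebesgue_integral_def)
next
  case False
  then have k: "0 < k" using k_nonneg by simp
  have "((\<lambda>r. k / r) has_integral (k * ln x - k * ln k)) {k..x}"
  proof (rule fundamental_theorem_of_calculus[OF x])
    fix r assume "r \<in> {k..x}"
    then have "0 < r" using k by simp
    then have "((\<lambda>r. k * ln r) has_real_derivative k / r) (at r within {k..x})"
      by (auto intro!: derivative_eq_intros)
    then show "((\<lambda>r. k * ln r) has_vector_derivative k / r) (at r within {k..x})"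
      by (simp only: has_real_derivative_iff_has_vector_derivative)
  qed
  then have "integral {k..x} (\<lambda>r. k / r) = k * (ln x - ln k)" by (simp add: integral_unique right_diff_distrib)
  then show ?thesis using set_borel_integral_eq_integral(2)[OF set_integrable_ratio(2)[of x]] by simp
qed

lemma drift_error_integral:
  assumes "k \<le> x"
  shows "(LBINT r:{k..x}. drift_error r / r) = x - k - k * (ln x - ln k) - d * inv_integral x"
proof -
  have "(LBINT r:{k..x}. drift_error r / r) = (LBINT r:{k..x}. r / r) - (LBINT r:{k..x}. k / r) - (LBINT r:{k..x}. d * (inv\<phi> r / r))"
    unfolding drift_error_ratio
    by (subst set_integral_diff(2), intro set_integral_diff(1) set_integrable_ratio, intro set_integrable_mult_right set_integrable_inv,
        subst set_integral_diff(2), rule set_integrable_ratio, rule set_integrable_ratio, rule refl)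
  then show ?thesis
    using assms by (simp only: integral_ratio_self integral_ratio_k set_integral_mult_right inv_integral_def)
qed

lemma drift_error_smallo: "0 < d \<Longrightarrow> drift_error \<in> o[at_top](\<lambda>u. u)"
proof (rule smalloI_tendsto)
  assume d: "0 < d"
  have "((\<lambda>x. 1 - k / x - d * inverse (x / inv\<phi> x)) \<longlongrightarrow> 1 - 0 - d * inverse d) at_top"
    using d by (intro tendsto_intros inv_over_tendsto_of_drift tendsto_divide_0[OF tendsto_const] filterlim_at_top_imp_at_infinity filterlim_ident) auto
  then have "((\<lambda>x. 1 - k / x - d * inverse (x / inv\<phi> x)) \<longlongrightarrow> 0) at_top" using d by simp
  then show "((\<lambda>x. drift_error x / x) \<longlongrightarrow> 0) at_top"
    by (rule Lim_transform_eventually)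
       (use eventually_gt_at_top[of 0] in \<open>rule eventually_mono, simp add: drift_error_ratio\<close>)
  show "\<forall>\<^sub>F x in at_top. x \<noteq> (0::real)" by (rule eventually_at_top_not_equal)
qed

text \<open>
  The exponents agree after inserting \<open>inv\<phi> r = (r - k - drift_error r) / d\<close>, which produces the power of \<open>x\<close>
  from the integral of \<open>k / r\<close> and the constant \<open>c\<close> from its lower end point. The quotient is
  \<open>sqrt (d * inv\<phi>' x)\<close>.
\<close>

lemma asymp_form_of_drift:
  assumes d: "0 < d" and t: "0 < t" and C: "0 < C"
  defines "c \<equiv> C * exp (k / d - k / d * ln k)"
  shows "(\<lambda>x. C powr t / sqrt (2 * pi * t) * sqrt (x powr (1 - t) * deriv inv\<phi> x) * exp (- t * inv_integral x))
     \<sim>[at_top] (\<lambda>x. (c * d powr (- 1 / (2 * t))) powr t / sqrt (2 * pi * t) * x powr ((d + t * (2 * k - d)) / (2 * d))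
         * exp (- (t * x / d) + t / d * (LBINT r:{k..x}. drift_error r / r)))"
proof (rule asymp_equiv_of_ratio)
  let ?F = "\<lambda>x. C powr t / sqrt (2 * pi * t) * sqrt (x powr (1 - t) * deriv inv\<phi> x) * exp (- t * inv_integral x)"
  let ?G = "\<lambda>x. (c * d powr (- 1 / (2 * t))) powr t / sqrt (2 * pi * t) * x powr ((d + t * (2 * k - d)) / (2 * d))
         * exp (- (t * x / d) + t / d * (LBINT r:{k..x}. drift_error r / r))"
  have "((\<lambda>x. sqrt (d * deriv inv\<phi> x)) \<longlongrightarrow> sqrt 1) at_top"
    by (intro tendsto_intros deriv_inv_tendsto_of_drift d)
  moreover have "\<forall>\<^sub>F x in at_top. sqrt (d * deriv inv\<phi> x) = ?F x / ?G x"
    using eventually_gt_at_top[of k]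
  proof eventually_elim
    case (elim x)
    have x: "0 < x" using elim k_nonneg by simp
    define D where "D = deriv inv\<phi> x"
    have D: "0 < D" using deriv_inv[OF elim] dphi_pos[OF inv_pos[OF elim]] by (simp add: D_def)
    define I where "I = inv_integral x"
    define q where "q = sqrt (2 * pi * t)"
    have q: "0 < q" using t by (simp add: q_def)
    have 1: "sqrt (x powr (1 - t) * D) = exp ((1 - t) / 2 * ln x) * sqrt D"
    proof -
      have "x powr (1 - t) = (exp ((1 - t) / 2 * ln x))\<^sup>2" using x by (simp add: powr_def power2_eq_square exp_add[symmetric])
      then show ?thesis by (simp add: real_sqrt_mult)
    qed
    have 2: "(c * d powr (- 1 / (2 * t))) powr t = exp (t * ln C + t * (k / d - k / d * ln k)) / sqrt d"
    proof -
      have "(c * d powr (- 1 / (2 * t))) powr t = c powr t * (d powr (- 1 / (2 * t))) powr t"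
        by (rule powr_mult)
      also have "(d powr (- 1 / (2 * t))) powr t = d powr (- (1 / 2))" using t by (simp add: powr_powr)
      also have "\<dots> = 1 / sqrt d" using d by (simp add: powr_minus powr_half_sqrt inverse_eq_divide)
      also have "c powr t = exp (t * ln C + t * (k / d - k / d * ln k))"
        using C by (simp add: c_def powr_def ln_mult distrib_left)
      finally show ?thesis by simp
    qed
    have 3: "x powr ((d + t * (2 * k - d)) / (2 * d)) = exp (((d + t * (2 * k - d)) / (2 * d)) * ln x)"
      using x by (simp add: powr_def)
    have 4: "(LBINT r:{k..x}. drift_error r / r) = x - k - k * (ln x - ln k) - d * I"
      unfolding I_def by (rule drift_error_integral) (use elim in simp)
    have 5: "exp (t * ln C + t * (k / d - k / d * ln k)) * exp (((d + t * (2 * k - d)) / (2 * d)) * ln x) * exp (- (t * x / d) + t / d * (x - k - k * (ln x - ln k) - d * I))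
       = exp (t * ln C) * exp ((1 - t) / 2 * ln x) * exp (- t * I)"
      unfolding exp_add[symmetric] by (rule arg_cong[where f=exp]) (use d in \<open>simp add: field_simps\<close>)
    have "?G x = (exp (t * ln C + t * (k / d - k / d * ln k)) * exp (((d + t * (2 * k - d)) / (2 * d)) * ln x) * exp (- (t * x / d) + t / d * (x - k - k * (ln x - ln k) - d * I))) / (sqrt d * q)"
      unfolding 2 3 4 q_def by simp
    also have "\<dots> = exp (t * ln C) * exp ((1 - t) / 2 * ln x) * exp (- t * I) / (sqrt d * q)" unfolding 5 ..
    finally have G: "?G x = exp (t * ln C) * exp ((1 - t) / 2 * ln x) * exp (- t * I) / (sqrt d * q)" .
    have F: "?F x = exp (t * ln C) * exp ((1 - t) / 2 * ln x) * exp (- t * I) * sqrt D / q"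
      unfolding D_def[symmetric] 1 using C by (simp add: powr_def I_def q_def)
    have alg: "sqrt d * s = P * s / q / (P / (sqrt d * q))" if "P \<noteq> 0" for P s :: real
      using that q d by (simp add: field_simps)
    show ?case unfolding F G unfolding D_def[symmetric] real_sqrt_mult by (rule alg) simp
  qed
  ultimately have "((\<lambda>x. ?F x / ?G x) \<longlongrightarrow> sqrt 1) at_top" by (rule Lim_transform_eventually)
  then show "((\<lambda>x. ?F x / ?G x) \<longlongrightarrow> 1) at_top" by simp
qed

lemma deriv_form_of_drift:
  assumes d: "0 < d"
  shows "(\<lambda>x. (-1) ^ n * x powr (- (real n * t)) * inv\<phi> x ^ n * F x) \<sim>[at_top] (\<lambda>x. (-1) ^ n * d powr (- real n) * x powr (real n * (1 - t)) * F x)"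
proof (rule asymp_equiv_mult[OF _ asymp_equiv_refl])
  have "(\<lambda>x. x powr (- (real n * t)) * inv\<phi> x ^ n) \<sim>[at_top] (\<lambda>x. d powr (- real n) * x powr (real n * (1 - t)))"
  proof (rule asymp_equiv_of_ratio)
    have "((\<lambda>x. (d * inverse (x / inv\<phi> x)) ^ n) \<longlongrightarrow> (d * inverse d) ^ n) at_top"
      using d by (intro tendsto_intros inv_over_tendsto_of_drift) auto
    then have "((\<lambda>x. (d * inverse (x / inv\<phi> x)) ^ n) \<longlongrightarrow> 1) at_top" using d by simp
    moreover have "\<forall>\<^sub>F x in at_top. (d * inverse (x / inv\<phi> x)) ^ n = x powr (- (real n * t)) * inv\<phi> x ^ n / (d powr (- real n) * x powr (real n * (1 - t)))"
      using eventually_gt_at_top[of 0]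
    proof eventually_elim
      case (elim x)
      have "x powr (real n * (1 - t)) = x ^ n * x powr (- (real n * t))"
        using elim by (simp add: powr_realpow[symmetric] powr_add[symmetric] algebra_simps)
      moreover have "d powr (- real n) = 1 / d ^ n" using d by (simp add: powr_minus powr_realpow inverse_eq_divide)
      ultimately show ?case using elim d by (simp add: power_mult_distrib power_divide field_simps)
    qed
    ultimately show "((\<lambda>x. x powr (- (real n * t)) * inv\<phi> x ^ n / (d powr (- real n) * x powr (real n * (1 - t)))) \<longlongrightarrow> 1) at_top"
      by (rule Lim_transform_eventually)
  qed
  from asymp_equiv_mult[OF asymp_equiv_refl[of "\<lambda>x. (-1) ^ n"] this]
  show "(\<lambda>x. (-1) ^ n * x powr (- (real n * t)) * inv\<phi> x ^ n) \<sim>[at_top] (\<lambda>x. (-1) ^ n * d powr (- real n) * x powr (real n * (1 - t)))"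
    by (simp add: mult.assoc)
qed

context
  fixes \<alpha> A :: real
  assumes \<alpha>: "0 < \<alpha>" "\<alpha> < 1" and A: "0 < A" and rv: "\<phi> \<sim>[at_top] (\<lambda>u. A * u powr \<alpha>)"
begin

lemma phi_power_ratio: "((\<lambda>u. \<phi> u / u powr \<alpha>) \<longlongrightarrow> A) at_top"
proof -
  have "\<forall>\<^sub>F u in at_top. A * u powr \<alpha> \<noteq> 0"
    using eventually_gt_at_top[of 0] by (rule eventually_mono) (use A in simp)
  with rv have "((\<lambda>u. \<phi> u / (A * u powr \<alpha>)) \<longlongrightarrow> 1) at_top" by (rule asymp_equivD_strong[OF _ eventually_mono]) simp
  then have "((\<lambda>u. A * (\<phi> u / (A * u powr \<alpha>))) \<longlongrightarrow> A * 1) at_top" by (intro tendsto_intros)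
  then show ?thesis using A by simp
qed

text \<open>
  The monotone density theorem: as \<open>\<phi>'\<close> is nonincreasing, it lies between the slopes of the chords over
  \<open>[l u, u]\<close> and \<open>[u, l u]\<close>, whose limits as \<open>u \<rightarrow> \<infinity>\<close> tend to \<open>A \<alpha>\<close> as \<open>l \<rightarrow> 1\<close>.
\<close>

lemma dphi_power_ratio: "((\<lambda>u. dphi u * u powr (1 - \<alpha>)) \<longlongrightarrow> A * \<alpha>) at_top"
proof -
  have slope: "((\<lambda>l. A * ((l powr \<alpha> - 1) / (l - 1))) \<longlongrightarrow> A * \<alpha>) (at 1)"
  proof -
    have "((\<lambda>l::real. l powr \<alpha>) has_real_derivative \<alpha>) (at 1)"
      by (auto intro!: derivative_eq_intros)
    then have "((\<lambda>l. (l powr \<alpha> - 1 powr \<alpha>) / (l - 1)) \<longlongrightarrow> \<alpha>) (at 1)" by (simp only: has_field_derivative_iff)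
    then show ?thesis by (intro tendsto_intros) simp
  qed
  have chord: "((\<lambda>u. (\<phi> (l * u) - \<phi> u) / (l * u - u) * u powr (1 - \<alpha>)) \<longlongrightarrow> A * ((l powr \<alpha> - 1) / (l - 1))) at_top"
    if l: "0 < l" "l \<noteq> 1" for l
  proof -
    have "filterlim (\<lambda>u. l * u) at_top at_top"
      by (rule filterlim_tendsto_pos_mult_at_top[OF tendsto_const l(1) filterlim_ident])
    from filterlim_compose[OF phi_power_ratio this]
    have "((\<lambda>u. \<phi> (l * u) / (l * u) powr \<alpha>) \<longlongrightarrow> A) at_top" .
    then have "((\<lambda>u. (l powr \<alpha> * (\<phi> (l * u) / (l * u) powr \<alpha>) - \<phi> u / u powr \<alpha>) / (l - 1)) \<longlongrightarrow> (l powr \<alpha> * A - A) / (l - 1)) at_top"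
      using l by (intro tendsto_intros phi_power_ratio) auto
    moreover have "\<forall>\<^sub>F u in at_top. (l powr \<alpha> * (\<phi> (l * u) / (l * u) powr \<alpha>) - \<phi> u / u powr \<alpha>) / (l - 1) = (\<phi> (l * u) - \<phi> u) / (l * u - u) * u powr (1 - \<alpha>)"
      using eventually_gt_at_top[of 0]
    proof eventually_elim
      case (elim u)
      have "l powr \<alpha> * (\<phi> (l * u) / (l * u) powr \<alpha>) = \<phi> (l * u) / u powr \<alpha>" using l elim by (simp add: powr_mult)
      moreover have "u powr (1 - \<alpha>) = u / u powr \<alpha>" using elim by (simp add: powr_diff)
      moreover have "(x / v - y / v) / (l - 1) = (x - y) / (l * u - u) * (u / v)" if "v \<noteq> 0" for x y v
      proof -
        have "l * u - u = (l - 1) * u" by (simp add: algebra_simps)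
        then show ?thesis using that elim l by (simp add: diff_divide_distrib[symmetric])
      qed
      ultimately show ?case using elim by simp
    qed
    moreover have "(l powr \<alpha> * A - A) / (l - 1) = A * ((l powr \<alpha> - 1) / (l - 1))" by (simp add: algebra_simps)
    ultimately show ?thesis by (simp add: Lim_transform_eventually)
  qed
  have mvt: "\<exists>z. u < z \<and> z < v \<and> \<phi> v - \<phi> u = (v - u) * dphi z" if "0 < u" "u < v" for u v
    by (rule MVT2[OF that(2)]) (use that in \<open>auto intro!: phi_deriv\<close>)
  show ?thesis
  proof (rule order_tendstoI)
    fix c assume c: "c < A * \<alpha>"
    have "((\<lambda>l. A * ((l powr \<alpha> - 1) / (l - 1))) \<longlongrightarrow> A * \<alpha>) (at_right 1)" by (rule tendsto_mono[OF at_le slope]) simp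
    from order_tendstoD(1)[OF this c] have "\<forall>\<^sub>F l in at_right 1. c < A * ((l powr \<alpha> - 1) / (l - 1))" .
    from eventually_happens[OF eventually_conj[OF this eventually_at_right_less]] obtain l where l: "c < A * ((l powr \<alpha> - 1) / (l - 1))" "1 < l" by auto
    have "\<forall>\<^sub>F u in at_top. c < (\<phi> (l * u) - \<phi> u) / (l * u - u) * u powr (1 - \<alpha>)"
      using chord[of l] l by (intro order_tendstoD(1)) auto
    then show "\<forall>\<^sub>F u in at_top. c < dphi u * u powr (1 - \<alpha>)"
      using eventually_gt_at_top[of 0]
    proof eventually_elim
      case (elim u)
      have ul: "u < l * u" using elim l by simp
      obtain z where z: "u < z" "\<phi> (l * u) - \<phi> u = (l * u - u) * dphi z" using mvt[OF _ ul] elim by blast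
      have "l * u - u \<noteq> 0" using ul by linarith
      then have "(\<phi> (l * u) - \<phi> u) / (l * u - u) = dphi z" unfolding z(2) by (rule nonzero_mult_div_cancel_left)
      also have "\<dots> \<le> dphi u" using z elim by (intro dphi_antimono) auto
      finally have "(\<phi> (l * u) - \<phi> u) / (l * u - u) * u powr (1 - \<alpha>) \<le> dphi u * u powr (1 - \<alpha>)" by (intro mult_right_mono) auto
      then show ?case using elim by linarith
    qed
  next
    fix c assume c: "A * \<alpha> < c"
    have "((\<lambda>l. A * ((l powr \<alpha> - 1) / (l - 1))) \<longlongrightarrow> A * \<alpha>) (at_left 1)" by (rule tendsto_mono[OF at_le slope]) simp
    from order_tendstoD(2)[OF this c] have "\<forall>\<^sub>F l in at_left 1. A * ((l powr \<alpha> - 1) / (l - 1)) < c" .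
    moreover have "\<forall>\<^sub>F l in at_left (1::real). l \<in> {0<..<1}" by (rule eventually_at_left_real) simp
    ultimately have "\<forall>\<^sub>F l in at_left 1. A * ((l powr \<alpha> - 1) / (l - 1)) < c \<and> l \<in> {0<..<1}" by (rule eventually_conj)
    from eventually_happens[OF this] obtain l where l: "A * ((l powr \<alpha> - 1) / (l - 1)) < c" "0 < l" "l < 1" by auto
    have "\<forall>\<^sub>F u in at_top. (\<phi> (l * u) - \<phi> u) / (l * u - u) * u powr (1 - \<alpha>) < c"
      using chord[of l] l by (intro order_tendstoD(2)) auto
    then show "\<forall>\<^sub>F u in at_top. dphi u * u powr (1 - \<alpha>) < c"
      using eventually_gt_at_top[of 0]
    proof eventually_elim
      case (elim u)
      have ul: "l * u < u" "0 < l * u" using elim l by simp_all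
      obtain z where z: "l * u < z" "z < u" "\<phi> u - \<phi> (l * u) = (u - l * u) * dphi z" using mvt[OF ul(2,1)] by blast
      have "dphi u \<le> dphi z" using z ul by (intro dphi_antimono) auto
      also have "\<dots> = (\<phi> (l * u) - \<phi> u) / (l * u - u)"
      proof -
        have eq: "\<phi> (l * u) - \<phi> u = (l * u - u) * dphi z" using z(3) by (simp add: algebra_simps)
        show ?thesis unfolding eq by (rule nonzero_mult_div_cancel_left[symmetric]) (use ul in linarith)
      qed
      finally have "dphi u * u powr (1 - \<alpha>) \<le> (\<phi> (l * u) - \<phi> u) / (l * u - u) * u powr (1 - \<alpha>)" by (intro mult_right_mono) auto
      then show ?case using elim by linarith
    qed
  qed
qed

lemma inv_power_ratio: "((\<lambda>x. inv\<phi> x / x powr (1 / \<alpha>)) \<longlongrightarrow> A powr (- 1 / \<alpha>)) at_top"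
proof -
  have "((\<lambda>x. \<phi> (inv\<phi> x) / inv\<phi> x powr \<alpha>) \<longlongrightarrow> A) at_top"
    by (rule filterlim_compose[OF phi_power_ratio inv_at_top])
  then have "((\<lambda>x. (\<phi> (inv\<phi> x) / inv\<phi> x powr \<alpha>) powr (- 1 / \<alpha>)) \<longlongrightarrow> A powr (- 1 / \<alpha>)) at_top"
    using A by (intro tendsto_intros) auto
  moreover have "\<forall>\<^sub>F x in at_top. (\<phi> (inv\<phi> x) / inv\<phi> x powr \<alpha>) powr (- 1 / \<alpha>) = inv\<phi> x / x powr (1 / \<alpha>)"
    using eventually_gt_at_top[of k]
  proof eventually_elim
    case (elim x)
    have i: "0 < inv\<phi> x" "0 < x" using inv_pos[OF elim] elim k_nonneg by auto
    have "(x / inv\<phi> x powr \<alpha>) powr (- 1 / \<alpha>) = x powr (- 1 / \<alpha>) / (inv\<phi> x powr \<alpha>) powr (- 1 / \<alpha>)"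
      using i by (simp add: powr_divide)
    also have "(inv\<phi> x powr \<alpha>) powr (- 1 / \<alpha>) = inverse (inv\<phi> x)"
      using \<alpha> i by (simp add: powr_powr powr_minus)
    also have "x powr (- 1 / \<alpha>) = inverse (x powr (1 / \<alpha>))" by (simp add: powr_minus[symmetric])
    finally show ?case using elim by (simp add: phi_inv field_simps)
  qed
  ultimately show ?thesis by (rule Lim_transform_eventually)
qed

lemma deriv_inv_power_ratio: "((\<lambda>x. deriv inv\<phi> x / (A powr (- 1 / \<alpha>) / \<alpha> * x powr (1 / \<alpha> - 1))) \<longlongrightarrow> 1) at_top"
proof -
  let ?B = "A powr (- 1 / \<alpha>)"
  have B: "0 < ?B" using A by simp
  have 1: "((\<lambda>x. dphi (inv\<phi> x) * inv\<phi> x powr (1 - \<alpha>)) \<longlongrightarrow> A * \<alpha>) at_top"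
    by (rule filterlim_compose[OF dphi_power_ratio inv_at_top])
  have "((\<lambda>x. (inv\<phi> x / x powr (1 / \<alpha>)) powr (1 - \<alpha>) * inverse (dphi (inv\<phi> x) * inv\<phi> x powr (1 - \<alpha>)) / (?B / \<alpha>)) \<longlongrightarrow> ?B powr (1 - \<alpha>) * inverse (A * \<alpha>) / (?B / \<alpha>)) at_top"
    using B A \<alpha> by (intro tendsto_intros inv_power_ratio 1) auto
  moreover have "?B powr (1 - \<alpha>) * inverse (A * \<alpha>) / (?B / \<alpha>) = 1"
  proof -
    have "?B powr (1 - \<alpha>) = ?B * A"
    proof -
      have "- 1 / \<alpha> * (1 - \<alpha>) = - 1 / \<alpha> + 1" using \<alpha> by (simp add: field_simps)
      then have "?B powr (1 - \<alpha>) = A powr (- 1 / \<alpha> + 1)" by (simp only: powr_powr)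
      also have "\<dots> = ?B * A powr 1" by (rule powr_add)
      finally show ?thesis using A by simp
    qed
    then show ?thesis using A \<alpha> by simp
  qed
  ultimately have "((\<lambda>x. (inv\<phi> x / x powr (1 / \<alpha>)) powr (1 - \<alpha>) * inverse (dphi (inv\<phi> x) * inv\<phi> x powr (1 - \<alpha>)) / (?B / \<alpha>)) \<longlongrightarrow> 1) at_top" by simp
  moreover have "\<forall>\<^sub>F x in at_top. (inv\<phi> x / x powr (1 / \<alpha>)) powr (1 - \<alpha>) * inverse (dphi (inv\<phi> x) * inv\<phi> x powr (1 - \<alpha>)) / (?B / \<alpha>) = deriv inv\<phi> x / (?B / \<alpha> * x powr (1 / \<alpha> - 1))"
    using eventually_gt_at_top[of k]
  proof eventually_elim
    case (elim x)
    have i: "0 < inv\<phi> x" "0 < x" using inv_pos[OF elim] elim k_nonneg by auto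
    have 2: "(inv\<phi> x / x powr (1 / \<alpha>)) powr (1 - \<alpha>) = inv\<phi> x powr (1 - \<alpha>) / x powr (1 / \<alpha> - 1)"
    proof -
      have "(1 / \<alpha>) * (1 - \<alpha>) = 1 / \<alpha> - 1" using \<alpha> by (simp add: field_simps)
      then show ?thesis using i by (simp add: powr_divide powr_powr)
    qed
    have alg: "p / y * inverse (e * p) / b = inverse e / (b * y)" if "p \<noteq> 0" for p y e b :: real
      using that by (simp add: field_simps)
    show ?case unfolding 2 deriv_inv[OF elim] by (rule alg) (use i in simp)
  qed
  ultimately show ?thesis by (rule Lim_transform_eventually)
qed

definition power_error :: "real \<Rightarrow> real" where
  "power_error r = A powr (- 1 / \<alpha>) * r powr (1 / \<alpha>) - inv\<phi> r"

lemma power_error_ratio: "power_error r / r = A powr (- 1 / \<alpha>) * (r powr (1 / \<alpha>) / r) - inv\<phi> r / r"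
  by (simp add: power_error_def diff_divide_distrib)

lemma set_integrable_power: "set_integrable lborel {k..x} (\<lambda>r. r powr (1 / \<alpha>) / r)"
proof (rule set_integrable_Icc_bounded)
  fix r assume r: "r \<in> {k..x}"
  show "\<bar>r powr (1 / \<alpha>) / r\<bar> \<le> x powr (1 / \<alpha> - 1)"
  proof (cases "r = 0")
    case False
    then have r0: "0 < r" using r k_nonneg by simp
    have "r powr (1 / \<alpha>) / r = r powr (1 / \<alpha> - 1)" using r0 by (simp add: powr_diff)
    also have "\<dots> \<le> x powr (1 / \<alpha> - 1)" using r r0 \<alpha> by (intro powr_mono2) (auto simp: field_simps)
    finally show ?thesis using r0 by simp
  qed simp
qed measurable

lemma set_integrable_power_error: "set_integrable lborel {k..x} (\<lambda>r. power_error r / r)"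
  unfolding power_error_ratio
  by (intro set_integral_diff(1) set_integrable_mult_right set_integrable_power set_integrable_inv)

lemma integral_power: "(LBINT r:{k..x}. r powr (1 / \<alpha>) / r) = \<alpha> * (x powr (1 / \<alpha>) - k powr (1 / \<alpha>))" if x: "k \<le> x"
proof -
  have "((\<lambda>r. r powr (1 / \<alpha>) / r) has_integral (\<alpha> * x powr (1 / \<alpha>) - \<alpha> * k powr (1 / \<alpha>))) {k..x}"
  proof (rule fundamental_theorem_of_calculus_interior[OF x])
    show "continuous_on {k..x} (\<lambda>r. \<alpha> * r powr (1 / \<alpha>))"
      using \<alpha> k_nonneg by (intro continuous_intros continuous_on_powr') auto
    fix r assume "r \<in> {k<..<x}"
    then have r: "0 < r" using k_nonneg by simp
    have "((\<lambda>r. r powr (1 / \<alpha>)) has_real_derivative (1 / \<alpha> * r powr (1 / \<alpha> - 1))) (at r)"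
      by (rule has_real_derivative_powr[OF r])
    then have "((\<lambda>r. \<alpha> * r powr (1 / \<alpha>)) has_real_derivative \<alpha> * (1 / \<alpha> * r powr (1 / \<alpha> - 1))) (at r)"
      by (rule DERIV_cmult)
    moreover have "\<alpha> * (1 / \<alpha> * r powr (1 / \<alpha> - 1)) = r powr (1 / \<alpha>) / r" using \<alpha> r by (simp add: powr_diff)
    ultimately show "((\<lambda>r. \<alpha> * r powr (1 / \<alpha>)) has_vector_derivative r powr (1 / \<alpha>) / r) (at r)"
      by (simp only: has_real_derivative_iff_has_vector_derivative)
  qed
  then have "integral {k..x} (\<lambda>r. r powr (1 / \<alpha>) / r) = \<alpha> * (x powr (1 / \<alpha>) - k powr (1 / \<alpha>))" by (simp add: integral_unique right_diff_distrib)
  then show ?thesis using set_borel_integral_eq_integral(2)[OF set_integrable_power[of x]] by simp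
qed

lemma power_error_integral:
  assumes "k \<le> x"
  shows "(LBINT r:{k..x}. power_error r / r) = A powr (- 1 / \<alpha>) * (\<alpha> * (x powr (1 / \<alpha>) - k powr (1 / \<alpha>))) - inv_integral x"
proof -
  have "(LBINT r:{k..x}. power_error r / r) = (LBINT r:{k..x}. A powr (- 1 / \<alpha>) * (r powr (1 / \<alpha>) / r)) - (LBINT r:{k..x}. inv\<phi> r / r)"
    unfolding power_error_ratio
    by (rule set_integral_diff(2)) (intro set_integrable_mult_right set_integrable_power set_integrable_inv)+
  then show ?thesis
    using assms by (simp only: integral_power set_integral_mult_right inv_integral_def)
qed

lemma power_error_smallo: "(\<lambda>u. power_error (u powr \<alpha>)) \<in> o[at_top](\<lambda>u. u)"
proof (rule smalloI_tendsto)
  have "filterlim (\<lambda>u::real. u powr \<alpha>) at_top at_top" using \<alpha>(1) by real_asymp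
  from filterlim_compose[OF inv_power_ratio this]
  have "((\<lambda>u. inv\<phi> (u powr \<alpha>) / (u powr \<alpha>) powr (1 / \<alpha>)) \<longlongrightarrow> A powr (- 1 / \<alpha>)) at_top" .
  then have "((\<lambda>u. A powr (- 1 / \<alpha>) - inv\<phi> (u powr \<alpha>) / (u powr \<alpha>) powr (1 / \<alpha>)) \<longlongrightarrow> A powr (- 1 / \<alpha>) - A powr (- 1 / \<alpha>)) at_top"
    by (intro tendsto_diff tendsto_const)
  then have "((\<lambda>u. A powr (- 1 / \<alpha>) - inv\<phi> (u powr \<alpha>) / (u powr \<alpha>) powr (1 / \<alpha>)) \<longlongrightarrow> 0) at_top" by simp
  moreover have "\<forall>\<^sub>F u in at_top. A powr (- 1 / \<alpha>) - inv\<phi> (u powr \<alpha>) / (u powr \<alpha>) powr (1 / \<alpha>) = power_error (u powr \<alpha>) / u"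
    using eventually_gt_at_top[of 0]
  proof eventually_elim
    case (elim u)
    have "(u powr \<alpha>) powr (1 / \<alpha>) = u" using elim \<alpha> by (simp add: powr_powr)
    then show ?case using elim by (simp add: power_error_def diff_divide_distrib)
  qed
  ultimately show "((\<lambda>u. power_error (u powr \<alpha>) / u) \<longlongrightarrow> 0) at_top" by (rule Lim_transform_eventually)
  show "\<forall>\<^sub>F x in at_top. x \<noteq> (0::real)" by (rule eventually_at_top_not_equal)
qed

text \<open>
  Here \<open>inv\<phi> r = A powr (- 1/\<alpha>) * r powr (1/\<alpha>) - power_error r\<close>; the first term integrates to the
  leading exponent, up to the constant in \<open>c\<close> that comes from the lower end point \<open>k\<close>. The quotient is
  governed by \<open>deriv_inv_power_ratio\<close>.
\<close>

lemma asymp_form_of_power: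
  assumes t: "0 < t" and C: "0 < C"
  defines "c \<equiv> C * exp (A powr (- 1 / \<alpha>) * \<alpha> * k powr (1 / \<alpha>))"
  shows "(\<lambda>x. C powr t / sqrt (2 * pi * t) * sqrt (x powr (1 - t) * deriv inv\<phi> x) * exp (- t * inv_integral x))
     \<sim>[at_top] (\<lambda>x. (c * (A powr (- 1 / \<alpha>) / \<alpha>) powr (1 / (2 * t))) powr t / sqrt (2 * pi * t) * x powr ((1 - \<alpha> * t) / (2 * \<alpha>))
         * exp (- (t * \<alpha> * A powr (- 1 / \<alpha>) * x powr (1 / \<alpha>)) + t * (LBINT r:{k..x}. power_error r / r)))"
proof (rule asymp_equiv_of_ratio)
  let ?B = "A powr (- 1 / \<alpha>)"
  let ?F = "\<lambda>x. C powr t / sqrt (2 * pi * t) * sqrt (x powr (1 - t) * deriv inv\<phi> x) * exp (- t * inv_integral x)"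
  let ?G = "\<lambda>x. (c * (?B / \<alpha>) powr (1 / (2 * t))) powr t / sqrt (2 * pi * t) * x powr ((1 - \<alpha> * t) / (2 * \<alpha>))
         * exp (- (t * \<alpha> * ?B * x powr (1 / \<alpha>)) + t * (LBINT r:{k..x}. power_error r / r))"
  have "((\<lambda>x. sqrt (deriv inv\<phi> x / (?B / \<alpha> * x powr (1 / \<alpha> - 1)))) \<longlongrightarrow> sqrt 1) at_top"
    by (intro tendsto_intros deriv_inv_power_ratio)
  moreover have "\<forall>\<^sub>F x in at_top. sqrt (deriv inv\<phi> x / (?B / \<alpha> * x powr (1 / \<alpha> - 1))) = ?F x / ?G x"
    using eventually_gt_at_top[of k]
  proof eventually_elim
    case (elim x)
    have x: "0 < x" using elim k_nonneg by simp
    define b where "b = ?B"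
    define e where "e = b / \<alpha>"
    have e: "0 < e" using A \<alpha> by (simp add: e_def b_def)
    define D where "D = deriv inv\<phi> x"
    define I where "I = inv_integral x"
    define q where "q = sqrt (2 * pi * t)"
    have q: "0 < q" using t by (simp add: q_def)
    have sq: "sqrt (x powr p) = exp (p / 2 * ln x)" for p
    proof -
      have "x powr p = (exp (p / 2 * ln x))\<^sup>2" using x by (simp add: powr_def power2_eq_square exp_add[symmetric])
      then show ?thesis by simp
    qed
    have 2: "(c * e powr (1 / (2 * t))) powr t = exp (t * ln C + t * (b * \<alpha> * k powr (1 / \<alpha>))) * sqrt e"
    proof -
      have "(c * e powr (1 / (2 * t))) powr t = c powr t * (e powr (1 / (2 * t))) powr t"
        by (rule powr_mult)
      also have "(e powr (1 / (2 * t))) powr t = e powr (1 / 2)" using t by (simp add: powr_powr)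
      also have "\<dots> = sqrt e" using e by (simp add: powr_half_sqrt)
      also have "c powr t = exp (t * ln C + t * (b * \<alpha> * k powr (1 / \<alpha>)))"
        using C by (simp add: c_def powr_def[of "C * _"] ln_mult distrib_left b_def)
      finally show ?thesis .
    qed
    have 3: "x powr ((1 - \<alpha> * t) / (2 * \<alpha>)) = exp (((1 - \<alpha> * t) / (2 * \<alpha>)) * ln x)"
      using x by (simp add: powr_def)
    have 4: "(LBINT r:{k..x}. power_error r / r) = b * (\<alpha> * (x powr (1 / \<alpha>) - k powr (1 / \<alpha>))) - I"
      unfolding I_def b_def by (rule power_error_integral) (use elim in simp)
    have 5: "exp (t * ln C + t * (b * \<alpha> * k powr (1 / \<alpha>))) * exp (((1 - \<alpha> * t) / (2 * \<alpha>)) * ln x) * exp (- (t * \<alpha> * b * x powr (1 / \<alpha>)) + t * (b * (\<alpha> * (x powr (1 / \<alpha>) - k powr (1 / \<alpha>))) - I))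
       = exp (t * ln C) * exp ((1 - t) / 2 * ln x) * exp ((1 / \<alpha> - 1) / 2 * ln x) * exp (- t * I)"
      unfolding exp_add[symmetric] by (rule arg_cong[where f=exp]) (use \<alpha> in \<open>simp add: field_simps\<close>)
    have "?G x = (exp (t * ln C + t * (b * \<alpha> * k powr (1 / \<alpha>))) * exp (((1 - \<alpha> * t) / (2 * \<alpha>)) * ln x) * exp (- (t * \<alpha> * b * x powr (1 / \<alpha>)) + t * (b * (\<alpha> * (x powr (1 / \<alpha>) - k powr (1 / \<alpha>))) - I))) * sqrt e / q"
      unfolding b_def[symmetric] e_def[symmetric] 2 3 4 q_def by simp
    also have "\<dots> = exp (t * ln C) * exp ((1 - t) / 2 * ln x) * exp ((1 / \<alpha> - 1) / 2 * ln x) * exp (- t * I) * sqrt e / q" unfolding 5 ..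
    finally have G: "?G x = exp (t * ln C) * exp ((1 - t) / 2 * ln x) * exp ((1 / \<alpha> - 1) / 2 * ln x) * exp (- t * I) * sqrt e / q" .
    have F: "?F x = exp (t * ln C) * (exp ((1 - t) / 2 * ln x) * sqrt D) * exp (- t * I) / q"
      unfolding D_def[symmetric] real_sqrt_mult[of "x powr (1 - t)"] sq using C by (simp add: powr_def I_def q_def)
    have L: "sqrt (D / (e * x powr (1 / \<alpha> - 1))) = sqrt D / (sqrt e * exp ((1 / \<alpha> - 1) / 2 * ln x))"
      by (simp only: real_sqrt_divide real_sqrt_mult sq)
    have alg: "s / (se * p2) = p0 * (p1 * s) * p3 / q / (p0 * p1 * p2 * p3 * se / q)" if "p0 \<noteq> 0" "p1 \<noteq> 0" "p2 \<noteq> 0" "p3 \<noteq> 0" "se \<noteq> 0" for p0 p1 p2 p3 s se :: real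
      using that q by (simp add: field_simps)
    show ?case unfolding F G unfolding D_def[symmetric] b_def[symmetric] unfolding e_def[symmetric] L
      by (rule alg) (use e in auto)
  qed
  ultimately have "((\<lambda>x. ?F x / ?G x) \<longlongrightarrow> sqrt 1) at_top" by (rule Lim_transform_eventually)
  then show "((\<lambda>x. ?F x / ?G x) \<longlongrightarrow> 1) at_top" by simp
qed

lemma deriv_form_of_power:
  "(\<lambda>x. (-1) ^ n * x powr (- (real n * t)) * inv\<phi> x ^ n * F x) \<sim>[at_top] (\<lambda>x. (-1) ^ n * A powr (- real n / \<alpha>) * x powr (real n / \<alpha> * (1 - \<alpha> * t)) * F x)"
proof (rule asymp_equiv_mult[OF _ asymp_equiv_refl])
  let ?B = "A powr (- 1 / \<alpha>)"
  have B: "0 < ?B" using A by simp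
  have "(\<lambda>x. x powr (- (real n * t)) * inv\<phi> x ^ n) \<sim>[at_top] (\<lambda>x. A powr (- real n / \<alpha>) * x powr (real n / \<alpha> * (1 - \<alpha> * t)))"
  proof (rule asymp_equiv_of_ratio)
    have "((\<lambda>x. (inv\<phi> x / x powr (1 / \<alpha>) / ?B) ^ n) \<longlongrightarrow> (?B / ?B) ^ n) at_top"
      using B by (intro tendsto_intros inv_power_ratio) auto
    then have "((\<lambda>x. (inv\<phi> x / x powr (1 / \<alpha>) / ?B) ^ n) \<longlongrightarrow> 1) at_top" using B by simp
    moreover have "\<forall>\<^sub>F x in at_top. (inv\<phi> x / x powr (1 / \<alpha>) / ?B) ^ n = x powr (- (real n * t)) * inv\<phi> x ^ n / (A powr (- real n / \<alpha>) * x powr (real n / \<alpha> * (1 - \<alpha> * t)))"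
      using eventually_gt_at_top[of 0]
    proof eventually_elim
      case (elim x)
      have "x powr (real n / \<alpha> * (1 - \<alpha> * t)) = x powr (1 / \<alpha> * real n + - (real n * t))"
        using \<alpha> by (intro arg_cong[where f="\<lambda>p. x powr p"]) (simp add: field_simps)
      also have "\<dots> = (x powr (1 / \<alpha>)) ^ n * x powr (- (real n * t))"
        using elim by (simp only: powr_add powr_powr[symmetric]) (simp add: powr_realpow)
      finally have 1: "x powr (real n / \<alpha> * (1 - \<alpha> * t)) = (x powr (1 / \<alpha>)) ^ n * x powr (- (real n * t))" .
      have "A powr (- real n / \<alpha>) = A powr (- 1 / \<alpha> * real n)" by simp
      also have "\<dots> = ?B ^ n" using B by (simp only: powr_powr[symmetric] powr_realpow)
      finally have 2: "A powr (- real n / \<alpha>) = ?B ^ n" .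
      show ?case unfolding 1 2 using elim by (simp add: power_divide power_mult_distrib mult.commute)
    qed
    ultimately show "((\<lambda>x. x powr (- (real n * t)) * inv\<phi> x ^ n / (A powr (- real n / \<alpha>) * x powr (real n / \<alpha> * (1 - \<alpha> * t)))) \<longlongrightarrow> 1) at_top"
      by (rule Lim_transform_eventually)
  qed
  from asymp_equiv_mult[OF asymp_equiv_refl[of "\<lambda>x. (-1) ^ n"] this]
  show "(\<lambda>x. (-1) ^ n * x powr (- (real n * t)) * inv\<phi> x ^ n) \<sim>[at_top] (\<lambda>x. (-1) ^ n * A powr (- real n / \<alpha>) * x powr (real n / \<alpha> * (1 - \<alpha> * t)))"
    by (simp add: mult.assoc)
qed

end

end


theorem theorem2p5:
  fixes \<phi> :: "real \<Rightarrow> real" and k d :: real and \<mu> :: "real measure"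
    and \<nu> :: "real \<Rightarrow> real measure"
  assumes "bernstein_triplet \<phi> k d \<mu>"
    and "filterlim \<phi> at_top at_top"
    and "\<forall>\<tau>\<in>{0<..<1}. (\<lambda>u. \<phi> u powr \<tau>) \<in> Bernstein_J"
    and "berg_urbanik_semigroup \<phi> \<nu>"
  shows "\<exists>p :: real \<Rightarrow> real \<Rightarrow> real.
    (\<forall>t>0. has_pos_density (\<nu> t) (p t) \<and> p t \<in> C0_infinity) \<and>
    (\<exists>C>0. \<forall>t>0.
       (\<lambda>x. p t (x powr t)) \<sim>[at_top]
       (\<lambda>x. C powr t / sqrt (2 * pi * t)
            * sqrt (x powr (1 - t) * deriv (bernstein_inv \<phi>) x)
            * exp (- t * (LBINT r:{k..x}. bernstein_inv \<phi> r / r)))) \<and>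
    (\<forall>n. \<forall>t>0.
       (\<lambda>x. (deriv ^^ n) (p t) (x powr t)) \<sim>[at_top]
       (\<lambda>x. (-1) ^ n * x powr (- (real n * t)) * bernstein_inv \<phi> x ^ n
            * p t (x powr t))) \<and>
    (d > 0 \<longrightarrow>
       (\<exists>(Ct :: real \<Rightarrow> real) (E :: real \<Rightarrow> real).
          (\<exists>c>0. \<forall>t>0. Ct t = c * d powr (- 1 / (2 * t))) \<and>
          (\<forall>u\<ge>k. 0 \<le> E u) \<and>
          (\<forall>x\<ge>k. set_integrable lborel {k..x} (\<lambda>r. E r / r)) \<and>
          E \<in> o[at_top](\<lambda>u. u) \<and>
          (\<forall>t>0.
             (\<lambda>x. p t (x powr t)) \<sim>[at_top]
             (\<lambda>x. Ct t powr t / sqrt (2 * pi * t)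
                  * x powr ((d + t * (2 * k - d)) / (2 * d))
                  * exp (- (t * x / d) + t / d * (LBINT r:{k..x}. E r / r))))) \<and>
       (\<forall>n. \<forall>t>0.
          (\<lambda>x. (deriv ^^ n) (p t) (x powr t)) \<sim>[at_top]
          (\<lambda>x. (-1) ^ n * d powr (- real n) * x powr (real n * (1 - t))
               * p t (x powr t)))) \<and>
    (\<forall>\<alpha> A. 0 < \<alpha> \<and> \<alpha> < 1 \<and> 0 < A \<and> \<phi> \<sim>[at_top] (\<lambda>u. A * u powr \<alpha>) \<longrightarrow>
       (\<exists>(Cb :: real \<Rightarrow> real) (H :: real \<Rightarrow> real).
          (\<exists>c>0. \<forall>t>0. Cb t = c * (A powr (- 1 / \<alpha>) / \<alpha>) powr (1 / (2 * t))) \<and>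
          (\<forall>x\<ge>k. set_integrable lborel {k..x} (\<lambda>r. H r / r)) \<and>
          (\<lambda>u. H (u powr \<alpha>)) \<in> o[at_top](\<lambda>u. u) \<and>
          (\<forall>t>0.
             (\<lambda>x. p t (x powr t)) \<sim>[at_top]
             (\<lambda>x. Cb t powr t / sqrt (2 * pi * t)
                  * x powr ((1 - \<alpha> * t) / (2 * \<alpha>))
                  * exp (- (t * \<alpha> * A powr (- 1 / \<alpha>) * x powr (1 / \<alpha>))
                         + t * (LBINT r:{k..x}. H r / r))))) \<and>
       (\<forall>n. \<forall>t>0.
          (\<lambda>x. (deriv ^^ n) (p t) (x powr t)) \<sim>[at_top]
          (\<lambda>x. (-1) ^ n * A powr (- real n / \<alpha>) * x powr (real n / \<alpha> * (1 - \<alpha> * t))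
               * p t (x powr t))))"
proof -
  obtain \<kappa> where \<kappa>: "log_deriv_measure \<phi> \<kappa>"
    and mellin: "\<And>t z. 0 \<le> t \<Longrightarrow> 0 < Re z \<Longrightarrow> (\<integral>x. of_real x powr z \<partial>\<nu> t) = exp (of_real t * berg_urbanik_exponent \<phi> \<kappa> z)"
    and semi: "mult_conv_semigroup \<nu>"
    using assms(4) unfolding berg_urbanik_semigroup_def by blast
  interpret jurek \<phi> k d \<mu> \<kappa>
    by unfold_locales (rule assms(1) assms(2) \<kappa> assms(3))+
  have BU: "berg_urbanik \<phi> k d \<mu> \<kappa> (\<nu> t) t" if "0 < t" for t
  proof (rule berg_urbanik.intro[OF jurek_axioms], rule berg_urbanik_axioms.intro)
    have nn: "0 \<le> t" using that by simp
    show "0 < t" by (rule that)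
    show "prob_space (\<nu> t)" "pos_measure (\<nu> t)" using semi nn unfolding mult_conv_semigroup_def by blast+
    show "(\<integral>x. of_real x powr z \<partial>\<nu> t) = exp (of_real t * \<Psi> z)" if "0 < Re z" for z
      by (rule mellin[OF nn that])
  qed
  obtain C where C: "0 < C" "((\<lambda>a. Re (\<Psi> (of_real a)) - (a + 1 / 2) * ln (\<phi> a) + inv_integral (\<phi> a)) \<longlongrightarrow> ln C) at_top"
    using stirling_inv by blast
  define p where "p = (\<lambda>t. deriv (cdf (\<nu> t)))"
  have p_eq: "p t = berg_urbanik.dens (\<nu> t)" if "0 < t" for t
    unfolding p_def berg_urbanik.dens_def[OF BU[OF that]] ..
  have dens: "has_pos_density (\<nu> t) (p t) \<and> p t \<in> C0_infinity" if "0 < t" for t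
    using berg_urbanik.dens_density[OF BU[OF that]] berg_urbanik.dens_C0[OF BU[OF that]] by (simp add: p_eq[OF that])
  have main: "(\<lambda>x. p t (x powr t)) \<sim>[at_top] (\<lambda>x. C powr t / sqrt (2 * pi * t) * sqrt (x powr (1 - t) * deriv inv\<phi> x) * exp (- t * inv_integral x))" if "0 < t" for t
    using berg_urbanik.dens_asymp[OF BU[OF that] C] by (simp only: p_eq[OF that])
  have higher: "(\<lambda>x. (deriv ^^ n) (p t) (x powr t)) \<sim>[at_top] (\<lambda>x. (-1) ^ n * x powr (- (real n * t)) * inv\<phi> x ^ n * p t (x powr t))" if "0 < t" for t n
    using berg_urbanik.higher_deriv_asymp[OF BU[OF that], of n] by (simp only: p_eq[OF that])
  show ?thesis
  proof (intro exI[of _ p] conjI impI allI)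
    fix t :: real assume t: "0 < t"
    show "has_pos_density (\<nu> t) (p t)" "p t \<in> C0_infinity" using dens[OF t] by auto
  next
    show "\<exists>C>0. \<forall>t>0. (\<lambda>x. p t (x powr t)) \<sim>[at_top]
       (\<lambda>x. C powr t / sqrt (2 * pi * t) * sqrt (x powr (1 - t) * deriv (bernstein_inv \<phi>) x)
            * exp (- t * (LBINT r:{k..x}. bernstein_inv \<phi> r / r)))"
      by (intro exI[of _ C] conjI allI impI C(1) main[unfolded inv_integral_def])
  next
    fix n and t :: real assume t: "0 < t"
    show "(\<lambda>x. (deriv ^^ n) (p t) (x powr t)) \<sim>[at_top]
       (\<lambda>x. (-1) ^ n * x powr (- (real n * t)) * bernstein_inv \<phi> x ^ n * p t (x powr t))"
      by (rule higher[OF t])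
  next
    assume d: "0 < d"
    define c where "c = C * exp (k / d - k / d * ln k)"
    have "0 < c" using C(1) by (simp add: c_def)
    then have 1: "\<exists>c'>0. \<forall>t>0. c * d powr (- 1 / (2 * t)) = c' * d powr (- 1 / (2 * t))" by blast
    have 2: "(\<lambda>x. p t (x powr t)) \<sim>[at_top]
             (\<lambda>x. (c * d powr (- 1 / (2 * t))) powr t / sqrt (2 * pi * t)
                  * x powr ((d + t * (2 * k - d)) / (2 * d))
                  * exp (- (t * x / d) + t / d * (LBINT r:{k..x}. drift_error r / r)))" if t: "0 < t" for t
      by (rule asymp_equiv_trans[OF main[OF t] asymp_form_of_drift[OF d t C(1), folded c_def]])
    show "\<exists>(Ct :: real \<Rightarrow> real) (E :: real \<Rightarrow> real).
          (\<exists>c>0. \<forall>t>0. Ct t = c * d powr (- 1 / (2 * t))) \<and>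
          (\<forall>u\<ge>k. 0 \<le> E u) \<and>
          (\<forall>x\<ge>k. set_integrable lborel {k..x} (\<lambda>r. E r / r)) \<and>
          E \<in> o[at_top](\<lambda>u. u) \<and>
          (\<forall>t>0.
             (\<lambda>x. p t (x powr t)) \<sim>[at_top]
             (\<lambda>x. Ct t powr t / sqrt (2 * pi * t)
                  * x powr ((d + t * (2 * k - d)) / (2 * d))
                  * exp (- (t * x / d) + t / d * (LBINT r:{k..x}. E r / r))))"
    proof (rule exI[of _ "\<lambda>t. c * d powr (- 1 / (2 * t))"], rule exI[of _ drift_error], intro conjI)
      show "\<exists>c'>0. \<forall>t>0. c * d powr (- 1 / (2 * t)) = c' * d powr (- 1 / (2 * t))" by (rule 1)
      show "drift_error \<in> o[at_top](\<lambda>u. u)" by (rule drift_error_smallo[OF d])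
      show "\<forall>u\<ge>k. 0 \<le> drift_error u" by (intro allI impI drift_error_nonneg)
      show "\<forall>x\<ge>k. set_integrable lborel {k..x} (\<lambda>r. drift_error r / r)"
        by (intro allI impI set_integrable_drift_error)
    qed (intro allI impI 2, assumption)
  next
    fix n and t :: real assume d: "0 < d" and t: "0 < t"
    show "(\<lambda>x. (deriv ^^ n) (p t) (x powr t)) \<sim>[at_top]
          (\<lambda>x. (-1) ^ n * d powr (- real n) * x powr (real n * (1 - t)) * p t (x powr t))"
      by (rule asymp_equiv_trans[OF higher[OF t] deriv_form_of_drift[OF d]])
  next
    fix \<alpha> A :: real assume "0 < \<alpha> \<and> \<alpha> < 1 \<and> 0 < A \<and> \<phi> \<sim>[at_top] (\<lambda>u. A * u powr \<alpha>)"
    then have rv: "0 < \<alpha>" "\<alpha> < 1" "0 < A" "\<phi> \<sim>[at_top] (\<lambda>u. A * u powr \<alpha>)" by auto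
    define c where "c = C * exp (A powr (- 1 / \<alpha>) * \<alpha> * k powr (1 / \<alpha>))"
    have "0 < c" using C(1) by (simp add: c_def)
    then have 1: "\<exists>c'>0. \<forall>t>0. c * (A powr (- 1 / \<alpha>) / \<alpha>) powr (1 / (2 * t)) = c' * (A powr (- 1 / \<alpha>) / \<alpha>) powr (1 / (2 * t))" by blast
    have 2: "(\<lambda>x. p t (x powr t)) \<sim>[at_top]
             (\<lambda>x. (c * (A powr (- 1 / \<alpha>) / \<alpha>) powr (1 / (2 * t))) powr t / sqrt (2 * pi * t)
                  * x powr ((1 - \<alpha> * t) / (2 * \<alpha>))
                  * exp (- (t * \<alpha> * A powr (- 1 / \<alpha>) * x powr (1 / \<alpha>))
                         + t * (LBINT r:{k..x}. power_error \<alpha> A r / r)))" if t: "0 < t" for t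
      by (rule asymp_equiv_trans[OF main[OF t] asymp_form_of_power[OF rv t C(1), folded c_def]])
    show "\<exists>(Cb :: real \<Rightarrow> real) (H :: real \<Rightarrow> real).
          (\<exists>c>0. \<forall>t>0. Cb t = c * (A powr (- 1 / \<alpha>) / \<alpha>) powr (1 / (2 * t))) \<and>
          (\<forall>x\<ge>k. set_integrable lborel {k..x} (\<lambda>r. H r / r)) \<and>
          (\<lambda>u. H (u powr \<alpha>)) \<in> o[at_top](\<lambda>u. u) \<and>
          (\<forall>t>0.
             (\<lambda>x. p t (x powr t)) \<sim>[at_top]
             (\<lambda>x. Cb t powr t / sqrt (2 * pi * t)
                  * x powr ((1 - \<alpha> * t) / (2 * \<alpha>))
                  * exp (- (t * \<alpha> * A powr (- 1 / \<alpha>) * x powr (1 / \<alpha>))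
                         + t * (LBINT r:{k..x}. H r / r))))"
    proof (rule exI[of _ "\<lambda>t. c * (A powr (- 1 / \<alpha>) / \<alpha>) powr (1 / (2 * t))"], rule exI[of _ "power_error \<alpha> A"], intro conjI)
      show "\<exists>c'>0. \<forall>t>0. c * (A powr (- 1 / \<alpha>) / \<alpha>) powr (1 / (2 * t)) = c' * (A powr (- 1 / \<alpha>) / \<alpha>) powr (1 / (2 * t))" by (rule 1)
      show "(\<lambda>u. power_error \<alpha> A (u powr \<alpha>)) \<in> o[at_top](\<lambda>u. u)" by (rule power_error_smallo[OF rv])
      show "\<forall>x\<ge>k. set_integrable lborel {k..x} (\<lambda>r. power_error \<alpha> A r / r)"
        by (intro allI impI set_integrable_power_error[OF rv])
    qed (intro allI impI 2, assumption)
    fix n and t :: real assume t: "0 < t"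
    show "(\<lambda>x. (deriv ^^ n) (p t) (x powr t)) \<sim>[at_top]
          (\<lambda>x. (-1) ^ n * A powr (- real n / \<alpha>) * x powr (real n / \<alpha> * (1 - \<alpha> * t)) * p t (x powr t))"
      by (rule asymp_equiv_trans[OF higher[OF t] deriv_form_of_power[OF rv]])
  qed
qed

end
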